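(* Let $E$ be an arbitrary directed graph and $K$ a field. Let $f(x)=1+a_1x+\cdots+a_nx^n$, $n\ge1$, be an irreducible polynomial in $K[x,x^{-1}]$ and let $c=e_1e_2\cdots e_m$ be an exclusive cycle in $E$. Set $q=c^\infty$. Then the annihilator in $L_K(E)$ of the left module $V^f_{[q]}$ is $I(H(q),B_{H(q)},f(c))$, the two-sided ideal generated by $I(H(q),B_{H(q)})$ and $f(c)$.
   Context: A directed graph $E=(E^0,E^1,r,s)$ consists of sets $E^0$ (vertices), $E^1$ (edges), of any cardinality, and maps $r,s:E^1\to E^0$. A vertex $v$ is regular if $s^{-1}(v)$ is finite and non-empty, an infinite emitter if $s^{-1}(v)$ is infinite. Vertices are paths of length $0$; $u\ge v$ means there is a path from $u$ to $v$. A cycle based at $v$ is a path $e_1\cdots e_m$ ($m\ge1$) with $s(e_1)=r(e_m)=v$ and $s(e_i)\ne s(e_j)$ for $i\neq j$; cycles are considered up to rotation. A cycle $c$ is exclusive if no vertex on $c$ is the base of a cycle other than the rotate of $c$ based at that vertex. $c^\infty=ccc\cdots$. $L_K(E)$ (Leavitt path algebra) is the $K$-algebra generated by pairwise orthogonal idempotents $v\in E^0$ and elements $e,e^*$ ($e\in E^1$) with relations: $s(e)e=e=er(e)$; $r(e)e^*=e^*=e^*s(e)$; $e^*e=r(e)$ and $e^*g=0$ for $e\ne g$ in $E^1$; $v=\sum_{s(e)=v}ee^*$ for every regular vertex $v$. With $v=s(e_1)$ the base of $c$, $f(c)=v+a_1c+\cdots+a_nc^n\in L_K(E)$. For an infinite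 path $p$, $H(p)=E^0\setminus\{w\in E^0: w\ge u\text{ for some vertex }u\text{ on }p\}$, a hereditary saturated set (hereditary: $u\in H,u\ge u'$ imply $u'\in H$; saturated: a regular $u$ with $r(s^{-1}(u))\subseteq H$ lies in $H$). For a hereditary saturated $H$, $B_H$ is the set of infinite emitters $u\in E^0\setminus H$ with $1\le|s^{-1}(u)\cap r^{-1}(E^0\setminus H)|<\infty$; for $u\in B_H$, $u^H=u-\sum_{s(e)=u,\,r(e)\notin H}ee^*$; for $S\subseteq B_H$, $I(H,S)$ is the two-sided ideal of $L_K(E)$ generated by $H\cup\{u^H:u\in S\}$. For an infinite path $p=g_1g_2\cdots$ put $\tau_{>n}(p)=g_{n+1}g_{n+2}\cdots$; infinite paths $p,p'$ are tail-equivalent if $\tau_{>k}(p)=\tau_{>l}(p')$ for some positive integers $k,l$; $[p]$ is the class of $p$. Over a field $K'$, $V_{[q]}$ is the $K'$-space with basis $[q]$ and left $L_{K'}(E)$-action: $v\cdot p=p$ if $v=s(p)$, else $0$; $e\cdot p=ep$ if $r(e)=s(p)$, else $0$; $e^*\cdot p=\tau_{>1}(p)$ if $p=ep'$, else $0$. $V^f_{[q]}$: let $K'=K[x,x^{-1}]/(f(x))$, a field, $\overline x$ the class of $x$, and $\sigma$ the $K'$-algebra automorphism of $L_{K'}(E)$ fixing all vertices and all $e,e^*$ with $e\in E^1$, $e\ne e_1$, with $\sigma(e_1)=\overline xe_1$, $\sigma(e_1^* )=\overline x^{-1}e_1^*$. Then $V^f_{[q]}$ is the $L_{K'}(E)$-module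 $V_{[q]}$ twisted by $\sigma$, i.e. with action $a*m=\sigma(a)m$, with scalars restricted to $L_K(E)$. *)

theory Defs
  imports
    "HOL-Algebra.Module"
    "HOL-Algebra.QuotRing"
    "HOL-Algebra.Ring_Divisibility"
    "HOL-Algebra.Elementary_Groups"
    "HOL-Library.Stream"
    "Graph_Theory.Digraph"
    "Graph_Theory.Arc_Walk"
begin

section \<open>Free modules, semigroup algebras, ideals and quotients\<close>

definition supp :: "('k, 'm) ring_scheme \<Rightarrow> ('b \<Rightarrow> 'k) \<Rightarrow> 'b set" where
  "supp F a = {b. a b \<noteq> \<zero>\<^bsub>F\<^esub>}"

definition delta :: "('k, 'm) ring_scheme \<Rightarrow> 'b \<Rightarrow> ('b \<Rightarrow> 'k)" where
  "delta F b = (\<lambda>x. if x = b then \<one>\<^bsub>F\<^esub> else \<zero>\<^bsub>F\<^esub>)"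

definition finsupp :: "('k, 'm) ring_scheme \<Rightarrow> 'b set \<Rightarrow> ('b \<Rightarrow> 'k) set" where
  "finsupp F B = {a. (\<forall>b\<in>B. a b \<in> carrier F) \<and> supp F a \<subseteq> B \<and> finite (supp F a)}"

text \<open>The free module with basis \<open>B\<close>. The ring fields \<open>mult\<close> and \<open>one\<close> of the record carry
  no meaning for a module.\<close>

definition free_module ::
    "('k, 'm) ring_scheme \<Rightarrow> 'b set \<Rightarrow> ('k, 'b \<Rightarrow> 'k) module" where
  "free_module F B =
    \<lparr>carrier = finsupp F B, monoid.mult = undefined, one = undefined,
     ring.zero = (\<lambda>_. \<zero>\<^bsub>F\<^esub>), ring.add = (\<lambda>a b x. a x \<oplus>\<^bsub>F\<^esub> b x),
     smult = (\<lambda>k a x. k \<otimes>\<^bsub>F\<^esub> a x)\<rparr>"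

text \<open>The algebra \<open>F[M]\<close> with convolution product. Only the multiplication of \<open>M\<close> matters for
  the product, so \<open>M\<close> may be a semigroup whose \<open>one\<close> lies outside its carrier; \<open>F[M]\<close> is then a
  non-unital algebra, and its \<open>one\<close> lies outside its carrier as well.\<close>

definition monoid_algebra ::
    "('k, 'm) ring_scheme \<Rightarrow> ('b, 'n) monoid_scheme \<Rightarrow> ('k, 'b \<Rightarrow> 'k) module" where
  "monoid_algebra F M =
    \<lparr>carrier = finsupp F (carrier M),
     monoid.mult = (\<lambda>a b x. finsum F (\<lambda>(y, z). a y \<otimes>\<^bsub>F\<^esub> b z)
                      {(y, z). y \<in> supp F a \<and> z \<in> supp F b \<and> y \<otimes>\<^bsub>M\<^esub> z = x}),
     one = delta F \<one>\<^bsub>M\<^esub>,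
     ring.zero = (\<lambda>_. \<zero>\<^bsub>F\<^esub>), ring.add = (\<lambda>a b x. a x \<oplus>\<^bsub>F\<^esub> b x),
     smult = (\<lambda>k a x. k \<otimes>\<^bsub>F\<^esub> a x)\<rparr>"

text \<open>Two-sided ideals of a possibly non-unital \<open>F\<close>-algebra (the library's \<open>ideal\<close> presupposes
  a unital ring). They are required to be \<open>F\<close>-subspaces. This is needed in a free non-unital
  algebra; in a Leavitt path algebra it is automatic, because every element \<open>a\<close> satisfies
  \<open>a = ua\<close> for a finite sum \<open>u\<close> of vertices and so \<open>ka = (ku)a\<close>.\<close>

definition alg_ideal ::
    "('k, 'm) ring_scheme \<Rightarrow> ('k, 'a, 'n) module_scheme \<Rightarrow> 'a set \<Rightarrow> bool" where
  "alg_ideal F A I \<longleftrightarrow> submodule I F A \<and>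
    (\<forall>a \<in> carrier A. \<forall>x \<in> I. a \<otimes>\<^bsub>A\<^esub> x \<in> I \<and> x \<otimes>\<^bsub>A\<^esub> a \<in> I)"

definition alg_ideal_gen ::
    "('k, 'm) ring_scheme \<Rightarrow> ('k, 'a, 'n) module_scheme \<Rightarrow> 'a set \<Rightarrow> 'a set" where
  "alg_ideal_gen F A S = \<Inter>{I. alg_ideal F A I \<and> S \<subseteq> I}"

definition alg_quot :: "('k, 'a, 'n) module_scheme \<Rightarrow> 'a set \<Rightarrow> ('k, 'a set) module" where
  "alg_quot A J = ring.extend (A Quot J)
     (module.fields (\<lambda>k C. \<Union>a\<in>C. J +>\<^bsub>A\<^esub> (k \<odot>\<^bsub>A\<^esub> a)))"

text \<open>The product of a non-empty list; it does not involve the \<open>one\<close> of a non-unital algebra.\<close>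

fun list_mult :: "('a, 'm) monoid_scheme \<Rightarrow> 'a list \<Rightarrow> 'a" where
  "list_mult B [] = \<one>\<^bsub>B\<^esub>"
| "list_mult B [x] = x"
| "list_mult B (x # y # zs) = x \<otimes>\<^bsub>B\<^esub> list_mult B (y # zs)"

definition words :: "'x set \<Rightarrow> 'x list monoid" where
  "words G = \<lparr>carrier = lists G - {[]}, monoid.mult = (@), one = []\<rparr>"

definition free_algebra ::
    "('k, 'm) ring_scheme \<Rightarrow> 'x set \<Rightarrow> ('k, 'x list \<Rightarrow> 'k) module" where
  "free_algebra F G = monoid_algebra F (words G)"


section \<open>Leavitt path algebras\<close>

datatype ('v, 'e) gen = Vx 'v | Ed 'e | Gh 'e

definition lpa_gens :: "('v, 'e) pre_digraph \<Rightarrow> ('v, 'e) gen set" where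
  "lpa_gens E = Vx ` verts E \<union> Ed ` arcs E \<union> Gh ` arcs E"

definition regular_vertex :: "('v, 'e) pre_digraph \<Rightarrow> 'v \<Rightarrow> bool" where
  "regular_vertex E v \<longleftrightarrow> v \<in> verts E \<and> finite (out_arcs E v) \<and> out_arcs E v \<noteq> {}"

definition infinite_emitter :: "('v, 'e) pre_digraph \<Rightarrow> 'v \<Rightarrow> bool" where
  "infinite_emitter E v \<longleftrightarrow> v \<in> verts E \<and> infinite (out_arcs E v)"

abbreviation lpa_free ::
    "('k, 'm) ring_scheme \<Rightarrow> ('v, 'e) pre_digraph \<Rightarrow> ('k, ('v, 'e) gen list \<Rightarrow> 'k) module" where
  "lpa_free F E \<equiv> free_algebra F (lpa_gens E)"

text \<open>A relation \<open>l = r\<close> is represented by the element \<open>l \<ominus> r\<close> of the free algebra.\<close>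

inductive_set lpa_relations ::
    "('k, 'm) ring_scheme \<Rightarrow> ('v, 'e) pre_digraph \<Rightarrow> (('v, 'e) gen list \<Rightarrow> 'k) set"
  for F E where
  vertex_idem: "v \<in> verts E \<Longrightarrow>
    delta F [Vx v, Vx v] \<ominus>\<^bsub>lpa_free F E\<^esub> delta F [Vx v] \<in> lpa_relations F E"
| vertex_orth: "v \<in> verts E \<Longrightarrow> w \<in> verts E \<Longrightarrow> v \<noteq> w \<Longrightarrow>
    delta F [Vx v, Vx w] \<in> lpa_relations F E"
| edge_source: "e \<in> arcs E \<Longrightarrow>
    delta F [Vx (tail E e), Ed e] \<ominus>\<^bsub>lpa_free F E\<^esub> delta F [Ed e] \<in> lpa_relations F E"
| edge_range: "e \<in> arcs E \<Longrightarrow>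
    delta F [Ed e, Vx (head E e)] \<ominus>\<^bsub>lpa_free F E\<^esub> delta F [Ed e] \<in> lpa_relations F E"
| ghost_range: "e \<in> arcs E \<Longrightarrow>
    delta F [Vx (head E e), Gh e] \<ominus>\<^bsub>lpa_free F E\<^esub> delta F [Gh e] \<in> lpa_relations F E"
| ghost_source: "e \<in> arcs E \<Longrightarrow>
    delta F [Gh e, Vx (tail E e)] \<ominus>\<^bsub>lpa_free F E\<^esub> delta F [Gh e] \<in> lpa_relations F E"
| CK1_same: "e \<in> arcs E \<Longrightarrow>
    delta F [Gh e, Ed e] \<ominus>\<^bsub>lpa_free F E\<^esub> delta F [Vx (head E e)] \<in> lpa_relations F E"
| CK1_diff: "e \<in> arcs E \<Longrightarrow> g \<in> arcs E \<Longrightarrow> e \<noteq> g \<Longrightarrow>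
    delta F [Gh e, Ed g] \<in> lpa_relations F E"
| CK2: "regular_vertex E v \<Longrightarrow>
    delta F [Vx v] \<ominus>\<^bsub>lpa_free F E\<^esub>
      (\<Oplus>\<^bsub>lpa_free F E\<^esub> e \<in> out_arcs E v. delta F [Ed e, Gh e]) \<in> lpa_relations F E"

definition lpa_ideal0 ::
    "('k, 'm) ring_scheme \<Rightarrow> ('v, 'e) pre_digraph \<Rightarrow> (('v, 'e) gen list \<Rightarrow> 'k) set" where
  "lpa_ideal0 F E = alg_ideal_gen F (lpa_free F E) (lpa_relations F E)"

text \<open>The algebra \<open>L\<^sub>F(E)\<close>; its elements are cosets. It is unital only if \<open>E\<close> has finitely many
  vertices, and the field \<open>one\<close> of the record is not used.\<close>

definition lpa ::
    "('k, 'm) ring_scheme \<Rightarrow> ('v, 'e) pre_digraph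
      \<Rightarrow> ('k, (('v, 'e) gen list \<Rightarrow> 'k) set) module" where
  "lpa F E = alg_quot (lpa_free F E) (lpa_ideal0 F E)"

definition lpa_gen ::
    "('k, 'm) ring_scheme \<Rightarrow> ('v, 'e) pre_digraph \<Rightarrow> ('v, 'e) gen
      \<Rightarrow> (('v, 'e) gen list \<Rightarrow> 'k) set" where
  "lpa_gen F E g = lpa_ideal0 F E +>\<^bsub>lpa_free F E\<^esub> delta F [g]"

text \<open>The homomorphism from \<open>L\<^sub>F(E)\<close> to an algebra \<open>B\<close> which sends each generator \<open>g\<close> to
  \<open>\<phi> g\<close> and is semilinear along the homomorphism \<open>\<iota>\<close> of scalars. The value at a coset is the
  common value at its representatives; this is well defined when the \<open>\<phi> g\<close> satisfy the defining
  relations.\<close>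

definition lpa_hom ::
    "('k, 'm) ring_scheme \<Rightarrow> ('l, 'b, 'n) module_scheme \<Rightarrow> ('k \<Rightarrow> 'l) \<Rightarrow> (('v, 'e) gen \<Rightarrow> 'b)
      \<Rightarrow> (('v, 'e) gen list \<Rightarrow> 'k) set \<Rightarrow> 'b" where
  "lpa_hom F B \<iota> \<phi> C =
    the_elem ((\<lambda>a. \<Oplus>\<^bsub>B\<^esub> w \<in> supp F a. \<iota> (a w) \<odot>\<^bsub>B\<^esub> list_mult B (map \<phi> w)) ` C)"


section \<open>Infinite paths, exclusive cycles, and the ideals \<open>I(H,S)\<close>\<close>

definition infinite_path :: "('v, 'e) pre_digraph \<Rightarrow> 'e stream \<Rightarrow> bool" where
  "infinite_path E p \<longleftrightarrow>
    (\<forall>i. p !! i \<in> arcs E \<and> head E (p !! i) = tail E (p !! Suc i))"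

definition tail_equiv :: "'e stream \<Rightarrow> 'e stream \<Rightarrow> bool" where
  "tail_equiv p p' \<longleftrightarrow> (\<exists>k>0. \<exists>l>0. sdrop k p = sdrop l p')"

definition tail_class :: "('v, 'e) pre_digraph \<Rightarrow> 'e stream \<Rightarrow> 'e stream set" where
  "tail_class E q = {p. infinite_path E p \<and> tail_equiv p q}"

text \<open>A cycle is a non-empty edge list based at the source of its first edge. The library's
  \<open>pre_digraph.cycle\<close> requires the ranges of the edges to be distinct, which for a closed path
  is the same as distinctness of the sources. The rotates of \<open>c\<close> are the lists \<open>rotate k c\<close>.\<close>

definition exclusive_cycle :: "('v, 'e) pre_digraph \<Rightarrow> 'e list \<Rightarrow> bool" where
  "exclusive_cycle E c \<longleftrightarrow> pre_digraph.cycle E c \<and>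
    (\<forall>v \<in> tail E ` set c. \<forall>d. pre_digraph.cycle E d \<and> tail E (hd d) = v
        \<longrightarrow> (\<exists>k. d = rotate k c))"

definition H_path :: "('v, 'e) pre_digraph \<Rightarrow> 'e stream \<Rightarrow> 'v set" where
  "H_path E p = verts E - {w \<in> verts E. \<exists>u \<in> tail E ` sset p. w \<rightarrow>\<^sup>*\<^bsub>E\<^esub> u}"

definition breaking_vertices :: "('v, 'e) pre_digraph \<Rightarrow> 'v set \<Rightarrow> 'v set" where
  "breaking_vertices E H =
    {u \<in> verts E - H. infinite_emitter E u \<and>
       {e \<in> out_arcs E u. head E e \<in> verts E - H} \<noteq> {} \<and>
       finite {e \<in> out_arcs E u. head E e \<in> verts E - H}}"

definition breaking_elt ::
    "('k, 'm) ring_scheme \<Rightarrow> ('v, 'e) pre_digraph \<Rightarrow> 'v set \<Rightarrow> 'v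
      \<Rightarrow> (('v, 'e) gen list \<Rightarrow> 'k) set" where
  "breaking_elt F E H u = lpa_gen F E (Vx u) \<ominus>\<^bsub>lpa F E\<^esub>
    (\<Oplus>\<^bsub>lpa F E\<^esub> e \<in> {e \<in> out_arcs E u. head E e \<notin> H}.
        lpa_gen F E (Ed e) \<otimes>\<^bsub>lpa F E\<^esub> lpa_gen F E (Gh e))"

definition lpa_ideal ::
    "('k, 'm) ring_scheme \<Rightarrow> ('v, 'e) pre_digraph \<Rightarrow> 'v set \<Rightarrow> 'v set
      \<Rightarrow> (('v, 'e) gen list \<Rightarrow> 'k) set set" where
  "lpa_ideal F E H S = alg_ideal_gen F (lpa F E)
    ((\<lambda>v. lpa_gen F E (Vx v)) ` H \<union> breaking_elt F E H ` S)"


section \<open>The modules \<open>V\<^bsub>[q]\<^esub>\<close>\<close>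

fun basis_act ::
    "('k, 'm) ring_scheme \<Rightarrow> ('v, 'e) pre_digraph \<Rightarrow> ('v, 'e) gen \<Rightarrow> 'e stream
      \<Rightarrow> ('e stream \<Rightarrow> 'k)" where
  "basis_act F E (Vx v) p = (if v = tail E (shd p) then delta F p else (\<lambda>_. \<zero>\<^bsub>F\<^esub>))"
| "basis_act F E (Ed e) p = (if head E e = tail E (shd p) then delta F (e ## p) else (\<lambda>_. \<zero>\<^bsub>F\<^esub>))"
| "basis_act F E (Gh e) p = (if shd p = e then delta F (stl p) else (\<lambda>_. \<zero>\<^bsub>F\<^esub>))"

definition gen_act ::
    "('k, 'm) ring_scheme \<Rightarrow> ('v, 'e) pre_digraph \<Rightarrow> 'e stream \<Rightarrow> ('v, 'e) gen
      \<Rightarrow> ('e stream \<Rightarrow> 'k) \<Rightarrow> ('e stream \<Rightarrow> 'k)" where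
  "gen_act F E q g m =
    (\<Oplus>\<^bsub>free_module F (tail_class E q)\<^esub> p \<in> supp F m.
        m p \<odot>\<^bsub>free_module F (tail_class E q)\<^esub> basis_act F E g p)"

text \<open>The action of \<open>L\<^sub>F(E)\<close> determined by the generators. As for \<open>lpa_hom\<close>, the value for a
  coset is the common value for its representatives.\<close>

definition chen_act ::
    "('k, 'm) ring_scheme \<Rightarrow> ('v, 'e) pre_digraph \<Rightarrow> 'e stream
      \<Rightarrow> (('v, 'e) gen list \<Rightarrow> 'k) set \<Rightarrow> ('e stream \<Rightarrow> 'k) \<Rightarrow> ('e stream \<Rightarrow> 'k)" where
  "chen_act F E q C m =
    the_elem ((\<lambda>a. \<Oplus>\<^bsub>free_module F (tail_class E q)\<^esub> w \<in> supp F a.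
        a w \<odot>\<^bsub>free_module F (tail_class E q)\<^esub> foldr (gen_act F E q) w m) ` C)"

text \<open>The left \<open>L\<^sub>F(E)\<close>-module \<open>V\<^bsub>[q]\<^esub>\<close>: its \<open>smult\<close> is the action of \<open>L\<^sub>F(E)\<close>, not of \<open>F\<close>.\<close>

definition chen_module ::
    "('k, 'm) ring_scheme \<Rightarrow> ('v, 'e) pre_digraph \<Rightarrow> 'e stream
      \<Rightarrow> ((('v, 'e) gen list \<Rightarrow> 'k) set, 'e stream \<Rightarrow> 'k) module" where
  "chen_module F E q =
    \<lparr>carrier = carrier (free_module F (tail_class E q)), monoid.mult = undefined, one = undefined,
     ring.zero = ring.zero (free_module F (tail_class E q)),
     ring.add = ring.add (free_module F (tail_class E q)),
     smult = chen_act F E q\<rparr>"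

definition annihilator :: "('a, 'm) ring_scheme \<Rightarrow> ('a, 'b, 'n) module_scheme \<Rightarrow> 'a set" where
  "annihilator L V = {a \<in> carrier L. \<forall>m \<in> carrier V. a \<odot>\<^bsub>V\<^esub> m = \<zero>\<^bsub>V\<^esub>}"


section \<open>Laurent polynomials and the modules \<open>V\<^sup>f\<^bsub>[q]\<^esub>\<close>\<close>

definition laurent :: "('k, 'm) ring_scheme \<Rightarrow> ('k, int \<Rightarrow> 'k) module" where
  "laurent K = monoid_algebra K integer_group"

text \<open>\<open>f(x) = 1 + a\<^sub>1 x + \<dots> + a\<^sub>n x\<^sup>n\<close>, where the variable \<open>x\<close> is \<open>delta K 1\<close>.\<close>

definition laurent_poly :: "('k, 'm) ring_scheme \<Rightarrow> (nat \<Rightarrow> 'k) \<Rightarrow> nat \<Rightarrow> (int \<Rightarrow> 'k)" where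
  "laurent_poly K a n = \<one>\<^bsub>laurent K\<^esub> \<oplus>\<^bsub>laurent K\<^esub>
    (\<Oplus>\<^bsub>laurent K\<^esub> i \<in> {1..n}. a i \<odot>\<^bsub>laurent K\<^esub> (delta K 1 [^]\<^bsub>laurent K\<^esub> i))"

text \<open>\<open>f(c) = v + a\<^sub>1 c + \<dots> + a\<^sub>n c\<^sup>n\<close> with \<open>v = s(e\<^sub>1)\<close>.\<close>

definition path_elt ::
    "('k, 'm) ring_scheme \<Rightarrow> ('v, 'e) pre_digraph \<Rightarrow> 'e list
      \<Rightarrow> (('v, 'e) gen list \<Rightarrow> 'k) set" where
  "path_elt K E p = list_mult (lpa K E) (map (\<lambda>e. lpa_gen K E (Ed e)) p)"

definition cycle_poly ::
    "('k, 'm) ring_scheme \<Rightarrow> ('v, 'e) pre_digraph \<Rightarrow> (nat \<Rightarrow> 'k) \<Rightarrow> nat \<Rightarrow> 'e list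
      \<Rightarrow> (('v, 'e) gen list \<Rightarrow> 'k) set" where
  "cycle_poly K E a n c = lpa_gen K E (Vx (tail E (hd c))) \<oplus>\<^bsub>lpa K E\<^esub>
    (\<Oplus>\<^bsub>lpa K E\<^esub> i \<in> {1..n}.
        a i \<odot>\<^bsub>lpa K E\<^esub> list_mult (lpa K E) (replicate i (path_elt K E c)))"

definition laurent_quot :: "('k, 'm) ring_scheme \<Rightarrow> (int \<Rightarrow> 'k) \<Rightarrow> (int \<Rightarrow> 'k) set ring" where
  "laurent_quot K f = laurent K Quot (PIdl\<^bsub>laurent K\<^esub> f)"

definition laurent_class ::
    "('k, 'm) ring_scheme \<Rightarrow> (int \<Rightarrow> 'k) \<Rightarrow> (int \<Rightarrow> 'k) \<Rightarrow> (int \<Rightarrow> 'k) set" where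
  "laurent_class K f h = (PIdl\<^bsub>laurent K\<^esub> f) +>\<^bsub>laurent K\<^esub> h"

text \<open>The embedding of \<open>K\<close> into \<open>K' = K[x,x\<^sup>-\<^sup>1]/(f)\<close>.\<close>

definition const_class ::
    "('k, 'm) ring_scheme \<Rightarrow> (int \<Rightarrow> 'k) \<Rightarrow> 'k \<Rightarrow> (int \<Rightarrow> 'k) set" where
  "const_class K f k = laurent_class K f (k \<odot>\<^bsub>laurent K\<^esub> \<one>\<^bsub>laurent K\<^esub>)"

text \<open>The automorphism of \<open>L\<^sub>F(E)\<close> with \<open>e \<mapsto> y e\<close> and \<open>e\<^sup>* \<mapsto> y\<^sup>-\<^sup>1 e\<^sup>*\<close> for the given edge
  \<open>e\<close>, fixing all other generators.\<close>

fun twist_gen ::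
    "('k, 'm) ring_scheme \<Rightarrow> ('v, 'e) pre_digraph \<Rightarrow> 'e \<Rightarrow> 'k \<Rightarrow> ('v, 'e) gen
      \<Rightarrow> (('v, 'e) gen list \<Rightarrow> 'k) set" where
  "twist_gen F E e y (Vx v) = lpa_gen F E (Vx v)"
| "twist_gen F E e y (Ed g) =
    (if g = e then y \<odot>\<^bsub>lpa F E\<^esub> lpa_gen F E (Ed g) else lpa_gen F E (Ed g))"
| "twist_gen F E e y (Gh g) =
    (if g = e then (inv\<^bsub>F\<^esub> y) \<odot>\<^bsub>lpa F E\<^esub> lpa_gen F E (Gh g) else lpa_gen F E (Gh g))"

definition lpa_twist ::
    "('k, 'm) ring_scheme \<Rightarrow> ('v, 'e) pre_digraph \<Rightarrow> 'e \<Rightarrow> 'k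
      \<Rightarrow> (('v, 'e) gen list \<Rightarrow> 'k) set \<Rightarrow> (('v, 'e) gen list \<Rightarrow> 'k) set" where
  "lpa_twist F E e y = lpa_hom F (lpa F E) id (twist_gen F E e y)"

text \<open>The canonical map from \<open>L\<^sub>K(E)\<close> to \<open>L\<^bsub>K'\<^esub>(E)\<close> along which scalars are restricted.\<close>

definition lpa_base_change ::
    "('k, 'm) ring_scheme \<Rightarrow> (int \<Rightarrow> 'k) \<Rightarrow> ('v, 'e) pre_digraph
      \<Rightarrow> (('v, 'e) gen list \<Rightarrow> 'k) set \<Rightarrow> (('v, 'e) gen list \<Rightarrow> (int \<Rightarrow> 'k) set) set" where
  "lpa_base_change K f E =
    lpa_hom K (lpa (laurent_quot K f) E) (const_class K f) (lpa_gen (laurent_quot K f) E)"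

text \<open>The left \<open>L\<^sub>K(E)\<close>-module \<open>V\<^sup>f\<^bsub>[q]\<^esub>\<close> for \<open>q = c\<^sup>\<infinity>\<close>, where \<open>e\<^sub>1 = hd c\<close>.\<close>

definition twisted_chen_module ::
    "('k, 'm) ring_scheme \<Rightarrow> ('v, 'e) pre_digraph \<Rightarrow> 'e list \<Rightarrow> (int \<Rightarrow> 'k)
      \<Rightarrow> ((('v, 'e) gen list \<Rightarrow> 'k) set, 'e stream \<Rightarrow> (int \<Rightarrow> 'k) set) module" where
  "twisted_chen_module K E c f =
    (let K' = laurent_quot K f;
         V = chen_module K' E (Stream.cycle c);
         \<sigma> = lpa_twist K' E (hd c) (laurent_class K f (delta K 1))
     in \<lparr>carrier = carrier V, monoid.mult = undefined, one = undefined, ring.zero = ring.zero V, ring.add = ring.add V,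
         smult = (\<lambda>a m. \<sigma> (lpa_base_change K f E a) \<odot>\<^bsub>V\<^esub> m)\<rparr>)"

end

theory Submission
  imports Defs
begin

text \<open>
  Let \<open>v\<close> be the base of \<open>c\<close>, let \<open>H = H(q)\<close> and let \<open>I\<close> be the ideal on the right hand side. An
  infinite path \<open>p\<close> in \<open>[q]\<close> never meets \<open>H\<close>. So the vertices of \<open>H\<close> act as zero, and so does
  \<open>u\<^sup>H\<close> for a breaking vertex \<open>u\<close>, because the first edge \<open>e\<close> of a path \<open>p\<close> from \<open>u\<close> has its range
  outside \<open>H\<close> and \<open>ee\<^sup>*p = p\<close>. As \<open>c\<close> is exclusive, an edge that leaves the cycle ends in \<open>H\<close>
  (\<open>no_exit\<close>). Hence \<open>q\<close> is the only path in \<open>[q]\<close> that starts at \<open>v\<close> (\<open>Q_from_v0\<close>), the cycle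
  multiplies it by the class of \<open>x\<close>, and \<open>f(c)\<close> multiplies it by the class of \<open>f\<close>, which is zero.
  This is \<open>I_subset_Ann\<close>.

  Conversely let \<open>x\<close> annihilate the module. Finite sums of vertices are local units
  (\<open>local_right_units\<close>), so one may assume \<open>x = xw\<close> for a vertex \<open>w\<close>; then \<open>x\<close> is a combination
  of products \<open>\<alpha>\<beta>\<^sup>*\<close> where \<open>\<beta>\<close> starts at \<open>w\<close>. The proof of \<open>x \<in> I\<close> is an induction on the maximal
  length of the \<open>\<beta>\<close> (\<open>ghost_deg_Ann_in_I\<close>). For an edge \<open>e\<close> that starts at \<open>w\<close>, the element \<open>xe\<close>
  annihilates the module as well and has a smaller length, so \<open>xe \<in> I\<close>. If \<open>w \<in> H\<close>,
  then \<open>x = xw\<close> lies in \<open>I\<close>, so let \<open>w\<close> lie outside \<open>H\<close>.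

  If \<open>w\<close> emits only finitely many edges with range outside \<open>H\<close>, then \<open>w\<close> is congruent modulo \<open>I\<close>
  to the sum of the \<open>ee\<^sup>*\<close> over these edges. So \<open>x = xw\<close> is congruent to the sum of the \<open>xee\<^sup>*\<close>, which
  lies in \<open>I\<close> (\<open>finite_emission\<close>). If \<open>w\<close> emits infinitely many such edges, it is not on the
  cycle. Write \<open>x\<close> as a combination \<open>x\<^sub>0\<close> of paths plus a combination of products that end in \<open>e\<^sup>*\<close>
  with \<open>e\<close> in a finite set \<open>S\<close>. A path of \<open>[q]\<close> whose first edge is outside \<open>S\<close> only feels \<open>x\<^sub>0\<close>, so
  \<open>x\<^sub>0\<close> kills it. Distinct paths \<open>\<alpha>\<close> that end at a vertex off the cycle yield distinct infinite
  paths (\<open>prefix_injective\<close>), so \<open>x\<^sub>0 = 0\<close>, and \<open>x\<close> is the sum of the \<open>xee\<^sup>*\<close> with \<open>e \<in> S\<close>.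

  There remains the base of the induction, where \<open>x\<close> is a combination of paths \<open>\<alpha>\<close> that end at \<open>w\<close>.
  Off the cycle the previous argument gives \<open>x = 0\<close>. On the cycle \<open>finite_emission\<close> reduces to
  \<open>w = v\<close>. There \<open>\<alpha>q = \<gamma>q\<close> happens only if \<open>\<alpha>\<close> and \<open>\<gamma>\<close> differ by a power of \<open>c\<close>
  (\<open>prefix_of_q\<close>), so \<open>x\<close> is a sum of terms \<open>\<gamma> g\<^sub>\<gamma>(c)\<close> with polynomials \<open>g\<^sub>\<gamma>\<close> and distinct \<open>\<gamma>q\<close>.
  Since \<open>xq = 0\<close>, every \<open>g\<^sub>\<gamma>\<close> has class zero, that is \<open>g\<^sub>\<gamma> = h f\<close> for some Laurent polynomial
  \<open>h\<close>, and \<open>g\<^sub>\<gamma>(c) = h(c) f(c)\<close> lies in \<open>I\<close> (\<open>real_span_v0\<close>).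

  The module operation is defined through representatives of cosets. It is well defined because
  the elements of the free algebra that act as zero form an ideal that contains the relations
  (\<open>free_act_lpa_ideal0\<close>). The argument above uses only its linearity, its multiplicativity and its
  values on the generators.
\<close>

section \<open>Semilinear maps and free modules\<close>

text \<open>\<open>L\<^sub>K(E)\<close> acts on a space over the larger field \<open>K' = K[x,x\<^sup>-\<^sup>1]/(f)\<close>, so maps are compatible with a
  homomorphism \<open>\<iota>\<close> of scalars.\<close>

definition semilinear ::
    "('k, 'm) ring_scheme \<Rightarrow> ('k \<Rightarrow> 'l) \<Rightarrow> ('k, 'a, 'n) module_scheme
      \<Rightarrow> ('l, 'b, 'p) module_scheme \<Rightarrow> ('a \<Rightarrow> 'b) \<Rightarrow> bool" where
  "semilinear F \<iota> M N h \<longleftrightarrow> h \<in> carrier M \<rightarrow> carrier N \<and>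
    (\<forall>x \<in> carrier M. \<forall>y \<in> carrier M. h (x \<oplus>\<^bsub>M\<^esub> y) = h x \<oplus>\<^bsub>N\<^esub> h y) \<and>
    (\<forall>k \<in> carrier F. \<forall>x \<in> carrier M. h (k \<odot>\<^bsub>M\<^esub> x) = \<iota> k \<odot>\<^bsub>N\<^esub> h x)"

lemma semilinearD:
  assumes "semilinear F \<iota> M N h"
  shows "x \<in> carrier M \<Longrightarrow> h x \<in> carrier N"
    and "\<lbrakk>x \<in> carrier M; y \<in> carrier M\<rbrakk> \<Longrightarrow> h (x \<oplus>\<^bsub>M\<^esub> y) = h x \<oplus>\<^bsub>N\<^esub> h y"
    and "\<lbrakk>k \<in> carrier F; x \<in> carrier M\<rbrakk> \<Longrightarrow> h (k \<odot>\<^bsub>M\<^esub> x) = \<iota> k \<odot>\<^bsub>N\<^esub> h x"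
  using assms unfolding semilinear_def by auto

lemma additive_finsum:
  assumes "abelian_group M" "abelian_group N" "h \<in> carrier M \<rightarrow> carrier N"
    and add: "\<And>x y. \<lbrakk>x \<in> carrier M; y \<in> carrier M\<rbrakk> \<Longrightarrow> h (x \<oplus>\<^bsub>M\<^esub> y) = h x \<oplus>\<^bsub>N\<^esub> h y"
    and "f \<in> A \<rightarrow> carrier M"
  shows "h (\<Oplus>\<^bsub>M\<^esub>i\<in>A. f i) = (\<Oplus>\<^bsub>N\<^esub>i\<in>A. h (f i))"
proof -
  interpret M: abelian_group M by fact
  interpret N: abelian_group N by fact
  interpret h: abelian_group_hom M N h
    using assms by (intro abelian_group_homI group_hom.intro group_hom_axioms.intro
        abelian_group.a_group) (auto simp: hom_def)
  show ?thesis
  proof (cases "finite A")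
    case True
    then show ?thesis using assms(5)
    proof (induction A)
      case (insert x A)
      then have "f x \<in> carrier M" "f \<in> A \<rightarrow> carrier M" by auto
      moreover have "(\<lambda>i. h (f i)) \<in> A \<rightarrow> carrier N" "h (f x) \<in> carrier N"
        using calculation by (auto simp: Pi_iff)
      ultimately show ?case using insert add by simp
    qed simp
  qed (simp add: M.finsum_infinite N.finsum_infinite)
qed

lemma
  assumes "module F M" "module G N" and h: "semilinear F \<iota> M N h"
  shows semilinear_0: "h \<zero>\<^bsub>M\<^esub> = \<zero>\<^bsub>N\<^esub>"
    and semilinear_diff:
      "\<lbrakk>x \<in> carrier M; y \<in> carrier M\<rbrakk> \<Longrightarrow> h (x \<ominus>\<^bsub>M\<^esub> y) = h x \<ominus>\<^bsub>N\<^esub> h y"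
    and semilinear_sum: "f \<in> A \<rightarrow> carrier M \<Longrightarrow> h (\<Oplus>\<^bsub>M\<^esub>i\<in>A. f i) = (\<Oplus>\<^bsub>N\<^esub>i\<in>A. h (f i))"
proof -
  interpret M: module F M by fact
  interpret N: module G N by fact
  note s = semilinearD[OF h]
  interpret h: abelian_group_hom M N h
    by (intro abelian_group_homI group_hom.intro group_hom_axioms.intro
        M.M.a_group N.M.a_group M.M.abelian_group_axioms N.M.abelian_group_axioms)
      (auto simp: hom_def s)
  show "h \<zero>\<^bsub>M\<^esub> = \<zero>\<^bsub>N\<^esub>" by simp
  show "\<lbrakk>x \<in> carrier M; y \<in> carrier M\<rbrakk> \<Longrightarrow> h (x \<ominus>\<^bsub>M\<^esub> y) = h x \<ominus>\<^bsub>N\<^esub> h y"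
    using group_hom.hom_inv[OF h.a_group_hom] by (simp add: a_minus_def a_inv_def s)
  show "f \<in> A \<rightarrow> carrier M \<Longrightarrow> h (\<Oplus>\<^bsub>M\<^esub>i\<in>A. f i) = (\<Oplus>\<^bsub>N\<^esub>i\<in>A. h (f i))"
    by (rule additive_finsum) (auto simp: s M.M.abelian_group_axioms N.M.abelian_group_axioms)
qed

text \<open>Free modules and semigroup algebras have the same underlying module; this predicate
  isolates it.\<close>

definition free_on ::
    "('k, 'm) ring_scheme \<Rightarrow> 'b set \<Rightarrow> ('k, 'b \<Rightarrow> 'k, 'n) module_scheme \<Rightarrow> bool" where
  "free_on F B M \<longleftrightarrow> carrier M = finsupp F B \<and> \<zero>\<^bsub>M\<^esub> = (\<lambda>_. \<zero>\<^bsub>F\<^esub>) \<and>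
     (\<forall>a b. a \<oplus>\<^bsub>M\<^esub> b = (\<lambda>x. a x \<oplus>\<^bsub>F\<^esub> b x)) \<and> (\<forall>k a. k \<odot>\<^bsub>M\<^esub> a = (\<lambda>x. k \<otimes>\<^bsub>F\<^esub> a x))"

lemma free_on_free_module: "free_on F B (free_module F B)"
  by (simp add: free_on_def free_module_def)

lemma free_on_monoid_algebra: "free_on F (carrier M) (monoid_algebra F M)"
  by (simp add: free_on_def monoid_algebra_def)

lemma finsupp_outside: "a \<in> finsupp F B \<Longrightarrow> x \<notin> B \<Longrightarrow> a x = \<zero>\<^bsub>F\<^esub>"
  by (auto simp: finsupp_def supp_def)

lemma finsupp_finite: "a \<in> finsupp F B \<Longrightarrow> finite (supp F a)"
  by (simp add: finsupp_def)

lemma finsupp_supp: "a \<in> finsupp F B \<Longrightarrow> supp F a \<subseteq> B"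
  by (simp add: finsupp_def)

lemma (in ring) finsupp_closed: "a \<in> finsupp R B \<Longrightarrow> a x \<in> carrier R"
  using finsupp_outside[of a R B x] by (cases "x \<in> B") (auto simp: finsupp_def)

lemma (in ring) finsuppI:
  assumes "\<And>b. b \<in> B \<Longrightarrow> a b \<in> carrier R" "S \<subseteq> B" "finite S" "\<And>x. x \<notin> S \<Longrightarrow> a x = \<zero>"
  shows "a \<in> finsupp R B"
proof -
  have "supp R a \<subseteq> S" using assms(4) by (auto simp: supp_def)
  then show ?thesis using assms by (auto simp: finsupp_def intro: finite_subset)
qed

lemma (in ring) delta_finsupp: "b \<in> B \<Longrightarrow> delta R b \<in> finsupp R B"
  by (rule finsuppI[of _ _ "{b}"]) (auto simp: delta_def)

lemma (in cring) free_on_module: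
  assumes "free_on R B M"
  shows "module R M"
proof -
  have fo: "carrier M = finsupp R B" "\<zero>\<^bsub>M\<^esub> = (\<lambda>_. \<zero>)"
      "\<And>a b. a \<oplus>\<^bsub>M\<^esub> b = (\<lambda>x. a x \<oplus> b x)" "\<And>k a. k \<odot>\<^bsub>M\<^esub> a = (\<lambda>x. k \<otimes> a x)"
    using assms by (auto simp: free_on_def)
  have add: "(\<lambda>x. a x \<oplus> b x) \<in> finsupp R B" if "a \<in> finsupp R B" "b \<in> finsupp R B" for a b
    using that finsupp_finite finsupp_supp
    by (intro finsuppI[of _ _ "supp R a \<union> supp R b"])
      (auto simp: finsupp_closed supp_def finsupp_finite dest: subsetD[OF finsupp_supp])
  have mul: "(\<lambda>x. k \<otimes> a x) \<in> finsupp R B" if "a \<in> finsupp R B" "k \<in> carrier R" for a k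
    using that finsupp_finite finsupp_supp
    by (intro finsuppI[of _ _ "supp R a"])
      (auto simp: finsupp_closed supp_def finsupp_finite dest: subsetD[OF finsupp_supp])
  have z: "(\<lambda>_. \<zero>) \<in> finsupp R B"
    by (rule finsuppI[of _ _ "{}"]) auto
  show ?thesis
  proof (rule moduleI)
    show "cring R" by (rule is_cring)
    show "abelian_group M"
    proof (rule abelian_groupI)
      fix x assume x: "x \<in> carrier M"
      show "\<exists>y\<in>carrier M. y \<oplus>\<^bsub>M\<^esub> x = \<zero>\<^bsub>M\<^esub>"
        using mul[of x "\<ominus> \<one>"] x finsupp_closed[of x B]
        by (intro bexI[of _ "\<lambda>y. \<ominus> \<one> \<otimes> x y"]) (auto simp: fo l_minus l_neg)
    qed (auto simp: fo add z finsupp_closed a_ac)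
  qed (auto simp: fo mul finsupp_closed l_distr r_distr m_assoc)
qed

lemma (in cring) delta_carrier: "free_on R B M \<Longrightarrow> b \<in> B \<Longrightarrow> delta R b \<in> carrier M"
  by (simp add: free_on_def delta_finsupp)

lemma (in cring) free_on_induct [consumes 2, case_names zero delta add]:
  assumes fo: "free_on R B M" and a: "a \<in> carrier M"
    and "P \<zero>\<^bsub>M\<^esub>"
    and d: "\<And>k b. \<lbrakk>k \<in> carrier R; b \<in> B\<rbrakk> \<Longrightarrow> P (k \<odot>\<^bsub>M\<^esub> delta R b)"
    and s: "\<And>x y. \<lbrakk>x \<in> carrier M; y \<in> carrier M; P x; P y\<rbrakk> \<Longrightarrow> P (x \<oplus>\<^bsub>M\<^esub> y)"
  shows "P a"
proof -
  interpret M: module R M by (rule free_on_module[OF fo])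
  have fo': "carrier M = finsupp R B" "\<zero>\<^bsub>M\<^esub> = (\<lambda>_. \<zero>)"
      "\<And>a b. a \<oplus>\<^bsub>M\<^esub> b = (\<lambda>x. a x \<oplus> b x)" "\<And>k a. k \<odot>\<^bsub>M\<^esub> a = (\<lambda>x. k \<otimes> a x)"
    using fo by (auto simp: free_on_def)
  have "\<forall>a \<in> carrier M. supp R a = S \<longrightarrow> P a" if "finite S" for S
    using that
  proof (induction S)
    case empty
    have "a = \<zero>\<^bsub>M\<^esub>" if "supp R a = {}" for a
      using that by (auto simp: supp_def fo')
    then show ?case using assms(3) by auto
  next
    case (insert b S)
    show ?case
    proof (intro ballI impI)
      fix a assume a: "a \<in> carrier M" and S: "supp R a = insert b S"
      have b: "b \<in> B" using a S finsupp_supp[of a R B] by (auto simp: fo')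
      have ab: "a b \<in> carrier R" using a by (simp add: fo' finsupp_closed)
      define a' where "a' = a(b := \<zero>)"
      have a': "a' \<in> finsupp R B"
        using a S b finsupp_closed[of a B] finsupp_supp[of a R B] insert.hyps
        by (intro finsuppI[of _ _ S]) (auto simp: a'_def fo' supp_def)
      have "supp R a' = S" using S insert.hyps by (auto simp: a'_def supp_def)
      then have Pa': "P a'" using insert.IH a' fo' by auto
      have eq: "a = (a b \<odot>\<^bsub>M\<^esub> delta R b) \<oplus>\<^bsub>M\<^esub> a'"
        using finsupp_closed[of a B] a by (auto simp: a'_def fo' delta_def)
      have "P ((a b \<odot>\<^bsub>M\<^esub> delta R b) \<oplus>\<^bsub>M\<^esub> a')"
      proof (rule s)
        show "P (a b \<odot>\<^bsub>M\<^esub> delta R b)" using d ab b by auto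
        show "a b \<odot>\<^bsub>M\<^esub> delta R b \<in> carrier M"
          using ab delta_carrier[OF fo b] by simp
      qed (use a' fo'(1) Pa' in auto)
      then show "P a" using eq by metis
    qed
  qed
  then show ?thesis using a finsupp_finite fo'(1) by blast
qed

lemma (in cring) free_on_finsum_apply:
  assumes fo: "free_on R B M" and "f \<in> I \<rightarrow> carrier M"
  shows "(\<Oplus>\<^bsub>M\<^esub>i\<in>I. f i) x = (\<Oplus>i\<in>I. f i x)"
proof -
  interpret M: module R M by (rule free_on_module[OF fo])
  show ?thesis
    using fo assms(2) by (intro additive_finsum[of M R "\<lambda>a. a x"])
      (auto simp: free_on_def finsupp_closed M.abelian_group_axioms abelian_group_axioms)
qed

text \<open>Homomorphisms out of a Leavitt path algebra, its actions on Chen modules and the evaluation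
  of Laurent polynomials at the cycle are all sums of this shape over the support of an element.\<close>

definition lin_ext ::
    "('k, 'm) ring_scheme \<Rightarrow> ('l, 'b, 'n) module_scheme \<Rightarrow> ('k \<Rightarrow> 'l) \<Rightarrow> ('i \<Rightarrow> 'b)
      \<Rightarrow> ('i \<Rightarrow> 'k) \<Rightarrow> 'b" where
  "lin_ext F N \<iota> h a = (\<Oplus>\<^bsub>N\<^esub>b \<in> supp F a. \<iota> (a b) \<odot>\<^bsub>N\<^esub> h b)"

lemma
  fixes F :: "('k, 'm) ring_scheme" and N :: "('l, 'b, 'n) module_scheme"
  assumes F: "cring F" and N: "module G N" and \<iota>: "\<iota> \<in> ring_hom F G"
    and h: "h \<in> B \<rightarrow> carrier N" and fo: "free_on F B M"
  shows lin_ext_semilinear: "semilinear F \<iota> M N (lin_ext F N \<iota> h)"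
    and lin_ext_delta: "b \<in> B \<Longrightarrow> lin_ext F N \<iota> h (delta F b) = h b"
proof -
  interpret F: cring F by (rule F)
  interpret N: module G N by (rule N)
  interpret M: module F M by (rule F.free_on_module[OF fo])
  have fo': "carrier M = finsupp F B" "\<zero>\<^bsub>M\<^esub> = (\<lambda>_. \<zero>\<^bsub>F\<^esub>)"
      "\<And>a b. a \<oplus>\<^bsub>M\<^esub> b = (\<lambda>x. a x \<oplus>\<^bsub>F\<^esub> b x)" "\<And>k a. k \<odot>\<^bsub>M\<^esub> a = (\<lambda>x. k \<otimes>\<^bsub>F\<^esub> a x)"
    using fo by (auto simp: free_on_def)
  have i0: "\<iota> \<zero>\<^bsub>F\<^esub> = \<zero>\<^bsub>G\<^esub>"
    by (rule ring_hom_zero[OF \<iota> F.ring_axioms N.R.ring_axioms])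
  have i: "\<iota> k \<in> carrier G" if "k \<in> carrier F" for k
    using \<iota> that by (rule ring_hom_closed)
  have hb: "h b \<in> carrier N" if "b \<in> B" for b using h that by auto
  have ext: "lin_ext F N \<iota> h a = (\<Oplus>\<^bsub>N\<^esub>b \<in> T. \<iota> (a b) \<odot>\<^bsub>N\<^esub> h b)"
    if "a \<in> finsupp F B" "supp F a \<subseteq> T" "T \<subseteq> B" "finite T" for a T
    unfolding lin_ext_def
    using that F.finsupp_closed[of a B]
    by (intro N.add.finprod_mono_neutral_cong_left) (auto simp: supp_def i0 i hb)
  show "semilinear F \<iota> M N (lin_ext F N \<iota> h)"
    unfolding semilinear_def
  proof (intro conjI ballI funcsetI)
    fix x assume x: "x \<in> carrier M"
    then show "lin_ext F N \<iota> h x \<in> carrier N"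
      unfolding lin_ext_def fo' using F.finsupp_closed[of x B] finsupp_supp[of x F B]
      by (intro N.finsum_closed) (auto intro!: i hb)
  next
    fix x y assume xy: "x \<in> carrier M" "y \<in> carrier M"
    define T where "T = supp F x \<union> supp F y"
    have T: "finite T" "T \<subseteq> B" "supp F x \<subseteq> T" "supp F y \<subseteq> T" "supp F (x \<oplus>\<^bsub>M\<^esub> y) \<subseteq> T"
      using xy finsupp_finite[of x F B] finsupp_finite[of y F B]
        finsupp_supp[of x F B] finsupp_supp[of y F B]
      by (auto simp: T_def fo' supp_def)
    have c: "x b \<in> carrier F" "y b \<in> carrier F" for b
      using xy F.finsupp_closed by (auto simp: fo')
    have "lin_ext F N \<iota> h (x \<oplus>\<^bsub>M\<^esub> y) = (\<Oplus>\<^bsub>N\<^esub>b \<in> T. \<iota> (x b \<oplus>\<^bsub>F\<^esub> y b) \<odot>\<^bsub>N\<^esub> h b)"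
      using ext[of "x \<oplus>\<^bsub>M\<^esub> y" T] T M.a_closed[OF xy] by (simp add: fo')
    also have "\<dots> = (\<Oplus>\<^bsub>N\<^esub>b \<in> T. \<iota> (x b) \<odot>\<^bsub>N\<^esub> h b \<oplus>\<^bsub>N\<^esub> \<iota> (y b) \<odot>\<^bsub>N\<^esub> h b)"
      using T c hb i by (intro N.M.finsum_cong')
        (auto simp: ring_hom_add[OF \<iota>] N.smult_l_distr subset_iff)
    also have "\<dots> = lin_ext F N \<iota> h x \<oplus>\<^bsub>N\<^esub> lin_ext F N \<iota> h y"
      using T c hb i xy fo' ext[of x T] ext[of y T]
      by (subst N.M.finsum_addf) (auto simp: subset_iff)
    finally show "lin_ext F N \<iota> h (x \<oplus>\<^bsub>M\<^esub> y) = lin_ext F N \<iota> h x \<oplus>\<^bsub>N\<^esub> lin_ext F N \<iota> h y" .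
  next
    fix k x assume kx: "k \<in> carrier F" "x \<in> carrier M"
    define T where "T = supp F x"
    have T: "finite T" "T \<subseteq> B" "supp F x \<subseteq> T" "supp F (k \<odot>\<^bsub>M\<^esub> x) \<subseteq> T"
      using kx finsupp_finite[of x F B] finsupp_supp[of x F B]
      by (auto simp: T_def fo' supp_def)
    have c: "x b \<in> carrier F" for b
      using kx F.finsupp_closed by (auto simp: fo')
    have "lin_ext F N \<iota> h (k \<odot>\<^bsub>M\<^esub> x) = (\<Oplus>\<^bsub>N\<^esub>b \<in> T. \<iota> (k \<otimes>\<^bsub>F\<^esub> x b) \<odot>\<^bsub>N\<^esub> h b)"
      using ext[of "k \<odot>\<^bsub>M\<^esub> x" T] T M.smult_closed[OF kx] by (simp add: fo')
    also have "\<dots> = (\<Oplus>\<^bsub>N\<^esub>b \<in> T. \<iota> k \<odot>\<^bsub>N\<^esub> (\<iota> (x b) \<odot>\<^bsub>N\<^esub> h b))"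
      using T c hb i kx by (intro N.M.finsum_cong')
        (auto simp: ring_hom_mult[OF \<iota>] N.smult_assoc1 subset_iff)
    also have "\<dots> = \<iota> k \<odot>\<^bsub>N\<^esub> lin_ext F N \<iota> h x"
      using T c hb i kx fo' ext[of x T]
      by (subst N.finsum_smult_ldistr[symmetric]) (auto simp: subset_iff)
    finally show "lin_ext F N \<iota> h (k \<odot>\<^bsub>M\<^esub> x) = \<iota> k \<odot>\<^bsub>N\<^esub> lin_ext F N \<iota> h x" .
  qed
  show "lin_ext F N \<iota> h (delta F b) = h b" if b: "b \<in> B"
  proof -
    have "supp F (delta F b) \<subseteq> {b}" by (auto simp: supp_def delta_def)
    then have "lin_ext F N \<iota> h (delta F b) = (\<Oplus>\<^bsub>N\<^esub>b' \<in> {b}. \<iota> (delta F b b') \<odot>\<^bsub>N\<^esub> h b')"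
      using b by (intro ext F.delta_finsupp) auto
    also have "\<dots> = h b"
      using hb[OF b] ring_hom_one[OF \<iota>] by (simp add: delta_def)
    finally show ?thesis .
  qed
qed

lemma semilinear_unique:
  assumes "cring F" "free_on F B M" "module G N" "\<iota> \<in> ring_hom F G"
    and "semilinear F \<iota> M N h" "semilinear F \<iota> M N h'"
    and eq: "\<And>b. b \<in> B \<Longrightarrow> h (delta F b) = h' (delta F b)" and x: "x \<in> carrier M"
  shows "h x = h' x"
proof -
  interpret F: cring F by fact
  interpret N: module G N by fact
  interpret M: module F M by (rule F.free_on_module) fact
  note z = semilinear_0[OF M.module_axioms N.module_axioms]
  show ?thesis
    using assms(2) x
  proof (induction rule: F.free_on_induct)
    case zero
    show ?case using z[OF assms(5)] z[OF assms(6)] by simp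
  next
    case (delta k b)
    then show ?case
      using eq[of b] semilinearD(3)[OF assms(5)] semilinearD(3)[OF assms(6)]
        F.delta_carrier[OF assms(2)] by simp
  next
    case (add x y)
    then show ?case using semilinearD(2)[OF assms(5)] semilinearD(2)[OF assms(6)] by simp
  qed
qed

section \<open>Non-unital algebras\<close>

text \<open>A Leavitt path algebra has a unit only if the graph has finitely many vertices.\<close>

locale nu_algebra = module F A
  for F :: "('k, 'm) ring_scheme" and A :: "('k, 'a, 'n) module_scheme" (structure) +
  assumes mult_closed [simp, intro]:
      "\<lbrakk>x \<in> carrier A; y \<in> carrier A\<rbrakk> \<Longrightarrow> x \<otimes> y \<in> carrier A"
    and mult_assoc:
      "\<lbrakk>x \<in> carrier A; y \<in> carrier A; z \<in> carrier A\<rbrakk> \<Longrightarrow> (x \<otimes> y) \<otimes> z = x \<otimes> (y \<otimes> z)"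
    and mult_add_left:
      "\<lbrakk>x \<in> carrier A; y \<in> carrier A; z \<in> carrier A\<rbrakk> \<Longrightarrow> (x \<oplus> y) \<otimes> z = x \<otimes> z \<oplus> y \<otimes> z"
    and mult_add_right:
      "\<lbrakk>x \<in> carrier A; y \<in> carrier A; z \<in> carrier A\<rbrakk> \<Longrightarrow> z \<otimes> (x \<oplus> y) = z \<otimes> x \<oplus> z \<otimes> y"
    and mult_smult_left:
      "\<lbrakk>k \<in> carrier F; x \<in> carrier A; y \<in> carrier A\<rbrakk> \<Longrightarrow> (k \<odot> x) \<otimes> y = k \<odot> (x \<otimes> y)"
    and mult_smult_right:
      "\<lbrakk>k \<in> carrier F; x \<in> carrier A; y \<in> carrier A\<rbrakk> \<Longrightarrow> x \<otimes> (k \<odot> y) = k \<odot> (x \<otimes> y)"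
begin

lemma mult_left_linear: "z \<in> carrier A \<Longrightarrow> semilinear F id A A (\<lambda>x. x \<otimes> z)"
  and mult_right_linear: "z \<in> carrier A \<Longrightarrow> semilinear F id A A (\<lambda>x. z \<otimes> x)"
  by (simp_all add: semilinear_def mult_add_left mult_add_right mult_smult_left mult_smult_right)

lemmas
  mult_zero_left [simp] = semilinear_0[OF module_axioms module_axioms mult_left_linear]
  and mult_zero_right [simp] = semilinear_0[OF module_axioms module_axioms mult_right_linear]
  and mult_minus_left = semilinear_diff[OF module_axioms module_axioms mult_left_linear]
  and mult_minus_right = semilinear_diff[OF module_axioms module_axioms mult_right_linear]
  and mult_finsum_right = semilinear_sum[OF module_axioms module_axioms mult_right_linear]

lemma alg_ideal_carrier: "alg_ideal F A (carrier A)"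
  unfolding alg_ideal_def by (auto intro: submoduleI)

lemma alg_idealD:
  assumes "alg_ideal F A I"
  shows "I \<subseteq> carrier A" "x \<in> I \<Longrightarrow> x \<in> carrier A" "\<zero> \<in> I"
    "\<lbrakk>x \<in> I; y \<in> I\<rbrakk> \<Longrightarrow> x \<oplus> y \<in> I" "x \<in> I \<Longrightarrow> \<ominus> x \<in> I"
    "\<lbrakk>x \<in> I; y \<in> I\<rbrakk> \<Longrightarrow> x \<ominus> y \<in> I"
    "\<lbrakk>k \<in> carrier F; x \<in> I\<rbrakk> \<Longrightarrow> k \<odot> x \<in> I"
    "\<lbrakk>x \<in> carrier A; y \<in> I\<rbrakk> \<Longrightarrow> x \<otimes> y \<in> I" "\<lbrakk>x \<in> carrier A; y \<in> I\<rbrakk> \<Longrightarrow> y \<otimes> x \<in> I"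
proof -
  have s: "submodule I F A" using assms by (simp add: alg_ideal_def)
  note E = submoduleE[OF s]
  show "I \<subseteq> carrier A" by (rule E)
  show "x \<in> I \<Longrightarrow> x \<in> carrier A" using E(1) by auto
  show "\<zero> \<in> I" using subgroup.one_closed[OF submodule.axioms(1)[OF s]] by simp
  show "\<lbrakk>x \<in> I; y \<in> I\<rbrakk> \<Longrightarrow> x \<oplus> y \<in> I" "x \<in> I \<Longrightarrow> \<ominus> x \<in> I"
    "\<lbrakk>k \<in> carrier F; x \<in> I\<rbrakk> \<Longrightarrow> k \<odot> x \<in> I"
    using E by auto
  show "\<lbrakk>x \<in> I; y \<in> I\<rbrakk> \<Longrightarrow> x \<ominus> y \<in> I" using E by (simp add: a_minus_def)
  show "\<lbrakk>x \<in> carrier A; y \<in> I\<rbrakk> \<Longrightarrow> x \<otimes> y \<in> I" "\<lbrakk>x \<in> carrier A; y \<in> I\<rbrakk> \<Longrightarrow> y \<otimes> x \<in> I"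
    using assms by (auto simp: alg_ideal_def)
qed

lemma alg_ideal_finsum:
  assumes "alg_ideal F A I" "f \<in> J \<rightarrow> I"
  shows "(\<Oplus>i\<in>J. f i) \<in> I"
proof (cases "finite J")
  case True
  then show ?thesis using assms(2)
  proof (induction J)
    case empty
    then show ?case by (simp add: alg_idealD[OF assms(1)])
  next
    case (insert x J)
    have "f \<in> J \<rightarrow> carrier A" "f x \<in> carrier A"
      using insert.prems alg_idealD(1)[OF assms(1)] by auto
    then show ?case using insert alg_idealD(4)[OF assms(1)] by simp
  qed
next
  case False
  then show ?thesis by (simp add: M.finsum_infinite alg_idealD(3)[OF assms(1)])
qed

lemma alg_idealI:
  assumes "I \<subseteq> carrier A" "\<zero> \<in> I" "\<And>x y. \<lbrakk>x \<in> I; y \<in> I\<rbrakk> \<Longrightarrow> x \<oplus> y \<in> I"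
    and k: "\<And>k x. \<lbrakk>k \<in> carrier F; x \<in> I\<rbrakk> \<Longrightarrow> k \<odot> x \<in> I"
    and "\<And>x y. \<lbrakk>x \<in> carrier A; y \<in> I\<rbrakk> \<Longrightarrow> x \<otimes> y \<in> I"
    and "\<And>x y. \<lbrakk>x \<in> carrier A; y \<in> I\<rbrakk> \<Longrightarrow> y \<otimes> x \<in> I"
  shows "alg_ideal F A I"
proof -
  have "\<ominus> x \<in> I" if "x \<in> I" for x
  proof -
    have "\<ominus> x = (\<ominus>\<^bsub>F\<^esub> \<one>\<^bsub>F\<^esub>) \<odot> x" using that assms(1) by (subst smult_l_minus) auto
    then show ?thesis using k that by simp
  qed
  then show ?thesis unfolding alg_ideal_def using assms by (auto intro!: submoduleI)
qed

lemma alg_ideal_gen: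
  assumes "S \<subseteq> carrier A"
  shows "alg_ideal F A (alg_ideal_gen F A S)" and "S \<subseteq> alg_ideal_gen F A S"
proof -
  let ?C = "{I. alg_ideal F A I \<and> S \<subseteq> I}"
  have c: "carrier A \<in> ?C" using assms alg_ideal_carrier by simp
  show "alg_ideal F A (alg_ideal_gen F A S)"
    unfolding alg_ideal_gen_def
  proof (rule alg_idealI)
    show "\<Inter>?C \<subseteq> carrier A" using c by blast
  qed (auto dest: alg_idealD)
  show "S \<subseteq> alg_ideal_gen F A S" unfolding alg_ideal_gen_def by auto
qed

lemma alg_ideal_gen_least:
  "\<lbrakk>alg_ideal F A I; S \<subseteq> I\<rbrakk> \<Longrightarrow> alg_ideal_gen F A S \<subseteq> I"
  unfolding alg_ideal_gen_def by auto

end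

section \<open>Semigroup algebras\<close>

locale semigroup_algebra = F?: cring F for F :: "('k, 'm) ring_scheme" +
  fixes M :: "('b, 'n) monoid_scheme" (structure)
  assumes M_closed: "\<lbrakk>x \<in> carrier M; y \<in> carrier M\<rbrakk> \<Longrightarrow> x \<otimes> y \<in> carrier M"
    and M_assoc: "\<lbrakk>x \<in> carrier M; y \<in> carrier M; z \<in> carrier M\<rbrakk> \<Longrightarrow> (x \<otimes> y) \<otimes> z = x \<otimes> (y \<otimes> z)"
begin

abbreviation FM :: "('k, 'b \<Rightarrow> 'k) module" where
  "FM \<equiv> monoid_algebra F M"

abbreviation conv (infixl "\<star>" 70) where "a \<star> b \<equiv> a \<otimes>\<^bsub>FM\<^esub> b"

lemma FM_free_on: "free_on F (carrier M) FM"
  by (rule free_on_monoid_algebra)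

lemma FM_module: "module F FM"
  by (rule F.free_on_module[OF FM_free_on])

lemma FM_simps:
  "carrier FM = finsupp F (carrier M)" "\<zero>\<^bsub>FM\<^esub> = (\<lambda>_. \<zero>\<^bsub>F\<^esub>)"
  "a \<oplus>\<^bsub>FM\<^esub> b = (\<lambda>x. a x \<oplus>\<^bsub>F\<^esub> b x)" "k \<odot>\<^bsub>FM\<^esub> a = (\<lambda>x. k \<otimes>\<^bsub>F\<^esub> a x)"
  by (simp_all add: monoid_algebra_def)

lemma FM_mult_apply:
  assumes "a \<in> carrier FM" "b \<in> carrier FM" "finite S" "finite T" "supp F a \<subseteq> S" "supp F b \<subseteq> T"
  shows "(a \<star> b) x =
    finsum F (\<lambda>(y, z). a y \<otimes>\<^bsub>F\<^esub> b z) {(y, z). y \<in> S \<and> z \<in> T \<and> y \<otimes> z = x}"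
proof -
  have c: "a y \<in> carrier F" "b y \<in> carrier F" for y
    using assms F.finsupp_closed by (auto simp: FM_simps)
  have "finite {(y, z). y \<in> S \<and> z \<in> T \<and> y \<otimes> z = x}"
    by (rule finite_subset[of _ "S \<times> T"]) (use assms in auto)
  then show ?thesis
    unfolding monoid_algebra_def using assms(5,6) c
    by (simp, intro F.add.finprod_mono_neutral_cong_left) (auto simp: supp_def)
qed

lemma FM_mult_closed:
  assumes "a \<in> carrier FM" "b \<in> carrier FM"
  shows "a \<star> b \<in> carrier FM"
proof -
  have c: "a y \<in> carrier F" "b y \<in> carrier F" for y
    using assms F.finsupp_closed by (auto simp: FM_simps)
  have fin: "finite (supp F a)" "finite (supp F b)" "supp F a \<subseteq> carrier M" "supp F b \<subseteq> carrier M"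
    using assms finsupp_finite[of _ F "carrier M"] finsupp_supp[of _ F "carrier M"]
    by (auto simp: FM_simps)
  let ?S = "(\<lambda>(y, z). y \<otimes> z) ` (supp F a \<times> supp F b)"
  show ?thesis
    unfolding FM_simps
  proof (rule F.finsuppI[of _ _ ?S])
    show "?S \<subseteq> carrier M" using fin by (auto intro!: M_closed)
    show "finite ?S" using fin by auto
    fix x
    show "(a \<star> b) x \<in> carrier F"
      using c by (subst FM_mult_apply[OF assms fin(1,2)]) (auto intro!: F.finsum_closed)
    assume "x \<notin> ?S"
    then have e: "{(y, z). y \<in> supp F a \<and> z \<in> supp F b \<and> y \<otimes> z = x} = {}" by auto
    show "(a \<star> b) x = \<zero>\<^bsub>F\<^esub>"
      by (subst FM_mult_apply[OF assms fin(1,2) order_refl order_refl]) (simp add: e del: split_paired_All)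
  qed
qed

lemma FM_mult_delta:
  assumes "u \<in> carrier M" "w \<in> carrier M"
  shows "delta F u \<star> delta F w = delta F (u \<otimes> w)"
proof
  fix x
  have s: "supp F (delta F b) \<subseteq> {b}" for b :: 'b by (auto simp: supp_def delta_def)
  have "(delta F u \<star> delta F w) x =
      finsum F (\<lambda>(y, z). delta F u y \<otimes>\<^bsub>F\<^esub> delta F w z) {(y, z). y \<in> {u} \<and> z \<in> {w} \<and> y \<otimes> z = x}"
    by (rule FM_mult_apply) (use assms s in \<open>auto simp: F.delta_carrier[OF FM_free_on]\<close>)
  also have "{(y, z). y \<in> {u} \<and> z \<in> {w} \<and> y \<otimes> z = x} = (if u \<otimes> w = x then {(u, w)} else {})"
    by auto
  finally show "(delta F u \<star> delta F w) x = delta F (u \<otimes> w) x"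
    by (auto simp: delta_def)
qed

text \<open>All four bilinearity laws are instances of one statement about the coefficients.\<close>

lemma FM_mult_combine:
  assumes in_FM: "a \<in> carrier FM" "b \<in> carrier FM" "a1 \<in> carrier FM" "b1 \<in> carrier FM"
      "a2 \<in> carrier FM" "b2 \<in> carrier FM" and k: "k \<in> carrier F"
    and eq: "\<And>y z. a y \<otimes>\<^bsub>F\<^esub> b z = k \<otimes>\<^bsub>F\<^esub> (a1 y \<otimes>\<^bsub>F\<^esub> b1 z) \<oplus>\<^bsub>F\<^esub> a2 y \<otimes>\<^bsub>F\<^esub> b2 z"
  shows "a \<star> b = k \<odot>\<^bsub>FM\<^esub> (a1 \<star> b1) \<oplus>\<^bsub>FM\<^esub> a2 \<star> b2"
proof
  fix x
  have c: "h y \<in> carrier F" if "h \<in> carrier FM" for h y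
    using that F.finsupp_closed by (auto simp: FM_simps)
  have fin: "finite (supp F h)" if "h \<in> carrier FM" for h
    using that finsupp_finite[of _ F "carrier M"] by (auto simp: FM_simps)
  define S where "S = supp F a \<union> supp F a1 \<union> supp F a2"
  define T where "T = supp F b \<union> supp F b1 \<union> supp F b2"
  define D where "D = {(y, z). y \<in> S \<and> z \<in> T \<and> y \<otimes> z = x}"
  have ST: "finite S" "finite T" using in_FM fin by (simp_all add: S_def T_def)
  have D: "finite D" by (rule finite_subset[of _ "S \<times> T"]) (use ST in \<open>auto simp: D_def\<close>)
  have app: "(g \<star> h) x = finsum F (\<lambda>(y, z). g y \<otimes>\<^bsub>F\<^esub> h z) D"
    if "g \<in> carrier FM" "h \<in> carrier FM" "supp F g \<subseteq> S" "supp F h \<subseteq> T" for g h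
    unfolding D_def using that ST by (intro FM_mult_apply)
  have "(a \<star> b) x = (\<Oplus>\<^bsub>F\<^esub>p\<in>D. k \<otimes>\<^bsub>F\<^esub> (case p of (y, z) \<Rightarrow> a1 y \<otimes>\<^bsub>F\<^esub> b1 z)
      \<oplus>\<^bsub>F\<^esub> (case p of (y, z) \<Rightarrow> a2 y \<otimes>\<^bsub>F\<^esub> b2 z))"
    using in_FM k c by (subst app) (auto simp: S_def T_def eq intro!: F.finsum_cong')
  also have "\<dots> = (\<Oplus>\<^bsub>F\<^esub>p\<in>D. k \<otimes>\<^bsub>F\<^esub> (case p of (y, z) \<Rightarrow> a1 y \<otimes>\<^bsub>F\<^esub> b1 z))
      \<oplus>\<^bsub>F\<^esub> (a2 \<star> b2) x"
    using in_FM k c by (subst app) (auto simp: S_def T_def intro!: F.finsum_addf)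
  also have "(\<Oplus>\<^bsub>F\<^esub>p\<in>D. k \<otimes>\<^bsub>F\<^esub> (case p of (y, z) \<Rightarrow> a1 y \<otimes>\<^bsub>F\<^esub> b1 z)) = k \<otimes>\<^bsub>F\<^esub> (a1 \<star> b1) x"
    using in_FM k c D by (subst app) (auto simp: S_def T_def intro!: F.finsum_rdistr[symmetric])
  finally show "(a \<star> b) x = (k \<odot>\<^bsub>FM\<^esub> (a1 \<star> b1) \<oplus>\<^bsub>FM\<^esub> a2 \<star> b2) x"
    by (simp add: FM_simps)
qed

lemma FM_nu_algebra: "nu_algebra F FM"
proof -
  interpret FM: module F FM by (rule FM_module)
  have c: "h y \<in> carrier F" if "h \<in> carrier FM" for h y
    using that F.finsupp_closed by (auto simp: FM_simps)
  note cl = FM_mult_closed FM.M.zero_closed[unfolded FM_simps(2)] FM.M.a_closed[unfolded FM_simps(3)]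
    FM.smult_closed[unfolded FM_simps(4)]
  have zl: "\<zero>\<^bsub>FM\<^esub> \<star> h = \<zero>\<^bsub>FM\<^esub>" if "h \<in> carrier FM" for h
    using FM_mult_combine[of "\<zero>\<^bsub>FM\<^esub>" h "\<zero>\<^bsub>FM\<^esub>" h "\<zero>\<^bsub>FM\<^esub>" h "\<ominus>\<^bsub>F\<^esub> \<one>\<^bsub>F\<^esub>"] that c cl
    by (simp add: FM_simps(2) FM.smult_l_minus FM.M.l_neg)
  have addl: "(a \<oplus>\<^bsub>FM\<^esub> b) \<star> h = a \<star> h \<oplus>\<^bsub>FM\<^esub> b \<star> h"
    if "a \<in> carrier FM" "b \<in> carrier FM" "h \<in> carrier FM" for a b h
    using FM_mult_combine[of "a \<oplus>\<^bsub>FM\<^esub> b" h a h b h "\<one>\<^bsub>F\<^esub>"] that c cl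
    by (simp add: FM_simps(3) F.l_distr)
  have addr: "h \<star> (a \<oplus>\<^bsub>FM\<^esub> b) = h \<star> a \<oplus>\<^bsub>FM\<^esub> h \<star> b"
    if "a \<in> carrier FM" "b \<in> carrier FM" "h \<in> carrier FM" for a b h
    using FM_mult_combine[of h "a \<oplus>\<^bsub>FM\<^esub> b" h a h b "\<one>\<^bsub>F\<^esub>"] that c cl
    by (simp add: FM_simps(3) F.r_distr)
  have scl: "(k \<odot>\<^bsub>FM\<^esub> a) \<star> b = k \<odot>\<^bsub>FM\<^esub> (a \<star> b)"
    and scr: "a \<star> (k \<odot>\<^bsub>FM\<^esub> b) = k \<odot>\<^bsub>FM\<^esub> (a \<star> b)"
    if "k \<in> carrier F" "a \<in> carrier FM" "b \<in> carrier FM" for k a b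
    using FM_mult_combine[of "k \<odot>\<^bsub>FM\<^esub> a" b a b "\<zero>\<^bsub>FM\<^esub>" b k]
      FM_mult_combine[of a "k \<odot>\<^bsub>FM\<^esub> b" a b "\<zero>\<^bsub>FM\<^esub>" b k] that c cl zl[of b]
    by (simp_all add: FM_simps(2,4) F.m_assoc F.m_lcomm)
  have dc: "delta F b \<in> carrier FM" if "b \<in> carrier M" for b
    using F.delta_carrier[OF FM_free_on that] .
  have z: "\<zero>\<^bsub>FM\<^esub> \<star> a = \<zero>\<^bsub>FM\<^esub>" "a \<star> \<zero>\<^bsub>FM\<^esub> = \<zero>\<^bsub>FM\<^esub>" if "a \<in> carrier FM" for a
    using scl[of "\<zero>\<^bsub>F\<^esub>" a a] scr[of "\<zero>\<^bsub>F\<^esub>" a a] that FM_mult_closed by auto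
  note rules = addl addr scl scr z FM_mult_closed dc FM.smult_r_distr
  \<comment> \<open>Associativity is trilinear, so it is reduced to basis elements one argument at a time.\<close>
  have assoc3: "(delta F u \<star> delta F v) \<star> a = delta F u \<star> (delta F v \<star> a)"
    if uv: "u \<in> carrier M" "v \<in> carrier M" and a: "a \<in> carrier FM" for u v a
    using FM_free_on a
    by (induction rule: F.free_on_induct) (use uv in \<open>auto simp: rules FM_mult_delta M_closed M_assoc\<close>)
  have assoc2: "(delta F u \<star> b) \<star> a = delta F u \<star> (b \<star> a)"
    if u: "u \<in> carrier M" and b: "b \<in> carrier FM" and a: "a \<in> carrier FM" for u b a
    using FM_free_on b
    by (induction rule: F.free_on_induct) (use u a in \<open>auto simp: rules assoc3\<close>)
  have assoc: "(d \<star> b) \<star> a = d \<star> (b \<star> a)"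
    if d: "d \<in> carrier FM" and b: "b \<in> carrier FM" and a: "a \<in> carrier FM" for d b a
    using FM_free_on d
    by (induction rule: F.free_on_induct) (use a b in \<open>auto simp: rules assoc2\<close>)
  show ?thesis
    by (intro nu_algebra.intro FM_module nu_algebra_axioms.intro FM_mult_closed assoc addl addr scl scr)
qed

end

section \<open>Quotient algebras\<close>

context nu_algebra
begin

lemma quot_simps:
  "carrier (alg_quot A J) = a_rcosets J"
  "C \<oplus>\<^bsub>alg_quot A J\<^esub> D = C <+> D"
  "\<zero>\<^bsub>alg_quot A J\<^esub> = J"
  "C \<otimes>\<^bsub>alg_quot A J\<^esub> D = (\<Union>a\<in>C. \<Union>b\<in>D. J +> (a \<otimes> b))"
  "k \<odot>\<^bsub>alg_quot A J\<^esub> C = (\<Union>a\<in>C. J +> (k \<odot> a))"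
  by (simp_all add: alg_quot_def FactRing_def ring.defs module.defs rcoset_mult_def)

context
  fixes J assumes J: "alg_ideal F A J"
begin

lemma J_abelian_subgroup: "abelian_subgroup J A"
  using J unfolding alg_ideal_def
  by (intro abelian_subgroupI3 additive_subgroup.intro submodule.axioms(1)[of J F] M.abelian_group_axioms)
    auto

lemma coset_mem_iff: "x \<in> carrier A \<Longrightarrow> y \<in> J +> x \<longleftrightarrow> y \<in> carrier A \<and> y \<ominus> x \<in> J"
proof -
  interpret J: abelian_subgroup J A by (rule J_abelian_subgroup)
  assume x: "x \<in> carrier A"
  have "J +> x \<subseteq> carrier A" using x alg_idealD(1)[OF J] by (rule M.a_r_coset_subset_G[rotated])
  then show ?thesis
    using J.a_rcos_module[of x y] x by (auto simp: a_minus_def)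
qed

lemma coset_self: "x \<in> carrier A \<Longrightarrow> x \<in> J +> x"
  using abelian_subgroup.a_rcos_self[OF J_abelian_subgroup] .

lemma coset_eqI: "\<lbrakk>x \<in> carrier A; y \<in> carrier A; y \<ominus> x \<in> J\<rbrakk> \<Longrightarrow> J +> y = J +> x"
  using M.a_repr_independence[of y J x] coset_mem_iff[of x y]
    additive_subgroup.a_subgroup[OF abelian_subgroup.axioms(1)[OF J_abelian_subgroup]] by blast

lemma coset_eq_iff: "\<lbrakk>x \<in> carrier A; y \<in> carrier A\<rbrakk> \<Longrightarrow> J +> y = J +> x \<longleftrightarrow> y \<ominus> x \<in> J"
  using coset_eqI coset_self coset_mem_iff by metis

lemma quot_zero_eq: "\<zero>\<^bsub>alg_quot A J\<^esub> = J +> \<zero>"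
  using M.a_coset_add_zero alg_idealD(1)[OF J] by (simp add: quot_simps)

lemma quot_carrierE:
  assumes "C \<in> carrier (alg_quot A J)"
  obtains x where "x \<in> carrier A" "C = J +> x"
  using assms by (auto simp: quot_simps A_RCOSETS_def' )

lemma quot_carrierI: "x \<in> carrier A \<Longrightarrow> J +> x \<in> carrier (alg_quot A J)"
  by (auto simp: quot_simps A_RCOSETS_def')

lemma quot_add:
  "\<lbrakk>x \<in> carrier A; y \<in> carrier A\<rbrakk> \<Longrightarrow> (J +> x) \<oplus>\<^bsub>alg_quot A J\<^esub> (J +> y) = J +> (x \<oplus> y)"
  unfolding quot_simps by (rule abelian_subgroup.a_rcos_sum[OF J_abelian_subgroup])

lemma quot_mult:
  assumes xy: "x \<in> carrier A" "y \<in> carrier A"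
  shows "(J +> x) \<otimes>\<^bsub>alg_quot A J\<^esub> (J +> y) = J +> (x \<otimes> y)"
proof -
  have "J +> (a \<otimes> b) = J +> (x \<otimes> y)" if "a \<in> J +> x" "b \<in> J +> y" for a b
  proof -
    have ab: "a \<in> carrier A" "b \<in> carrier A" "a \<ominus> x \<in> J" "b \<ominus> y \<in> J"
      using that xy coset_mem_iff by auto
    have c: "x \<otimes> b \<in> carrier A" "a \<otimes> b \<in> carrier A" "x \<otimes> y \<in> carrier A" using ab xy by auto
    have "(a \<ominus> x) \<otimes> b \<oplus> x \<otimes> (b \<ominus> y) \<in> J"
      using ab xy alg_idealD[OF J] by simp
    also have "(a \<ominus> x) \<otimes> b \<oplus> x \<otimes> (b \<ominus> y) = a \<otimes> b \<ominus> x \<otimes> y"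
      using ab xy c by (simp add: mult_minus_left mult_minus_right)
        (simp add: a_minus_def M.a_assoc M.r_neg1 M.r_neg2)
    finally show ?thesis using ab xy by (intro coset_eqI) auto
  qed
  then show ?thesis
    unfolding quot_simps using coset_self[OF xy(1)] coset_self[OF xy(2)] by blast
qed

lemma quot_smult:
  assumes x: "x \<in> carrier A" and k: "k \<in> carrier F"
  shows "k \<odot>\<^bsub>alg_quot A J\<^esub> (J +> x) = J +> (k \<odot> x)"
proof -
  have "J +> (k \<odot> a) = J +> (k \<odot> x)" if "a \<in> J +> x" for a
  proof -
    have a: "a \<in> carrier A" "a \<ominus> x \<in> J" using that x coset_mem_iff by auto
    have "k \<odot> (a \<ominus> x) = k \<odot> a \<ominus> k \<odot> x"
      using a x k by (simp add: a_minus_def smult_r_distr smult_r_minus)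
    then show ?thesis using a x k alg_idealD(7)[OF J k a(2)] by (intro coset_eqI) auto
  qed
  then show ?thesis unfolding quot_simps using coset_self[OF x] by blast
qed

lemma quot_nu_algebra: "nu_algebra F (alg_quot A J)"
proof -
  note q = quot_add quot_mult quot_smult quot_carrierI quot_zero_eq
  have ag: "abelian_group (alg_quot A J)"
  proof (rule abelian_groupI)
    fix C assume "C \<in> carrier (alg_quot A J)"
    then obtain x where x: "x \<in> carrier A" "C = J +> x" by (rule quot_carrierE)
    show "\<exists>y\<in>carrier (alg_quot A J). y \<oplus>\<^bsub>alg_quot A J\<^esub> C = \<zero>\<^bsub>alg_quot A J\<^esub>"
      using x by (intro bexI[of _ "J +> (\<ominus> x)"]) (auto simp: q M.l_neg)
  qed (auto elim!: quot_carrierE simp: q M.a_ac)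
  have "module F (alg_quot A J)"
    by (rule moduleI[OF R.is_cring ag])
      (auto elim!: quot_carrierE simp: q smult_l_distr smult_r_distr smult_assoc1)
  then show ?thesis
    by (intro nu_algebra.intro nu_algebra_axioms.intro)
      (auto elim!: quot_carrierE simp: q mult_assoc mult_add_left mult_add_right
        mult_smult_left mult_smult_right)
qed

end

end

section \<open>Leavitt path algebras: generators, relations and representations\<close>

lemma (in abelian_group) minus_eq_zeroD:
  "\<lbrakk>x \<in> carrier G; y \<in> carrier G; x \<ominus> y = \<zero>\<rbrakk> \<Longrightarrow> x = y"
  by (metis a_minus_def a_inv_closed minus_equality minus_minus)

context nu_algebra
begin

lemma list_mult_closed: "\<lbrakk>set w \<subseteq> carrier A; w \<noteq> []\<rbrakk> \<Longrightarrow> list_mult A w \<in> carrier A"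
  by (induction w rule: induct_list012) auto

lemma list_mult_Cons:
  "w \<noteq> [] \<Longrightarrow> list_mult A (x # w) = x \<otimes> list_mult A w"
  by (cases w) auto

lemma list_mult_append:
  "\<lbrakk>set u \<subseteq> carrier A; u \<noteq> []; set w \<subseteq> carrier A; w \<noteq> []\<rbrakk>
    \<Longrightarrow> list_mult A (u @ w) = list_mult A u \<otimes> list_mult A w"
  by (induction u rule: induct_list012)
    (auto simp: list_mult_Cons mult_assoc list_mult_closed)

end

lemma (in cring) words_semigroup_algebra: "semigroup_algebra R (words G)"
  by (intro semigroup_algebra.intro is_cring semigroup_algebra_axioms.intro)
    (auto simp: words_def)

lemma words_simps: "carrier (words G) = lists G - {[]}" "u \<otimes>\<^bsub>words G\<^esub> w = u @ w"
  by (simp_all add: words_def)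

lemma lpa_gensI:
  "v \<in> verts E \<Longrightarrow> Vx v \<in> lpa_gens E" "e \<in> arcs E \<Longrightarrow> Ed e \<in> lpa_gens E"
  "e \<in> arcs E \<Longrightarrow> Gh e \<in> lpa_gens E"
  by (auto simp: lpa_gens_def)

locale free_lpa = wf_digraph E + F?: cring F
  for E :: "('v, 'e) pre_digraph" and F :: "('k, 'm) ring_scheme"
begin

abbreviation "W \<equiv> lists (lpa_gens E) - {[]}"
abbreviation "FA \<equiv> lpa_free F E"
abbreviation "LA \<equiv> lpa F E"
abbreviation "gen \<equiv> lpa_gen F E"

sublocale words: semigroup_algebra F "words (lpa_gens E)"
  by (rule words_semigroup_algebra)

lemma free_on: "free_on F W (FA)"
  using words.FM_free_on by (simp add: free_algebra_def words_simps)

sublocale free: nu_algebra F FA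
  using words.FM_nu_algebra by (simp add: free_algebra_def)

lemma delta_word: "w \<in> W \<Longrightarrow> delta F w \<in> carrier FA"
  by (rule delta_carrier[OF free_on])

lemma delta_mult:
  "\<lbrakk>u \<in> W; w \<in> W\<rbrakk> \<Longrightarrow> delta F u \<otimes>\<^bsub>FA\<^esub> delta F w = delta F (u @ w)"
  using words.FM_mult_delta[of u w] by (simp add: free_algebra_def words_simps)

lemma regular_vertexD: "regular_vertex E v \<Longrightarrow> v \<in> verts E \<and> finite (out_arcs E v)"
  by (simp add: regular_vertex_def)

lemma relations_carrier: "lpa_relations F E \<subseteq> carrier FA"
proof
  fix r assume "r \<in> lpa_relations F E"
  then show "r \<in> carrier FA"
    by induction (auto intro!: free.M.minus_closed delta_word free.M.finsum_closed
        simp: lpa_gensI dest: regular_vertexD)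
qed

lemma lpa_ideal0: "alg_ideal F (FA) (lpa_ideal0 F E)"
  and relations_lpa_ideal0: "lpa_relations F E \<subseteq> lpa_ideal0 F E"
  unfolding lpa_ideal0_def by (rule free.alg_ideal_gen[OF relations_carrier])+

sublocale L: nu_algebra F LA
  unfolding lpa_def by (rule free.quot_nu_algebra[OF lpa_ideal0])

abbreviation proj :: "(('v, 'e) gen list \<Rightarrow> 'k) \<Rightarrow> (('v, 'e) gen list \<Rightarrow> 'k) set" where
  "proj a \<equiv> lpa_ideal0 F E +>\<^bsub>FA\<^esub> a"

lemma proj_closed: "x \<in> carrier FA \<Longrightarrow> proj x \<in> carrier LA"
  unfolding lpa_def by (rule free.quot_carrierI[OF lpa_ideal0])

lemma proj_surj:
  assumes "C \<in> carrier LA"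
  obtains x where "x \<in> carrier FA" "C = proj x"
  using assms unfolding lpa_def by (rule free.quot_carrierE[OF lpa_ideal0])

lemma proj_semilinear: "semilinear F id (FA) LA proj"
  unfolding semilinear_def lpa_def
  by (auto simp: free.quot_add[OF lpa_ideal0] free.quot_smult[OF lpa_ideal0] free.quot_carrierI[OF lpa_ideal0])

lemma proj_add:
  "\<lbrakk>x \<in> carrier FA; y \<in> carrier FA\<rbrakk>
    \<Longrightarrow> proj x \<oplus>\<^bsub>LA\<^esub> proj y = proj (x \<oplus>\<^bsub>FA\<^esub> y)"
  using semilinearD(2)[OF proj_semilinear] by simp

lemma proj_smult:
  "\<lbrakk>k \<in> carrier F; x \<in> carrier FA\<rbrakk>
    \<Longrightarrow> k \<odot>\<^bsub>LA\<^esub> proj x = proj (k \<odot>\<^bsub>FA\<^esub> x)"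
  using semilinearD(3)[OF proj_semilinear] by simp

lemma proj_mult:
  "\<lbrakk>x \<in> carrier FA; y \<in> carrier FA\<rbrakk>
    \<Longrightarrow> proj (x \<otimes>\<^bsub>FA\<^esub> y) = proj x \<otimes>\<^bsub>LA\<^esub> proj y"
  unfolding lpa_def by (simp add: free.quot_mult[OF lpa_ideal0])

lemma proj_eq_iff:
  "\<lbrakk>x \<in> carrier FA; y \<in> carrier FA\<rbrakk>
    \<Longrightarrow> proj x = proj y \<longleftrightarrow> x \<ominus>\<^bsub>FA\<^esub> y \<in> lpa_ideal0 F E"
  by (rule free.coset_eq_iff[OF lpa_ideal0])

lemma lpa_gen_closed: "g \<in> lpa_gens E \<Longrightarrow> gen g \<in> carrier LA"
  unfolding lpa_gen_def by (auto intro!: proj_closed delta_word)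

lemma proj_delta:
  "\<lbrakk>set w \<subseteq> lpa_gens E; w \<noteq> []\<rbrakk> \<Longrightarrow> proj (delta F w) = list_mult LA (map gen w)"
proof (induction w rule: induct_list012)
  case (3 x y zs)
  have "proj (delta F (x # y # zs)) = proj (delta F [x] \<otimes>\<^bsub>FA\<^esub> delta F (y # zs))"
    using 3 by (subst delta_mult) auto
  also have "\<dots> = proj (delta F [x]) \<otimes>\<^bsub>LA\<^esub> proj (delta F (y # zs))"
    using 3 by (intro proj_mult delta_word) auto
  finally show ?case using 3 by (simp add: lpa_gen_def)
qed (auto simp: lpa_gen_def)

lemma lpa_induct [consumes 1, case_names zero word add]:
  assumes "C \<in> carrier LA" "P \<zero>\<^bsub>LA\<^esub>"
    and w: "\<And>k w. \<lbrakk>k \<in> carrier F; set w \<subseteq> lpa_gens E; w \<noteq> []\<rbrakk>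
      \<Longrightarrow> P (k \<odot>\<^bsub>LA\<^esub> list_mult LA (map gen w))"
    and a: "\<And>x y. \<lbrakk>x \<in> carrier LA; y \<in> carrier LA; P x; P y\<rbrakk>
      \<Longrightarrow> P (x \<oplus>\<^bsub>LA\<^esub> y)"
  shows "P C"
proof -
  note s = semilinearD[OF proj_semilinear]
  obtain x where x: "x \<in> carrier FA" "C = proj x"
    using assms(1) by (rule proj_surj)
  have "P (proj x)"
    using free_on x(1)
  proof (induction rule: F.free_on_induct)
    case zero
    then show ?case
      using assms(2) free.quot_zero_eq[OF lpa_ideal0] unfolding lpa_def by simp
  next
    case (delta k b)
    then have "proj (k \<odot>\<^bsub>FA\<^esub> delta F b) =
        k \<odot>\<^bsub>LA\<^esub> list_mult LA (map gen b)"
      using s(3)[of k "delta F b"] delta_word[of b] proj_delta[of b]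
      by (simp add: in_lists_conv_set subset_iff)
    then show ?case using w[of k b] delta by (simp add: in_lists_conv_set subset_iff)
  next
    case (add x y)
    then show ?case using s by (auto intro: a)
  qed
  then show ?thesis using x by simp
qed

text \<open>The relations involve only words of length at most two, so the values of \<open>h\<close> on these words
  decide whether it kills them. This serves homomorphisms and actions alike.\<close>

lemma relations_vanish:
  assumes N: "module G N" and h: "semilinear F \<iota> (FA) N h"
    and "\<And>v. v \<in> verts E \<Longrightarrow> h (delta F [Vx v, Vx v]) = h (delta F [Vx v])"
    and "\<And>v w. \<lbrakk>v \<in> verts E; w \<in> verts E; v \<noteq> w\<rbrakk> \<Longrightarrow> h (delta F [Vx v, Vx w]) = \<zero>\<^bsub>N\<^esub>"
    and "\<And>e. e \<in> arcs E \<Longrightarrow> h (delta F [Vx (tail E e), Ed e]) = h (delta F [Ed e])"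
    and "\<And>e. e \<in> arcs E \<Longrightarrow> h (delta F [Ed e, Vx (head E e)]) = h (delta F [Ed e])"
    and "\<And>e. e \<in> arcs E \<Longrightarrow> h (delta F [Vx (head E e), Gh e]) = h (delta F [Gh e])"
    and "\<And>e. e \<in> arcs E \<Longrightarrow> h (delta F [Gh e, Vx (tail E e)]) = h (delta F [Gh e])"
    and "\<And>e. e \<in> arcs E \<Longrightarrow> h (delta F [Gh e, Ed e]) = h (delta F [Vx (head E e)])"
    and "\<And>e g. \<lbrakk>e \<in> arcs E; g \<in> arcs E; e \<noteq> g\<rbrakk> \<Longrightarrow> h (delta F [Gh e, Ed g]) = \<zero>\<^bsub>N\<^esub>"
    and "\<And>v. regular_vertex E v \<Longrightarrow>
      h (delta F [Vx v]) = (\<Oplus>\<^bsub>N\<^esub>e \<in> out_arcs E v. h (delta F [Ed e, Gh e]))"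
    and r: "r \<in> lpa_relations F E"
  shows "h r = \<zero>\<^bsub>N\<^esub>"
proof -
  interpret N: module G N by (rule N)
  note s = semilinearD[OF h]
  have m: "h (x \<ominus>\<^bsub>FA\<^esub> y) = \<zero>\<^bsub>N\<^esub>"
    if "x \<in> carrier FA" "y \<in> carrier FA" "h x = h y" for x y
    using that s semilinear_diff[OF free.module_axioms N h] by (simp add: a_minus_def N.M.r_neg)
  have f: "h (\<Oplus>\<^bsub>FA\<^esub>e \<in> out_arcs E v. delta F [Ed e, Gh e]) =
      (\<Oplus>\<^bsub>N\<^esub>e \<in> out_arcs E v. h (delta F [Ed e, Gh e]))" for v
    by (rule semilinear_sum[OF free.module_axioms N h]) (auto simp: lpa_gensI intro!: delta_word)
  show ?thesis
    using r
    by induction (auto intro!: m delta_word free.M.finsum_closed simp: assms f lpa_gensI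
        dest: regular_vertexD)
qed

lemma proj_relation: "r \<in> lpa_relations F E \<Longrightarrow> proj r = \<zero>\<^bsub>LA\<^esub>"
proof -
  assume r: "r \<in> lpa_relations F E"
  then have "r \<ominus>\<^bsub>FA\<^esub> \<zero>\<^bsub>FA\<^esub> \<in> lpa_ideal0 F E"
    using relations_lpa_ideal0 free.alg_idealD(3,6)[OF lpa_ideal0] by auto
  then have "proj r = proj \<zero>\<^bsub>FA\<^esub>"
    using r relations_carrier proj_eq_iff by auto
  then show ?thesis
    using free.quot_zero_eq[OF lpa_ideal0] by (simp add: lpa_def)
qed

end

text \<open>By the universal property such a family is the same as a homomorphism from the Leavitt path
  algebra. Base change and the twisting automorphism both arise in this way.\<close>

locale leavitt_family = nu_algebra F A + wf_digraph E
  for F :: "('k, 'm) ring_scheme" and A :: "('k, 'a, 'n) module_scheme" (structure)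
    and E :: "('v, 'e) pre_digraph" +
  fixes \<phi> :: "('v, 'e) gen \<Rightarrow> 'a"
  assumes gen_closed: "x \<in> lpa_gens E \<Longrightarrow> \<phi> x \<in> carrier A"
    and vertex_idem: "v \<in> verts E \<Longrightarrow> \<phi> (Vx v) \<otimes> \<phi> (Vx v) = \<phi> (Vx v)"
    and vertex_orth: "\<lbrakk>v \<in> verts E; w \<in> verts E; v \<noteq> w\<rbrakk> \<Longrightarrow> \<phi> (Vx v) \<otimes> \<phi> (Vx w) = \<zero>"
    and edge_source: "e \<in> arcs E \<Longrightarrow> \<phi> (Vx (tail E e)) \<otimes> \<phi> (Ed e) = \<phi> (Ed e)"
    and edge_range: "e \<in> arcs E \<Longrightarrow> \<phi> (Ed e) \<otimes> \<phi> (Vx (head E e)) = \<phi> (Ed e)"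
    and ghost_range: "e \<in> arcs E \<Longrightarrow> \<phi> (Vx (head E e)) \<otimes> \<phi> (Gh e) = \<phi> (Gh e)"
    and ghost_source: "e \<in> arcs E \<Longrightarrow> \<phi> (Gh e) \<otimes> \<phi> (Vx (tail E e)) = \<phi> (Gh e)"
    and CK1_same: "e \<in> arcs E \<Longrightarrow> \<phi> (Gh e) \<otimes> \<phi> (Ed e) = \<phi> (Vx (head E e))"
    and CK1_diff: "\<lbrakk>e \<in> arcs E; g \<in> arcs E; e \<noteq> g\<rbrakk> \<Longrightarrow> \<phi> (Gh e) \<otimes> \<phi> (Ed g) = \<zero>"
    and CK2: "regular_vertex E v \<Longrightarrow> \<phi> (Vx v) = (\<Oplus>e \<in> out_arcs E v. \<phi> (Ed e) \<otimes> \<phi> (Gh e))"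

context free_lpa
begin

sublocale Lgen: leavitt_family F LA E gen
proof -
  have d2: "proj (delta F [x, y]) = gen x \<otimes>\<^bsub>LA\<^esub> gen y"
    if "x \<in> lpa_gens E" "y \<in> lpa_gens E" for x y
    using proj_delta[of "[x, y]"] that by simp
  have m: "proj x = proj y"
    if "x \<ominus>\<^bsub>FA\<^esub> y \<in> lpa_relations F E"
      "x \<in> carrier FA" "y \<in> carrier FA" for x y
    using that proj_eq_iff relations_lpa_ideal0 by auto
  have r1: "gen x \<otimes>\<^bsub>LA\<^esub> gen y = gen z"
    if "delta F [x, y] \<ominus>\<^bsub>FA\<^esub> delta F [z] \<in> lpa_relations F E"
      "x \<in> lpa_gens E" "y \<in> lpa_gens E" "z \<in> lpa_gens E" for x y z
    using m[OF that(1)] that(2-) by (simp add: d2 delta_word lpa_gen_def[of F E z])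
  have r0: "gen x \<otimes>\<^bsub>LA\<^esub> gen y = \<zero>\<^bsub>LA\<^esub>"
    if "delta F [x, y] \<in> lpa_relations F E" "x \<in> lpa_gens E" "y \<in> lpa_gens E" for x y
    using proj_relation[OF that(1)] that(2-) by (simp add: d2)
  have ck2: "gen (Vx v) =
      (\<Oplus>\<^bsub>LA\<^esub>e \<in> out_arcs E v. gen (Ed e) \<otimes>\<^bsub>LA\<^esub> gen (Gh e))"
    if v: "regular_vertex E v" for v
  proof -
    have c: "(\<lambda>e. delta F [Ed e, Gh e]) \<in> out_arcs E v \<rightarrow> carrier FA"
      by (auto intro!: delta_word simp: lpa_gensI)
    have "gen (Vx v) = proj (\<Oplus>\<^bsub>FA\<^esub>e \<in> out_arcs E v. delta F [Ed e, Gh e])"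
      unfolding lpa_gen_def using regular_vertexD[OF v] c
      by (intro m lpa_relations.CK2[OF v] delta_word free.M.finsum_closed) (auto simp: lpa_gensI)
    also have "\<dots> = (\<Oplus>\<^bsub>LA\<^esub>e \<in> out_arcs E v. proj (delta F [Ed e, Gh e]))"
      by (rule semilinear_sum[OF free.module_axioms L.module_axioms proj_semilinear c])
    also have "\<dots> = (\<Oplus>\<^bsub>LA\<^esub>e \<in> out_arcs E v.
        gen (Ed e) \<otimes>\<^bsub>LA\<^esub> gen (Gh e))"
      by (rule L.M.finsum_cong') (auto simp: d2 lpa_gensI lpa_gen_closed)
    finally show ?thesis .
  qed
  show "leavitt_family F LA E gen"
    by (intro leavitt_family.intro leavitt_family_axioms.intro L.nu_algebra_axioms
        wf_digraph_axioms ck2 r1 r0 lpa_relations.intros)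
      (auto simp: lpa_gensI intro!: lpa_gen_closed)
qed

end

subsection \<open>Homomorphisms\<close>

locale lpa_lift = free_lpa E F + leavitt_family G B E \<phi>
  for E :: "('v, 'e) pre_digraph" and F :: "('k, 'm) ring_scheme"
    and G :: "('l, 'n) ring_scheme" and B :: "('l, 'b, 'p) module_scheme"
    and \<phi> :: "('v, 'e) gen \<Rightarrow> 'b" +
  fixes \<iota> :: "'k \<Rightarrow> 'l"
  assumes \<iota>: "\<iota> \<in> ring_hom F G"
begin

definition free_hom :: "(('v, 'e) gen list \<Rightarrow> 'k) \<Rightarrow> 'b" where
  "free_hom = lin_ext F B \<iota> (\<lambda>w. list_mult B (map \<phi> w))"

lemma word_closed: "w \<in> W \<Longrightarrow> list_mult B (map \<phi> w) \<in> carrier B"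
  using gen_closed by (intro list_mult_closed) (auto simp: in_lists_conv_set)

lemma free_hom_semilinear: "semilinear F \<iota> (FA) B free_hom"
  unfolding free_hom_def using word_closed
  by (intro lin_ext_semilinear[OF F.is_cring module_axioms \<iota> _ free_on]) auto

lemma free_hom_delta: "w \<in> W \<Longrightarrow> free_hom (delta F w) = list_mult B (map \<phi> w)"
  unfolding free_hom_def using word_closed
  by (intro lin_ext_delta[OF F.is_cring module_axioms \<iota> _ free_on]) auto

lemma free_hom_zero: "free_hom \<zero>\<^bsub>FA\<^esub> = \<zero>\<^bsub>B\<^esub>"
  by (rule semilinear_0[OF free.module_axioms module_axioms free_hom_semilinear])

lemma free_hom_mult:
  assumes "x \<in> carrier FA" "y \<in> carrier FA"
  shows "free_hom (x \<otimes>\<^bsub>FA\<^esub> y) = free_hom x \<otimes>\<^bsub>B\<^esub> free_hom y"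
proof -
  note s = semilinearD[OF free_hom_semilinear]
  have i: "\<iota> k \<in> carrier G" if "k \<in> carrier F" for k
    using \<iota> that by (rule ring_hom_closed)
  have 1: "free_hom (delta F w \<otimes>\<^bsub>FA\<^esub> y) = free_hom (delta F w) \<otimes>\<^bsub>B\<^esub> free_hom y"
    if w: "w \<in> W" for w
    using free_on assms(2)
  proof (induction rule: F.free_on_induct)
    case zero
    then show ?case using w delta_word[OF w] s by (simp add: free_hom_zero)
  next
    case (delta k b)
    have wb: "w @ b \<in> W" using w delta by auto
    have "list_mult B (map \<phi> (w @ b)) = list_mult B (map \<phi> w) \<otimes>\<^bsub>B\<^esub> list_mult B (map \<phi> b)"
      using w delta gen_closed unfolding map_append
      by (intro list_mult_append) (auto simp: in_lists_conv_set)
    then show ?case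
      using delta w delta_word[OF w] delta_word[of b] s i delta_word[OF wb]
        delta_mult[OF w, of b] word_closed[of b] word_closed[OF w]
      by (simp add: free.mult_smult_right mult_smult_right free_hom_delta wb del: map_append)
  next
    case (add x y)
    then show ?case
      using delta_word[OF w] s by (simp add: free.mult_add_right mult_add_right)
  qed
  show ?thesis
    using free_on assms(1)
  proof (induction rule: F.free_on_induct)
    case zero
    then show ?case using s assms by (simp add: free_hom_zero)
  next
    case (delta k b)
    then show ?case
      using s i delta_word[of b] 1[of b] assms
      by (simp add: free.mult_smult_left mult_smult_left)
  next
    case (add x y)
    then show ?case
      using s assms by (simp add: free.mult_add_left mult_add_left)
  qed
qed

text \<open>The kernel of \<open>free_hom\<close> is an ideal that contains the relations. Hence \<open>free_hom\<close> is constant on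
  cosets, which is what makes \<open>lpa_hom\<close> well defined.\<close>

lemma free_hom_lpa_ideal0: "x \<in> lpa_ideal0 F E \<Longrightarrow> free_hom x = \<zero>\<^bsub>B\<^esub>"
proof -
  note s = semilinearD[OF free_hom_semilinear]
  let ?K = "{x \<in> carrier FA. free_hom x = \<zero>\<^bsub>B\<^esub>}"
  have i: "\<iota> k \<in> carrier G" if "k \<in> carrier F" for k
    using \<iota> that by (rule ring_hom_closed)
  have "alg_ideal F (FA) ?K"
    by (rule free.alg_idealI) (auto simp: s i free_hom_mult free_hom_zero)
  moreover have "lpa_relations F E \<subseteq> ?K"
  proof
    fix r assume r: "r \<in> lpa_relations F E"
    have d1: "free_hom (delta F [x]) = \<phi> x" if "x \<in> lpa_gens E" for x
      using free_hom_delta[of "[x]"] that by simp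
    have d2: "free_hom (delta F [x, y]) = \<phi> x \<otimes>\<^bsub>B\<^esub> \<phi> y"
      if "x \<in> lpa_gens E" "y \<in> lpa_gens E" for x y
      using free_hom_delta[of "[x, y]"] that by simp
    have ck2: "(\<Oplus>\<^bsub>B\<^esub>e \<in> out_arcs E v. \<phi> (Ed e) \<otimes>\<^bsub>B\<^esub> \<phi> (Gh e)) =
        (\<Oplus>\<^bsub>B\<^esub>e \<in> out_arcs E v. free_hom (delta F [Ed e, Gh e]))" for v
      by (rule M.finsum_cong') (auto simp: d2 lpa_gensI intro!: s delta_word)
    have "free_hom r = \<zero>\<^bsub>B\<^esub>"
      by (rule relations_vanish[OF module_axioms free_hom_semilinear _ _ _ _ _ _ _ _ _ r])
        (simp_all add: d1 d2 lpa_gensI regular_vertexD vertex_idem vertex_orth edge_source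
          edge_range ghost_range ghost_source CK1_same CK1_diff CK2 ck2)
    then show "r \<in> ?K" using r relations_carrier by auto
  qed
  ultimately have "lpa_ideal0 F E \<subseteq> ?K"
    unfolding lpa_ideal0_def by (rule free.alg_ideal_gen_least)
  then show "x \<in> lpa_ideal0 F E \<Longrightarrow> free_hom x = \<zero>\<^bsub>B\<^esub>" by auto
qed

lemma lpa_hom_proj:
  assumes x: "x \<in> carrier FA"
  shows "lpa_hom F B \<iota> \<phi> (proj x) = free_hom x"
proof -
  note s = semilinearD[OF free_hom_semilinear]
  have "free_hom y = free_hom x" if "y \<in> proj x" for y
  proof -
    have y: "y \<in> carrier FA" "y \<ominus>\<^bsub>FA\<^esub> x \<in> lpa_ideal0 F E"
      using that x free.coset_mem_iff[OF lpa_ideal0] by auto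
    have d: "free_hom y \<ominus>\<^bsub>B\<^esub> free_hom x = \<zero>\<^bsub>B\<^esub>"
      using free_hom_lpa_ideal0[OF y(2)] x y
        semilinear_diff[OF free.module_axioms module_axioms free_hom_semilinear] by simp
    show ?thesis by (rule M.minus_eq_zeroD[OF s(1)[OF y(1)] s(1)[OF x] d])
  qed
  then have "free_hom ` proj x = {free_hom x}"
    using free.coset_self[OF lpa_ideal0 x] by blast
  then show ?thesis
    unfolding lpa_hom_def free_hom_def lin_ext_def by simp
qed

lemma lpa_hom_semilinear: "semilinear F \<iota> LA B (lpa_hom F B \<iota> \<phi>)"
proof -
  note s = semilinearD[OF free_hom_semilinear]
  show ?thesis
    unfolding semilinear_def
    by (auto elim!: proj_surj simp: lpa_hom_proj s proj_add proj_smult)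
qed

lemma lpa_hom_mult:
  "\<lbrakk>C \<in> carrier LA; D \<in> carrier LA\<rbrakk>
    \<Longrightarrow> lpa_hom F B \<iota> \<phi> (C \<otimes>\<^bsub>LA\<^esub> D) = lpa_hom F B \<iota> \<phi> C \<otimes>\<^bsub>B\<^esub> lpa_hom F B \<iota> \<phi> D"
  by (auto elim!: proj_surj simp: lpa_hom_proj free_hom_mult proj_mult[symmetric])

lemma lpa_hom_gen: "g \<in> lpa_gens E \<Longrightarrow> lpa_hom F B \<iota> \<phi> (gen g) = \<phi> g"
  unfolding lpa_gen_def using free_hom_delta[of "[g]"] by (simp add: lpa_hom_proj delta_word)

end

subsection \<open>Modules\<close>

text \<open>A word acts letter by letter, starting with its last letter. The elements of the free algebra
  that act as zero form an ideal, so the action descends to the Leavitt path algebra as soon as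
  the operators satisfy the defining relations.\<close>

locale leavitt_action = free_lpa E F + V: module F V
  for E :: "('v, 'e) pre_digraph" and F :: "('k, 'm) ring_scheme"
    and V :: "('k, 'b, 'p) module_scheme" +
  fixes T :: "('v, 'e) gen \<Rightarrow> 'b \<Rightarrow> 'b"
  assumes T_linear: "x \<in> lpa_gens E \<Longrightarrow> semilinear F id V V (T x)"
    and T_vertex_idem: "\<lbrakk>v \<in> verts E; m \<in> carrier V\<rbrakk> \<Longrightarrow> T (Vx v) (T (Vx v) m) = T (Vx v) m"
    and T_vertex_orth: "\<lbrakk>v \<in> verts E; w \<in> verts E; v \<noteq> w; m \<in> carrier V\<rbrakk>
      \<Longrightarrow> T (Vx v) (T (Vx w) m) = \<zero>\<^bsub>V\<^esub>"
    and T_edge_source: "\<lbrakk>e \<in> arcs E; m \<in> carrier V\<rbrakk> \<Longrightarrow> T (Vx (tail E e)) (T (Ed e) m) = T (Ed e) m"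
    and T_edge_range: "\<lbrakk>e \<in> arcs E; m \<in> carrier V\<rbrakk> \<Longrightarrow> T (Ed e) (T (Vx (head E e)) m) = T (Ed e) m"
    and T_ghost_range: "\<lbrakk>e \<in> arcs E; m \<in> carrier V\<rbrakk> \<Longrightarrow> T (Vx (head E e)) (T (Gh e) m) = T (Gh e) m"
    and T_ghost_source: "\<lbrakk>e \<in> arcs E; m \<in> carrier V\<rbrakk> \<Longrightarrow> T (Gh e) (T (Vx (tail E e)) m) = T (Gh e) m"
    and T_CK1_same: "\<lbrakk>e \<in> arcs E; m \<in> carrier V\<rbrakk> \<Longrightarrow> T (Gh e) (T (Ed e) m) = T (Vx (head E e)) m"
    and T_CK1_diff: "\<lbrakk>e \<in> arcs E; g \<in> arcs E; e \<noteq> g; m \<in> carrier V\<rbrakk>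
      \<Longrightarrow> T (Gh e) (T (Ed g) m) = \<zero>\<^bsub>V\<^esub>"
    and T_CK2: "\<lbrakk>regular_vertex E v; m \<in> carrier V\<rbrakk>
      \<Longrightarrow> T (Vx v) m = (\<Oplus>\<^bsub>V\<^esub>e \<in> out_arcs E v. T (Ed e) (T (Gh e) m))"
begin

definition free_act :: "(('v, 'e) gen list \<Rightarrow> 'k) \<Rightarrow> 'b \<Rightarrow> 'b" where
  "free_act x m = lin_ext F V id (\<lambda>w. foldr T w m) x"

lemma T_word_linear: "w \<in> W \<or> w = [] \<Longrightarrow> semilinear F id V V (foldr T w)"
proof (induction w)
  case Nil
  then show ?case by (simp add: semilinear_def)
next
  case (Cons g w)
  then have "w \<in> W \<or> w = []" "g \<in> lpa_gens E" by auto
  then have "semilinear F id V V (foldr T w)" "semilinear F id V V (T g)"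
    using Cons.IH T_linear by blast+
  note s = semilinearD[OF this(1)] semilinearD[OF this(2)]
  show ?case unfolding semilinear_def by (auto simp: s)
qed

lemma T_word_closed: "\<lbrakk>w \<in> W; m \<in> carrier V\<rbrakk> \<Longrightarrow> foldr T w m \<in> carrier V"
  using semilinearD(1)[OF T_word_linear] by blast

lemma free_act_semilinear:
  "m \<in> carrier V \<Longrightarrow> semilinear F id (FA) V (\<lambda>x. free_act x m)"
  unfolding free_act_def using T_word_closed
  by (intro lin_ext_semilinear[OF F.is_cring V.module_axioms id_ring_hom _ free_on]) auto

lemma free_act_delta:
  "\<lbrakk>w \<in> W; m \<in> carrier V\<rbrakk> \<Longrightarrow> free_act (delta F w) m = foldr T w m"
  unfolding free_act_def using T_word_closed
  by (intro lin_ext_delta[OF F.is_cring V.module_axioms id_ring_hom _ free_on]) auto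

lemma free_act_zero: "m \<in> carrier V \<Longrightarrow> free_act \<zero>\<^bsub>FA\<^esub> m = \<zero>\<^bsub>V\<^esub>"
  by (rule semilinear_0[OF free.module_axioms V.module_axioms free_act_semilinear])

lemma free_act_linear:
  assumes "x \<in> carrier FA"
  shows "semilinear F id V V (free_act x)"
  using free_on assms
proof (induction rule: F.free_on_induct)
  case zero
  then show ?case by (auto simp: semilinear_def free_act_zero)
next
  case (delta k b)
  then show ?case
    using semilinearD[OF free_act_semilinear] semilinearD[OF T_word_linear[of b]] delta_word[of b]
    by (auto simp: semilinear_def free_act_delta V.smult_r_distr V.smult_assoc1[symmetric] F.m_comm)
next
  case (add x y)
  then show ?case
    using semilinearD[OF free_act_semilinear]
    by (auto simp: semilinear_def V.smult_r_distr V.M.a_ac)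
qed

lemma free_act_mult:
  assumes x: "x \<in> carrier FA" and y: "y \<in> carrier FA" and m: "m \<in> carrier V"
  shows "free_act (x \<otimes>\<^bsub>FA\<^esub> y) m = free_act x (free_act y m)"
proof -
  note s = semilinearD[OF free_act_semilinear] and s' = semilinearD[OF free_act_linear]
  note z = semilinear_0[OF V.module_axioms V.module_axioms free_act_linear]
  have 1: "free_act (delta F w \<otimes>\<^bsub>FA\<^esub> y) m = free_act (delta F w) (free_act y m)"
    if w: "w \<in> W" for w
    using free_on y
  proof (induction rule: F.free_on_induct)
    case zero
    then show ?case using w delta_word[OF w] z m by (simp add: free_act_zero)
  next
    case (delta k b)
    have wb: "w @ b \<in> W" using w delta by auto
    show ?case
      using delta w delta_word[OF w] delta_word[of b] s s' delta_word[OF wb] m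
        delta_mult[OF w, of b] T_word_closed[of b m]
      by (simp add: free.mult_smult_right free_act_delta wb)
  next
    case (add x y)
    then show ?case
      using delta_word[OF w] s s' m by (simp add: free.mult_add_right)
  qed
  show ?thesis
    using free_on x
  proof (induction rule: F.free_on_induct)
    case zero
    then show ?case using s y m by (simp add: free_act_zero)
  next
    case (delta k b)
    then show ?case
      using s delta_word[of b] 1[of b] y m by (simp add: free.mult_smult_left)
  next
    case (add x' y')
    then show ?case
      using s y m by (simp add: free.mult_add_left)
  qed
qed

lemma free_act_lpa_ideal0: "\<lbrakk>x \<in> lpa_ideal0 F E; m \<in> carrier V\<rbrakk> \<Longrightarrow> free_act x m = \<zero>\<^bsub>V\<^esub>"
proof -
  note s = semilinearD[OF free_act_semilinear] and s' = semilinearD[OF free_act_linear]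
  let ?K = "{x \<in> carrier FA. \<forall>m \<in> carrier V. free_act x m = \<zero>\<^bsub>V\<^esub>}"
  note z = semilinear_0[OF V.module_axioms V.module_axioms free_act_linear]
  have "alg_ideal F (FA) ?K"
    by (rule free.alg_idealI) (auto simp: s s' z free_act_mult free_act_zero)
  moreover have "lpa_relations F E \<subseteq> ?K"
  proof
    fix r assume r: "r \<in> lpa_relations F E"
    have d1: "free_act (delta F [x]) m = T x m" if "x \<in> lpa_gens E" "m \<in> carrier V" for x m
      using free_act_delta[of "[x]"] that by simp
    have d2: "free_act (delta F [x, y]) m = T x (T y m)"
      if "x \<in> lpa_gens E" "y \<in> lpa_gens E" "m \<in> carrier V" for x y m
      using free_act_delta[of "[x, y]"] that by simp
    have "free_act r m = \<zero>\<^bsub>V\<^esub>" if m: "m \<in> carrier V" for m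
    proof -
      have ck2: "(\<Oplus>\<^bsub>V\<^esub>e \<in> out_arcs E v. T (Ed e) (T (Gh e) m)) =
          (\<Oplus>\<^bsub>V\<^esub>e \<in> out_arcs E v. free_act (delta F [Ed e, Gh e]) m)" for v
        by (rule V.M.finsum_cong') (auto simp: d2 lpa_gensI m intro!: s delta_word)
      show ?thesis
        by (rule relations_vanish[OF V.module_axioms free_act_semilinear[OF m] _ _ _ _ _ _ _ _ _ r])
          (simp_all add: d1 d2 lpa_gensI regular_vertexD m T_vertex_idem T_vertex_orth T_edge_source
            T_edge_range T_ghost_range T_ghost_source T_CK1_same T_CK1_diff T_CK2 ck2)
    qed
    then show "r \<in> ?K" using r relations_carrier by auto
  qed
  ultimately have "lpa_ideal0 F E \<subseteq> ?K"
    unfolding lpa_ideal0_def by (rule free.alg_ideal_gen_least)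
  then show "\<lbrakk>x \<in> lpa_ideal0 F E; m \<in> carrier V\<rbrakk> \<Longrightarrow> free_act x m = \<zero>\<^bsub>V\<^esub>" by auto
qed

definition act :: "(('v, 'e) gen list \<Rightarrow> 'k) set \<Rightarrow> 'b \<Rightarrow> 'b" where
  "act C m = the_elem ((\<lambda>x. free_act x m) ` C)"

lemma act_proj:
  assumes x: "x \<in> carrier FA" and m: "m \<in> carrier V"
  shows "act (proj x) m = free_act x m"
proof -
  note s = semilinearD[OF free_act_semilinear[OF m]]
  have "free_act y m = free_act x m" if "y \<in> proj x" for y
  proof -
    have y: "y \<in> carrier FA" "y \<ominus>\<^bsub>FA\<^esub> x \<in> lpa_ideal0 F E"
      using that x free.coset_mem_iff[OF lpa_ideal0] by auto
    have d: "free_act y m \<ominus>\<^bsub>V\<^esub> free_act x m = \<zero>\<^bsub>V\<^esub>"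
      using free_act_lpa_ideal0[OF y(2) m] x y
        semilinear_diff[OF free.module_axioms V.module_axioms free_act_semilinear[OF m]] by simp
    show ?thesis by (rule V.M.minus_eq_zeroD[OF s(1)[OF y(1)] s(1)[OF x] d])
  qed
  then have "(\<lambda>x. free_act x m) ` proj x = {free_act x m}"
    using free.coset_self[OF lpa_ideal0 x] by blast
  then show ?thesis unfolding act_def by simp
qed

lemma act_semilinear:
  assumes m: "m \<in> carrier V"
  shows "semilinear F id LA V (\<lambda>C. act C m)"
proof -
  note s = semilinearD[OF free_act_semilinear[OF m]]
   
  show ?thesis
    unfolding semilinear_def
    by (auto elim!: proj_surj simp: act_proj m s proj_add proj_smult)
qed

lemma act_linear: "C \<in> carrier LA \<Longrightarrow> semilinear F id V V (act C)"
  using semilinearD[OF free_act_linear] unfolding semilinear_def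
  by (auto elim!: proj_surj simp: act_proj)

lemma act_mult:
  "\<lbrakk>C \<in> carrier LA; D \<in> carrier LA; m \<in> carrier V\<rbrakk>
    \<Longrightarrow> act (C \<otimes>\<^bsub>LA\<^esub> D) m = act C (act D m)"
  by (auto elim!: proj_surj simp: act_proj free_act_mult proj_mult[symmetric]
      semilinearD(1)[OF free_act_linear])

lemma act_gen: "\<lbrakk>g \<in> lpa_gens E; m \<in> carrier V\<rbrakk> \<Longrightarrow> act (gen g) m = T g m"
  unfolding lpa_gen_def using free_act_delta[of "[g]"] by (simp add: act_proj delta_word)

end

section \<open>Infinite paths that end in an exclusive cycle\<close>

context wf_digraph
begin

lemma infinite_path_SCons:
  "infinite_path G (e ## z) \<longleftrightarrow> e \<in> arcs G \<and> head G e = tail G (shd z) \<and> infinite_path G z"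
proof
  assume z: "infinite_path G (e ## z)"
  have "z !! i \<in> arcs G \<and> head G (z !! i) = tail G (z !! Suc i)" for i
    using z unfolding infinite_path_def by (auto dest: spec[of _ "Suc i"])
  moreover have "e \<in> arcs G \<and> head G e = tail G (shd z)"
    using z unfolding infinite_path_def by (auto dest: spec[of _ 0])
  ultimately show "e \<in> arcs G \<and> head G e = tail G (shd z) \<and> infinite_path G z"
    by (simp add: infinite_path_def)
next
  assume z: "e \<in> arcs G \<and> head G e = tail G (shd z) \<and> infinite_path G z"
  show "infinite_path G (e ## z)"
    unfolding infinite_path_def
  proof
    fix i
    show "(e ## z) !! i \<in> arcs G \<and> head G ((e ## z) !! i) = tail G ((e ## z) !! Suc i)"
      using z by (cases i) (auto simp: infinite_path_def)
  qed
qed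

lemma tail_equiv_SCons: "tail_equiv (e ## z) q \<longleftrightarrow> tail_equiv z q"
proof
  assume "tail_equiv (e ## z) q"
  then obtain k l where kl: "k > 0" "l > 0" "sdrop k (e ## z) = sdrop l q"
    by (auto simp: tail_equiv_def)
  then have "sdrop (k - 1) z = sdrop l q" by (cases k) auto
  then have "sdrop k z = sdrop (Suc l) q"
    using kl by (metis sdrop_simps(2) sdrop_add Suc_diff_1 add.commute plus_1_eq_Suc sdrop.simps(1) sdrop_stl)
  then show "tail_equiv z q" unfolding tail_equiv_def using kl by blast
next
  assume "tail_equiv z q"
  then obtain k l where kl: "k > 0" "l > 0" "sdrop k z = sdrop l q"
    by (auto simp: tail_equiv_def)
  then have "sdrop (Suc k) (e ## z) = sdrop l q" by simp
  then show "tail_equiv (e ## z) q" unfolding tail_equiv_def using kl by blast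
qed

lemma tail_class_SCons:
  "e ## z \<in> tail_class G q \<longleftrightarrow> e \<in> arcs G \<and> head G e = tail G (shd z) \<and> z \<in> tail_class G q"
  by (auto simp: tail_class_def infinite_path_SCons tail_equiv_SCons)

lemma tail_class_shift:
  assumes "z \<in> tail_class G q" "awalk u p (tail G (shd z))"
  shows "p @- z \<in> tail_class G q \<and> tail G (shd (p @- z)) = u"
  using assms(2)
proof (induction p arbitrary: u)
  case Nil
  then show ?case using assms(1) by (simp add: awalk_Nil_iff)
next
  case (Cons e p)
  then show ?case by (auto simp: awalk_Cons_iff tail_class_SCons)
qed

lemma tail_class_sdrop: "z \<in> tail_class G q \<Longrightarrow> sdrop n z \<in> tail_class G q"
proof (induction n arbitrary: z)
  case (Suc n)
  have "stl z \<in> tail_class G q" using Suc.prems tail_class_SCons[of "shd z" "stl z" q] by simp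
  then show ?case using Suc.IH[of "stl z"] by simp
qed simp

lemma tail_class_nth:
  assumes "z \<in> tail_class G q"
  shows "z !! i \<in> arcs G" "head G (z !! i) = tail G (z !! Suc i)"
  using assms by (auto simp: tail_class_def infinite_path_def)

lemma tail_class_shd: "z \<in> tail_class G q \<Longrightarrow> shd z \<in> arcs G"
  using tail_class_nth(1)[of z q 0] by simp

lemma tail_class_reach:
  assumes "z \<in> tail_class G q"
  shows "tail G (z !! i) \<rightarrow>\<^sup>*\<^bsub>G\<^esub> tail G (z !! (i + n))"
proof (induction n)
  case 0
  then show ?case using tail_class_nth[OF assms] by simp
next
  case (Suc n)
  have "awalk (tail G (z !! (i + n))) [z !! (i + n)] (tail G (z !! (i + Suc n)))"
    using tail_class_nth[OF assms, of "i + n"] head_in_verts[of "z !! (i + n)"]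
    by (simp add: awalk_simps del: snth.simps)
  then show ?case using Suc reachable_awalkI reachable_trans by blast
qed

end

locale exclusive_cycle_graph = wf_digraph E for E :: "('v, 'e) pre_digraph" +
  fixes c :: "'e list"
  assumes excl: "exclusive_cycle E c"
begin

definition q :: "'e stream" where "q = Stream.cycle c"

definition v0 :: 'v where "v0 = tail E (hd c)"

definition C0 :: "'v set" where "C0 = tail E ` set c"

abbreviation H :: "'v set" where "H \<equiv> H_path E q"

abbreviation Q :: "'e stream set" where "Q \<equiv> tail_class E q"

lemma c_nonempty: "c \<noteq> []"
  and c_awalk: "awalk v0 c v0"
  and c_distinct_tails: "distinct (map (tail E) c)"
proof -
  obtain u where u: "awalk u c u" "distinct (tl (awalk_verts u c))" "c \<noteq> []"
    using excl by (auto simp: exclusive_cycle_def cycle_def)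
  then obtain e es where ces: "c = e # es" by (cases c) auto
  have uv: "u = v0" unfolding v0_def using u(1) ces by (simp add: awalk_Cons_iff)
  show "c \<noteq> []" "awalk v0 c v0" using u uv by auto
  have "head E (last c) = u"
    using u(1,3) by (cases c rule: rev_cases) (auto simp: awalk_simps)
  then show "distinct (map (tail E) c)"
    using u(2) uv[unfolded v0_def] ces by (auto simp: awalk_verts_conv)
qed

lemma c_arcs: "set c \<subseteq> arcs E"
  using c_awalk by (simp add: awalk_def)

lemma q_unfold: "q = c @- q"
  unfolding q_def by (rule cycle_decomp[OF c_nonempty])

lemma sset_q: "sset q = set c"
  unfolding q_def using c_nonempty by simp

lemma shd_q: "tail E (shd q) = v0"
  by (simp add: q_def v0_def)

lemma q_nth: "q !! i = c ! (i mod length c)"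
proof -
  have "sdrop i q = Stream.cycle (rotate (i mod length c) c)"
    unfolding q_def by (rule sdrop_cycle[OF c_nonempty])
  then have "q !! i = hd (rotate (i mod length c) c)"
    using sdrop_simps(1)[of i q] by simp
  also have "\<dots> = c ! (i mod length c)"
    using c_nonempty by (simp add: hd_rotate_conv_nth)
  finally show ?thesis .
qed

lemma q_infinite_path: "infinite_path E q"
proof -
  have step: "head E (c ! i) = tail E (c ! (Suc i mod length c))" if "i < length c" for i
  proof -
    have "awalk v0 (take i c @ c ! i # drop (Suc i) c) v0"
      using c_awalk that by (simp add: id_take_nth_drop[symmetric])
    then have d: "awalk (head E (c ! i)) (drop (Suc i) c) v0"
      by (auto simp: awalk_Cons_iff)
    show ?thesis
    proof (cases "Suc i < length c")
      case True
      then have "drop (Suc i) c = c ! Suc i # drop (Suc (Suc i)) c"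
        by (simp add: Cons_nth_drop_Suc)
      then show ?thesis using d True by (simp add: awalk_Cons_iff)
    next
      case False
      then have "Suc i = length c" using that by simp
      then show ?thesis
        using d c_nonempty by (simp add: awalk_Nil_iff v0_def hd_conv_nth)
    qed
  qed
  show ?thesis
    unfolding infinite_path_def
  proof
    fix i
    have "i mod length c < length c" using c_nonempty by simp
    then show "q !! i \<in> arcs E \<and> head E (q !! i) = tail E (q !! Suc i)"
      using step[of "i mod length c"] c_arcs by (auto simp: q_nth mod_Suc_eq simp del: snth.simps)
  qed
qed

lemma q_in_Q: "q \<in> Q"
  using q_infinite_path by (auto simp: tail_class_def tail_equiv_def)

lemma C0_iff: "w \<in> C0 \<longleftrightarrow> (\<exists>i. w = tail E (q !! i))"
proof
  assume "w \<in> C0"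
  then obtain i where "i < length c" "w = tail E (c ! i)"
    by (auto simp: C0_def in_set_conv_nth)
  then show "\<exists>i. w = tail E (q !! i)" by (intro exI[of _ i]) (simp add: q_nth)
next
  assume "\<exists>i. w = tail E (q !! i)"
  then show "w \<in> C0" using c_nonempty by (auto simp: C0_def q_nth)
qed

lemma q_nth_eqI:
  assumes "tail E (q !! i) = tail E (q !! j)"
  shows "i mod length c = j mod length c"
proof -
  have "i mod length c < length c" "j mod length c < length c" using c_nonempty by auto
  moreover have "map (tail E) c ! (i mod length c) = map (tail E) c ! (j mod length c)"
    using assms c_nonempty by (simp add: q_nth)
  ultimately show ?thesis
    using nth_eq_iff_index_eq[OF c_distinct_tails] by (metis length_map)
qed

lemma C0_reach:
  assumes "u \<in> C0" "w \<in> C0"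
  shows "u \<rightarrow>\<^sup>*\<^bsub>E\<^esub> w"
proof -
  obtain i j where ij: "u = tail E (q !! i)" "w = tail E (q !! j)"
    using assms C0_iff by auto
  \<comment> \<open>From position \<open>i\<close> a further \<open>i * (length c - 1)\<close> steps lead to a multiple of \<open>length c\<close>.\<close>
  have "q !! (i + (j + i * (length c - 1))) = q !! j"
  proof -
    have "i + (j + i * (length c - 1)) = j + i * length c"
      using c_nonempty by (cases c) auto
    then show ?thesis unfolding q_nth by (metis mod_mult_self1)
  qed
  then show ?thesis
    using tail_class_reach[OF q_in_Q, of i "j + i * (length c - 1)"] ij by simp
qed

lemma not_H_iff: "w \<in> verts E \<Longrightarrow> w \<notin> H \<longleftrightarrow> (\<exists>u \<in> C0. w \<rightarrow>\<^sup>*\<^bsub>E\<^esub> u)"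
  by (auto simp: H_path_def sset_q C0_def)

lemma C0_verts: "C0 \<subseteq> verts E"
  using c_arcs by (auto simp: C0_def)

lemma C0_not_H: "w \<in> C0 \<Longrightarrow> w \<notin> H"
  using C0_verts not_H_iff reachable_refl by blast

lemma v0_C0: "v0 \<in> C0"
  using c_nonempty by (simp add: v0_def C0_def)

lemma Q_eventually_C0:
  assumes "z \<in> Q"
  shows "\<exists>k. \<forall>i \<ge> k. tail E (z !! i) \<in> C0"
proof -
  obtain k l where kl: "sdrop k z = sdrop l q"
    using assms by (auto simp: tail_class_def tail_equiv_def)
  have "tail E (z !! i) \<in> C0" if "i \<ge> k" for i
  proof -
    have "z !! i = sdrop k z !! (i - k)" using that by (simp add: sdrop_snth)
    also have "\<dots> = q !! (l + (i - k))" unfolding kl by (simp add: sdrop_snth)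
    finally show ?thesis using C0_iff by auto
  qed
  then show ?thesis by blast
qed

lemma Q_not_H:
  assumes "z \<in> Q"
  shows "tail E (z !! i) \<notin> H"
proof -
  obtain k where k: "\<And>i. i \<ge> k \<Longrightarrow> tail E (z !! i) \<in> C0" using Q_eventually_C0[OF assms] by blast
  have "tail E (z !! i) \<rightarrow>\<^sup>*\<^bsub>E\<^esub> tail E (z !! (i + k))" by (rule tail_class_reach[OF assms])
  moreover have "tail E (z !! (i + k)) \<in> C0" using k by simp
  ultimately show ?thesis
    using not_H_iff tail_class_nth(1)[OF assms] tail_in_verts by blast
qed

lemma Q_start_not_H: "z \<in> Q \<Longrightarrow> tail E (shd z) \<notin> H"
  using Q_not_H[of z 0] by simp

lemma Q_head_not_H: "z \<in> Q \<Longrightarrow> head E (shd z) \<notin> H"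
  using Q_not_H[of z 1] tail_class_nth(2)[of z q 0] by simp

text \<open>The range of \<open>e\<close> lies outside \<open>H\<close>, so a path without repeated vertices leads from it back to the
  source of \<open>e\<close>. Together with \<open>e\<close> this is a cycle based at a vertex of \<open>c\<close>, hence a rotate of
  \<open>c\<close>.\<close>

lemma no_exit:
  assumes e: "e \<in> arcs E" "tail E e \<in> C0" "head E e \<notin> H"
  shows "e \<in> set c"
proof -
  obtain u where "u \<in> C0" "head E e \<rightarrow>\<^sup>*\<^bsub>E\<^esub> u"
    using e not_H_iff by auto
  then have "head E e \<rightarrow>\<^sup>*\<^bsub>E\<^esub> tail E e"
    using C0_reach e(2) reachable_trans by blast
  then obtain p where p: "apath (head E e) p (tail E e)"
    using reachable_apath by blast
  have "awalk (tail E e) (e # p) (tail E e)"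
    using p e by (simp add: awalk_Cons_iff apath_def)
  moreover have "distinct (tl (awalk_verts (tail E e) (e # p)))"
    using p by (simp add: apath_def)
  ultimately have "cycle (e # p)" unfolding cycle_def by blast
  then have "\<exists>k. e # p = rotate k c"
    using excl e(2) unfolding exclusive_cycle_def C0_def by fastforce
  then show ?thesis by (metis list.set_intros(1) set_rotate)
qed

lemma c_edge_unique:
  assumes "e \<in> set c" "g \<in> set c" "tail E e = tail E g"
  shows "e = g"
  using assms c_distinct_tails by (auto simp: distinct_map dest: inj_onD)

lemma c_edge_head:
  assumes "e \<in> set c"
  shows "head E e \<in> C0"
proof -
  have "e \<in> sset q" using assms sset_q by simp
  then obtain i where "e = q !! i" by (auto simp: sset_range)
  then show ?thesis using tail_class_nth(2)[OF q_in_Q, of i] C0_iff by metis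
qed

lemma Q_step:
  assumes z: "z \<in> Q" "tail E (z !! i) \<in> C0"
  shows "z !! i \<in> set c" "tail E (z !! Suc i) \<in> C0"
proof -
  show 1: "z !! i \<in> set c"
    using z(2) tail_class_nth[OF z(1), of i] Q_not_H[OF z(1), of "Suc i"]
    by (intro no_exit) auto
  show "tail E (z !! Suc i) \<in> C0"
    using c_edge_head[OF 1] tail_class_nth(2)[OF z(1), of i] by simp
qed

text \<open>By \<open>no_exit\<close> a path of the class that has reached the cycle can only follow it.\<close>

lemma Q_from_C0:
  assumes z: "z \<in> Q" "tail E (shd z) = tail E (q !! i)"
  shows "z = sdrop i q"
proof -
  have "tail E (z !! j) = tail E (q !! (i + j)) \<and> z !! j = q !! (i + j)" for j
  proof (induction j)
    case 0
    have "tail E (z !! 0) \<in> C0" using z C0_iff by auto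
    then have "z !! 0 \<in> set c" using Q_step(1)[OF z(1)] by blast
    then have "z !! 0 = q !! i"
      using z c_edge_unique[of "z !! 0" "q !! i"] sset_q snth_sset[of q i] by simp
    then show ?case by simp
  next
    case (Suc j)
    have t: "tail E (z !! Suc j) = tail E (q !! Suc (i + j))"
      using Suc tail_class_nth(2)[OF z(1), of j] tail_class_nth(2)[OF q_in_Q, of "i + j"] by simp
    then have "tail E (z !! Suc j) \<in> C0" using C0_iff by metis
    then have "z !! Suc j \<in> set c" using Q_step(1)[OF z(1)] by blast
    then have "z !! Suc j = q !! Suc (i + j)"
      using t c_edge_unique[of "z !! Suc j" "q !! Suc (i + j)"] sset_q snth_sset[of q "Suc (i + j)"]
      by simp
    then show ?case by simp
  qed
  then have "smap id z = sdrop i q"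
    unfolding smap_alt by (simp add: sdrop_snth)
  then show ?thesis by (simp add: stream.map_id)
qed

lemma Q_from_v0: "\<lbrakk>z \<in> Q; tail E (shd z) = v0\<rbrakk> \<Longrightarrow> z = q"
  using Q_from_C0[of z 0] shd_q by simp

lemma Q_exists:
  assumes "w \<in> verts E" "w \<notin> H"
  obtains z where "z \<in> Q" "tail E (shd z) = w"
proof -
  obtain u where u: "u \<in> C0" "w \<rightarrow>\<^sup>*\<^bsub>E\<^esub> u" using assms not_H_iff by blast
  obtain i where i: "u = tail E (q !! i)" using u C0_iff by auto
  obtain p where p: "awalk w p u" using u reachable_awalk by blast
  have "sdrop i q \<in> Q" by (rule tail_class_sdrop[OF q_in_Q])
  moreover have "tail E (shd (sdrop i q)) = u" using i by simp
  ultimately show ?thesis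
    using tail_class_shift[of "sdrop i q" q w p] p that by auto
qed

lemma Q_exists_edge:
  assumes "g \<in> arcs E" "head E g \<notin> H"
  obtains z where "g ## z \<in> Q"
  using Q_exists[of "head E g"] assms head_in_verts tail_class_SCons by metis

text \<open>If \<open>\<alpha>\<close> and \<open>\<beta>\<close> had different lengths, \<open>y\<close> would be periodic. As \<open>y\<close> runs into the cycle eventually,
  it would then start on the cycle.\<close>

lemma prefix_injective:
  assumes w: "w \<notin> C0" and y: "y \<in> Q" "tail E (shd y) = w"
    and eq: "\<alpha> @- y = \<beta> @- y"
  shows "\<alpha> = \<beta>"
proof -
  have False if eq: "\<alpha> @- y = \<beta> @- y" and l: "length \<alpha> < length \<beta>" for \<alpha> \<beta> :: "'e list"
  proof -
    define d where "d = length \<beta> - length \<alpha>"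
    have d: "d > 0" using l by (simp add: d_def)
    have p: "y !! (j + d) = y !! j" for j
    proof -
      have "(\<alpha> @- y) !! (length \<beta> + j) = y !! (j + d)"
        using l by (simp add: shift_snth d_def add.commute)
      moreover have "(\<beta> @- y) !! (length \<beta> + j) = y !! j" by (simp add: shift_snth)
      ultimately show ?thesis using eq by simp
    qed
    have k: "y !! (k * d) = y !! 0" for k
    proof (induction k)
      case (Suc k)
      then show ?case using p[of "k * d"] by (simp add: add.commute)
    qed simp
    obtain t where t: "\<And>i. i \<ge> t \<Longrightarrow> tail E (y !! i) \<in> C0" using Q_eventually_C0[OF y(1)] by blast
    have "tail E (y !! (t * d)) \<in> C0" using d by (intro t) simp
    then show False using k[of t] w y(2) by simp
  qed
  from this[of \<alpha> \<beta>] this[of \<beta> \<alpha>] eq have "length \<alpha> = length \<beta>"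
    by (metis linorder_neqE_nat)
  then show ?thesis using eq by (metis shift_left_inj stake_shift stake_append take_all diff_self_eq_0 stake.simps(1) append_Nil2 order_refl)
qed

text \<open>The excess of \<open>\<alpha>\<close> over \<open>\<gamma>\<close> is an initial segment of \<open>c\<^sup>\<infinity>\<close> that returns to \<open>v0\<close>. The vertices of
  \<open>c\<close> are distinct, so its length is a multiple of the length of \<open>c\<close>.\<close>

lemma prefix_of_q:
  assumes \<alpha>: "awalk u \<alpha> v0" and \<gamma>: "awalk u' \<gamma> v0" and len: "length \<gamma> \<le> length \<alpha>"
    and eq: "\<gamma> @- q = \<alpha> @- q"
  obtains j where "\<alpha> = \<gamma> @ concat (replicate j c)"
proof -
  define n where "n = length \<alpha> - length \<gamma>"
  have st: "stake (length \<alpha>) (\<gamma> @- q) = stake (length \<alpha>) (\<alpha> @- q)" using eq by simp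
  have \<alpha>_eq: "\<alpha> = \<gamma> @ stake n q"
    using st len by (simp add: stake_shift n_def)
  have "sdrop (length \<alpha>) (\<gamma> @- q) = sdrop (length \<alpha>) (\<alpha> @- q)" using eq by simp
  then have "sdrop n q = q" using len by (simp add: sdrop_shift n_def)
  then have "tail E (q !! n) = tail E (q !! 0)"
    by (metis sdrop_simps(1) snth.simps(1))
  then have m: "n mod length c = 0" using q_nth_eqI[of n 0] by simp
  have "stake n q = concat (replicate (n div length c) c)"
    unfolding q_def by (rule stake_cycle_eq_mod_0[OF c_nonempty m])
  then show ?thesis using \<alpha>_eq that by simp
qed

end

section \<open>Chen modules\<close>

lemma comp_semilinear:
  "\<lbrakk>semilinear F id M N g; semilinear F id N P h\<rbrakk> \<Longrightarrow> semilinear F id M P (\<lambda>m. h (g m))"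
  unfolding semilinear_def by (auto simp: Pi_iff)

lemma zero_semilinear:
  "module F N \<Longrightarrow> semilinear F id M N (\<lambda>_. \<zero>\<^bsub>N\<^esub>)"
  unfolding semilinear_def
  by (auto simp: abelian_monoid.zero_closed abelian_group.axioms(1) module.axioms(2)
      abelian_monoid.l_zero module.smult_r_null)

lemma finsum_semilinear:
  assumes N: "module F N" and h: "\<And>i. i \<in> I \<Longrightarrow> semilinear F id M N (h i)"
  shows "semilinear F id M N (\<lambda>m. \<Oplus>\<^bsub>N\<^esub>i\<in>I. h i m)"
proof (cases "finite I")
  case True
  interpret N: module F N by (rule N)
  note s = semilinearD[OF h]
  show ?thesis
    unfolding semilinear_def
  proof (intro conjI ballI funcsetI)
    fix x assume x: "x \<in> carrier M"
    then show "(\<Oplus>\<^bsub>N\<^esub>i\<in>I. h i x) \<in> carrier N" by (auto intro!: N.M.finsum_closed s)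
    fix y assume y: "y \<in> carrier M"
    have "(\<Oplus>\<^bsub>N\<^esub>i\<in>I. h i (x \<oplus>\<^bsub>M\<^esub> y)) = (\<Oplus>\<^bsub>N\<^esub>i\<in>I. h i x \<oplus>\<^bsub>N\<^esub> h i y)"
      using x y by (intro N.M.finsum_cong') (auto simp: s)
    also have "\<dots> = (\<Oplus>\<^bsub>N\<^esub>i\<in>I. h i x) \<oplus>\<^bsub>N\<^esub> (\<Oplus>\<^bsub>N\<^esub>i\<in>I. h i y)"
      using x y by (intro N.M.finsum_addf) (auto simp: s)
    finally show "(\<Oplus>\<^bsub>N\<^esub>i\<in>I. h i (x \<oplus>\<^bsub>M\<^esub> y)) = (\<Oplus>\<^bsub>N\<^esub>i\<in>I. h i x) \<oplus>\<^bsub>N\<^esub> (\<Oplus>\<^bsub>N\<^esub>i\<in>I. h i y)" .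
  next
    fix k x assume kx: "k \<in> carrier F" "x \<in> carrier M"
    have "(\<Oplus>\<^bsub>N\<^esub>i\<in>I. h i (k \<odot>\<^bsub>M\<^esub> x)) = (\<Oplus>\<^bsub>N\<^esub>i\<in>I. k \<odot>\<^bsub>N\<^esub> h i x)"
      using kx by (intro N.M.finsum_cong') (auto simp: s)
    also have "\<dots> = k \<odot>\<^bsub>N\<^esub> (\<Oplus>\<^bsub>N\<^esub>i\<in>I. h i x)"
      using kx True by (intro N.finsum_smult_ldistr[symmetric]) (auto simp: s)
    finally show "(\<Oplus>\<^bsub>N\<^esub>i\<in>I. h i (k \<odot>\<^bsub>M\<^esub> x)) = id k \<odot>\<^bsub>N\<^esub> (\<Oplus>\<^bsub>N\<^esub>i\<in>I. h i x)" by simp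
  qed
next
  case False
  interpret N: module F N by (rule N)
  show ?thesis using zero_semilinear[OF N] False by (simp add: N.M.finsum_infinite)
qed

locale chen = free_lpa E F
  for E :: "('v, 'e) pre_digraph" and F :: "('k, 'm) ring_scheme" +
  fixes q :: "'e stream"
begin

abbreviation "Q \<equiv> tail_class E q"
abbreviation "V \<equiv> free_module F Q"
abbreviation "T \<equiv> gen_act F E q"

lemma V_free_on: "free_on F Q V" by (rule free_on_free_module)

sublocale V: module F V by (rule F.free_on_module[OF V_free_on])

lemma V_zero: "(\<lambda>_. \<zero>\<^bsub>F\<^esub>) = \<zero>\<^bsub>V\<^esub>" by (simp add: free_module_def)

lemma delta_V: "p \<in> Q \<Longrightarrow> delta F p \<in> carrier V"
  by (rule F.delta_carrier[OF V_free_on])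

lemma Q_stl: "p \<in> Q \<Longrightarrow> stl p \<in> Q"
  using tail_class_SCons[of "shd p" "stl p" q] by simp

lemma Q_shd: "p \<in> Q \<Longrightarrow> shd p \<in> arcs E \<and> head E (shd p) = tail E (shd (stl p))"
  using tail_class_SCons[of "shd p" "stl p" q] by simp

lemma basis_act_closed:
  assumes "g \<in> lpa_gens E" "p \<in> Q"
  shows "basis_act F E g p \<in> carrier V"
  using assms
  by (cases g) (auto simp: lpa_gens_def delta_V V_zero Q_stl tail_class_SCons)

lemma T_lin_ext: "T g m = lin_ext F V id (basis_act F E g) m"
  by (simp add: gen_act_def lin_ext_def)

lemma T_semilinear: "g \<in> lpa_gens E \<Longrightarrow> semilinear F id V V (T g)"
  using lin_ext_semilinear[OF F.is_cring V.module_axioms id_ring_hom _ V_free_on, of "basis_act F E g"]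
    basis_act_closed
  unfolding T_lin_ext[abs_def] by auto

lemma T_delta: "\<lbrakk>g \<in> lpa_gens E; p \<in> Q\<rbrakk> \<Longrightarrow> T g (delta F p) = basis_act F E g p"
  using lin_ext_delta[OF F.is_cring V.module_axioms id_ring_hom _ V_free_on, of "basis_act F E g"]
    basis_act_closed
  unfolding T_lin_ext by auto

lemma T_zero: "g \<in> lpa_gens E \<Longrightarrow> T g \<zero>\<^bsub>V\<^esub> = \<zero>\<^bsub>V\<^esub>"
  by (rule semilinear_0[OF V.module_axioms V.module_axioms T_semilinear])

lemma eq_on_basis:
  assumes "semilinear F id V V h" "semilinear F id V V h'" "m \<in> carrier V"
    and "\<And>p. p \<in> Q \<Longrightarrow> h (delta F p) = h' (delta F p)"
  shows "h m = h' m"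
  using semilinear_unique[OF F.is_cring V_free_on V.module_axioms id_ring_hom assms(1,2,4,3)] .

sublocale leavitt_action E F V T
proof -
  note ev = T_delta T_zero V_zero tail_class_SCons Q_stl Q_shd delta_V lpa_gensI
  have lin: "semilinear F id V V (\<lambda>m. T g (T h m))" if "g \<in> lpa_gens E" "h \<in> lpa_gens E" for g h
    by (rule comp_semilinear[OF T_semilinear T_semilinear]) (rule that)+
  have eq: "T g (T h m) = T x m"
    if "\<And>p. p \<in> Q \<Longrightarrow> T g (T h (delta F p)) = T x (delta F p)" "m \<in> carrier V"
      "g \<in> lpa_gens E" "h \<in> lpa_gens E" "x \<in> lpa_gens E" for g h x m
    by (rule eq_on_basis[OF lin T_semilinear]) (use that in auto)
  have eq0: "T g (T h m) = \<zero>\<^bsub>V\<^esub>"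
    if "\<And>p. p \<in> Q \<Longrightarrow> T g (T h (delta F p)) = \<zero>\<^bsub>V\<^esub>" "m \<in> carrier V"
      "g \<in> lpa_gens E" "h \<in> lpa_gens E" for g h m
    by (rule eq_on_basis[OF lin zero_semilinear[OF V.module_axioms]]) (use that in auto)
  have ck2: "T (Vx v) m = (\<Oplus>\<^bsub>V\<^esub>e \<in> out_arcs E v. T (Ed e) (T (Gh e) m))"
    if v: "regular_vertex E v" and m: "m \<in> carrier V" for v m
  proof (rule eq_on_basis[of _ "\<lambda>m. \<Oplus>\<^bsub>V\<^esub>e \<in> out_arcs E v. T (Ed e) (T (Gh e) m)"])
    note vv = regular_vertexD[OF v]
    show "semilinear F id V V (T (Vx v))" using vv by (intro T_semilinear) (simp add: lpa_gensI)
    show "semilinear F id V V (\<lambda>m. \<Oplus>\<^bsub>V\<^esub>e \<in> out_arcs E v. T (Ed e) (T (Gh e) m))"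
      by (rule finsum_semilinear[OF V.module_axioms lin]) (auto simp: lpa_gensI)
    fix p assume p: "p \<in> Q"
    \<comment> \<open>Only the edge with which \<open>p\<close> starts contributes to the sum.\<close>
    have e: "T (Ed e) (T (Gh e) (delta F p)) = (if shd p = e then delta F p else \<zero>\<^bsub>V\<^esub>)"
      if "e \<in> arcs E" for e
      using that p by (auto simp: ev)
    have "(\<Oplus>\<^bsub>V\<^esub>e \<in> out_arcs E v. T (Ed e) (T (Gh e) (delta F p))) =
        (\<Oplus>\<^bsub>V\<^esub>e \<in> out_arcs E v. if shd p = e then delta F p else \<zero>\<^bsub>V\<^esub>)"
      using p by (intro V.M.finsum_cong') (auto simp: e delta_V)
    also have "\<dots> = (if tail E (shd p) = v then delta F p else \<zero>\<^bsub>V\<^esub>)"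
    proof (cases "tail E (shd p) = v")
      case True
      then have "shd p \<in> out_arcs E v" using Q_shd[OF p] by simp
      then show ?thesis
        using V.M.finsum_singleton[of "shd p" "out_arcs E v" "\<lambda>_. delta F p"] vv p delta_V True by simp
    next
      case False
      have "(\<Oplus>\<^bsub>V\<^esub>e \<in> out_arcs E v. if shd p = e then delta F p else \<zero>\<^bsub>V\<^esub>) =
          (\<Oplus>\<^bsub>V\<^esub>e \<in> out_arcs E v. \<zero>\<^bsub>V\<^esub>)"
        using False by (intro V.M.finsum_cong') auto
      then show ?thesis using False by simp
    qed
    also have "\<dots> = T (Vx v) (delta F p)"
      using p vv by (auto simp: ev)
    finally show "T (Vx v) (delta F p) = (\<Oplus>\<^bsub>V\<^esub>e \<in> out_arcs E v. T (Ed e) (T (Gh e) (delta F p)))" ..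
  qed (rule m)
  show "leavitt_action E F V T"
    by (intro leavitt_action.intro leavitt_action_axioms.intro free_lpa_axioms V.module_axioms;
        (rule T_semilinear ck2 eq eq0; (assumption | auto simp: ev)))
qed

lemma chen_act_eq: "chen_act F E q C m = act C m"
  by (simp add: chen_act_def act_def free_act_def lin_ext_def)

end

section \<open>The twisting automorphism\<close>

context free_lpa
begin

fun twist_scalar :: "'e \<Rightarrow> 'k \<Rightarrow> ('v, 'e) gen \<Rightarrow> 'k" where
  "twist_scalar e y (Vx v) = \<one>\<^bsub>F\<^esub>"
| "twist_scalar e y (Ed g) = (if g = e then y else \<one>\<^bsub>F\<^esub>)"
| "twist_scalar e y (Gh g) = (if g = e then inv\<^bsub>F\<^esub> y else \<one>\<^bsub>F\<^esub>)"

lemma twist_gen_eq: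
  "g \<in> lpa_gens E \<Longrightarrow> twist_gen F E e y g = twist_scalar e y g \<odot>\<^bsub>LA\<^esub> gen g"
  by (cases g) (auto simp: lpa_gen_closed)

lemma twist_scalar_closed: "y \<in> Units F \<Longrightarrow> twist_scalar e y g \<in> carrier F"
  by (cases g) auto

lemma twist_scalar_cancel:
  "y \<in> Units F \<Longrightarrow> twist_scalar e y (Ed g) \<otimes>\<^bsub>F\<^esub> twist_scalar e y (Gh g) = \<one>\<^bsub>F\<^esub>"
  "y \<in> Units F \<Longrightarrow> twist_scalar e y (Gh g) \<otimes>\<^bsub>F\<^esub> twist_scalar e y (Ed g) = \<one>\<^bsub>F\<^esub>"
  by auto

text \<open>The scalars of \<open>e\<close> and \<open>e\<^sup>*\<close> are inverse to each other, and in every relation all terms are rescaled by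
  the same factor.\<close>

lemma twist_family:
  assumes y: "y \<in> Units F"
  shows "leavitt_family F LA E (twist_gen F E e y)"
proof -
  let ?t = "twist_scalar e y" and ?g = gen
  note t = twist_scalar_closed[OF y]
  have m: "twist_gen F E e y a \<otimes>\<^bsub>LA\<^esub> twist_gen F E e y b =
      (?t a \<otimes>\<^bsub>F\<^esub> ?t b) \<odot>\<^bsub>LA\<^esub> (?g a \<otimes>\<^bsub>LA\<^esub> ?g b)"
    if "a \<in> lpa_gens E" "b \<in> lpa_gens E" for a b
    using that t by (simp add: twist_gen_eq lpa_gen_closed L.mult_smult_left L.mult_smult_right
        L.smult_assoc1[symmetric] F.m_comm)
  note [simp del] = twist_gen.simps
  have ck2: "twist_gen F E e y (Vx v) =
      (\<Oplus>\<^bsub>LA\<^esub>g \<in> out_arcs E v. twist_gen F E e y (Ed g) \<otimes>\<^bsub>LA\<^esub> twist_gen F E e y (Gh g))"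
    if v: "regular_vertex E v" for v
  proof -
    have "(\<Oplus>\<^bsub>LA\<^esub>g \<in> out_arcs E v. twist_gen F E e y (Ed g) \<otimes>\<^bsub>LA\<^esub> twist_gen F E e y (Gh g)) =
        (\<Oplus>\<^bsub>LA\<^esub>g \<in> out_arcs E v. ?g (Ed g) \<otimes>\<^bsub>LA\<^esub> ?g (Gh g))"
      using y by (intro L.M.finsum_cong')
        (auto simp: m lpa_gensI lpa_gen_closed twist_scalar_cancel simp del: twist_scalar.simps)
    then show ?thesis
      using Lgen.CK2[OF v] regular_vertexD[OF v] by (simp add: twist_gen_eq lpa_gensI lpa_gen_closed)
  qed
  show ?thesis
    using y
    by (intro leavitt_family.intro leavitt_family_axioms.intro L.nu_algebra_axioms wf_digraph_axioms ck2)
      (auto simp: m lpa_gensI, auto simp: twist_gen_eq lpa_gensI lpa_gen_closed t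
        Lgen.vertex_idem Lgen.vertex_orth Lgen.edge_source Lgen.edge_range Lgen.ghost_range
        Lgen.ghost_source Lgen.CK1_same Lgen.CK1_diff)
qed

end

section \<open>Laurent polynomials modulo an irreducible polynomial\<close>

locale laurent_field = field K for K :: "('k, 'm) ring_scheme"
begin

sublocale Lz: semigroup_algebra K integer_group
  by (intro semigroup_algebra.intro is_cring semigroup_algebra_axioms.intro)
    (auto simp: integer_group_def)

abbreviation "LP \<equiv> laurent K"

lemma LP_free_on: "free_on K UNIV LP"
  using Lz.FM_free_on by (simp add: laurent_def integer_group_def)

sublocale LP: nu_algebra K LP
  using Lz.FM_nu_algebra by (simp add: laurent_def)

abbreviation X :: "int \<Rightarrow> int \<Rightarrow> 'k" where "X j \<equiv> delta K j"

lemma X_closed [simp]: "X j \<in> carrier LP"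
  by (rule delta_carrier[OF LP_free_on]) simp

lemma X_mult: "X i \<otimes>\<^bsub>LP\<^esub> X j = X (i + j)"
  using Lz.FM_mult_delta[of i j] by (simp add: laurent_def integer_group_def)

lemma LP_one: "\<one>\<^bsub>LP\<^esub> = X 0"
  by (simp add: laurent_def monoid_algebra_def integer_group_def)

lemma LP_cring: "cring LP"
proof -
  have z: "\<zero>\<^bsub>LP\<^esub> \<otimes>\<^bsub>LP\<^esub> h = \<zero>\<^bsub>LP\<^esub>" "h \<otimes>\<^bsub>LP\<^esub> \<zero>\<^bsub>LP\<^esub> = \<zero>\<^bsub>LP\<^esub>" if "h \<in> carrier LP" for h
    using that by simp_all
  have l1: "X 0 \<otimes>\<^bsub>LP\<^esub> h = h" if "h \<in> carrier LP" for h
    using LP_free_on that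
    by (induction rule: free_on_induct) (auto simp: LP.mult_smult_right LP.mult_add_right X_mult)
  have comm1: "X j \<otimes>\<^bsub>LP\<^esub> h = h \<otimes>\<^bsub>LP\<^esub> X j" if "h \<in> carrier LP" for j h
    using LP_free_on that
    by (induction rule: free_on_induct)
      (auto simp: LP.mult_smult_right LP.mult_smult_left LP.mult_add_right LP.mult_add_left
        X_mult add.commute)
  have comm: "g \<otimes>\<^bsub>LP\<^esub> h = h \<otimes>\<^bsub>LP\<^esub> g" if "g \<in> carrier LP" "h \<in> carrier LP" for g h
    using LP_free_on that(1)
    by (induction rule: free_on_induct)
      (use that in \<open>auto simp: LP.mult_smult_right LP.mult_smult_left LP.mult_add_right
        LP.mult_add_left comm1\<close>)
  show ?thesis
  proof (rule cringI)
    show "abelian_group LP" by (rule LP.M.abelian_group_axioms)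
    show "comm_monoid LP"
      by (rule comm_monoidI) (auto simp: LP_one l1 LP.mult_assoc intro: comm)
  qed (rule LP.mult_add_left)
qed

sublocale LP: cring LP by (rule LP_cring)

lemma X_pow: "X 1 [^]\<^bsub>LP\<^esub> (i :: nat) = X (int i)"
  by (induction i) (auto simp: LP_one[symmetric] X_mult add.commute)

definition const :: "'k \<Rightarrow> int \<Rightarrow> 'k" where "const k = k \<odot>\<^bsub>LP\<^esub> \<one>\<^bsub>LP\<^esub>"

lemma const_closed [simp]: "k \<in> carrier K \<Longrightarrow> const k \<in> carrier LP"
  by (simp add: const_def)

lemma const_mult: "\<lbrakk>k \<in> carrier K; h \<in> carrier LP\<rbrakk> \<Longrightarrow> const k \<otimes>\<^bsub>LP\<^esub> h = k \<odot>\<^bsub>LP\<^esub> h"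
  by (simp add: const_def LP.mult_smult_left)

lemma const_ring_hom: "const \<in> ring_hom K LP"
  by (rule ring_hom_memI)
    (auto simp: const_mult, auto simp: const_def LP.smult_assoc1 LP.smult_l_distr)

end

locale laurent_quotient = laurent_field K for K :: "('k, 'm) ring_scheme" +
  fixes f :: "int \<Rightarrow> 'k"
  assumes f_closed: "f \<in> carrier (laurent K)"
    and irred: "ring_irreducible\<^bsub>laurent K\<^esub> f"
begin

abbreviation "K' \<equiv> laurent_quot K f"
abbreviation "cls \<equiv> laurent_class K f"
abbreviation "\<iota> \<equiv> const_class K f"
abbreviation "xb \<equiv> cls (X 1)"

lemma f_not_unit: "f \<notin> Units LP"
  using irred by (auto simp: ring_irreducible_def irreducible_def)

sublocale I: ideal "PIdl\<^bsub>LP\<^esub> f" LP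
  by (rule LP.cgenideal_ideal[OF f_closed])

lemma K'_cring: "cring K'"
  unfolding laurent_quot_def by (rule I.quotient_is_cring[OF LP_cring])

sublocale K': cring K' by (rule K'_cring)

lemma cls_ring_hom: "cls \<in> ring_hom LP K'"
proof -
  have "cls = (+>\<^bsub>LP\<^esub>) (PIdl\<^bsub>LP\<^esub> f)" by (rule ext) (simp add: laurent_class_def)
  then show ?thesis using I.rcos_ring_hom by (simp add: laurent_quot_def)
qed

lemma cls_closed [simp]: "h \<in> carrier LP \<Longrightarrow> cls h \<in> carrier K'"
  using cls_ring_hom by (rule ring_hom_closed)

lemma cls_zero_iff: "h \<in> carrier LP \<Longrightarrow> cls h = \<zero>\<^bsub>K'\<^esub> \<longleftrightarrow> h \<in> PIdl\<^bsub>LP\<^esub> f"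
proof -
  assume h: "h \<in> carrier LP"
  have z: "\<zero>\<^bsub>K'\<^esub> = PIdl\<^bsub>LP\<^esub> f" by (simp add: laurent_quot_def FactRing_def)
  show ?thesis
    unfolding z laurent_class_def
    using LP.a_coset_join1[of "PIdl\<^bsub>LP\<^esub> f" h] LP.a_coset_join2[of h "PIdl\<^bsub>LP\<^esub> f"] h I.a_subgroup by blast
qed

lemma cls_zeroE:
  assumes "h \<in> carrier LP" "cls h = \<zero>\<^bsub>K'\<^esub>"
  obtains g where "g \<in> carrier LP" "h = g \<otimes>\<^bsub>LP\<^esub> f"
proof -
  have "h \<in> PIdl\<^bsub>LP\<^esub> f" using cls_zero_iff assms by blast
  then show ?thesis using that unfolding cgenideal_def by blast
qed

lemma \<iota>_eq: "\<iota> k = cls (const k)"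
  by (simp add: const_class_def const_def)

lemma \<iota>_ring_hom: "\<iota> \<in> ring_hom K K'"
  using ring_hom_trans[OF const_ring_hom cls_ring_hom]
  by (simp add: \<iota>_eq[abs_def] comp_def)

lemma K'_one_not_zero: "\<one>\<^bsub>K'\<^esub> \<noteq> \<zero>\<^bsub>K'\<^esub>"
proof
  assume "\<one>\<^bsub>K'\<^esub> = \<zero>\<^bsub>K'\<^esub>"
  then have "cls \<one>\<^bsub>LP\<^esub> = \<zero>\<^bsub>K'\<^esub>" using ring_hom_one[OF cls_ring_hom] by simp
  then obtain g where g: "g \<in> carrier LP" "\<one>\<^bsub>LP\<^esub> = g \<otimes>\<^bsub>LP\<^esub> f"
    using cls_zeroE[of "\<one>\<^bsub>LP\<^esub>"] by auto
  then have "f \<in> Units LP"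
    using f_closed LP.m_comm[of f g] unfolding Units_def by auto
  then show False using f_not_unit by simp
qed

lemma \<iota>_injective:
  assumes k: "k \<in> carrier K" "\<iota> k = \<zero>\<^bsub>K'\<^esub>"
  shows "k = \<zero>\<^bsub>K\<^esub>"
proof (rule ccontr)
  assume "k \<noteq> \<zero>\<^bsub>K\<^esub>"
  then have u: "k \<in> Units K" using k field_Units by auto
  have "\<one>\<^bsub>K'\<^esub> = \<iota> (k \<otimes>\<^bsub>K\<^esub> inv\<^bsub>K\<^esub> k)"
    using u ring_hom_one[OF \<iota>_ring_hom] by simp
  also have "\<dots> = \<iota> k \<otimes>\<^bsub>K'\<^esub> \<iota> (inv\<^bsub>K\<^esub> k)"
    using u k by (intro ring_hom_mult[OF \<iota>_ring_hom]) auto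
  also have "\<dots> = \<zero>\<^bsub>K'\<^esub>"
    using k u ring_hom_closed[OF \<iota>_ring_hom] by simp
  finally show False using K'_one_not_zero by simp
qed

lemma cls_X_mult: "cls (X i) \<otimes>\<^bsub>K'\<^esub> cls (X j) = cls (X (i + j))"
  by (simp add: ring_hom_mult[OF cls_ring_hom, symmetric] X_mult)

lemma cls_X0: "cls (X 0) = \<one>\<^bsub>K'\<^esub>"
  using ring_hom_one[OF cls_ring_hom] by (simp add: LP_one)

lemma cls_X_unit: "cls (X i) \<in> Units K'"
  unfolding Units_def
  by (auto intro!: bexI[of _ "cls (X (- i))"] simp: cls_X_mult cls_X0)

lemma cls_X_cancel:
  assumes "h \<in> carrier K'" "cls (X i) \<otimes>\<^bsub>K'\<^esub> h = \<zero>\<^bsub>K'\<^esub>"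
  shows "h = \<zero>\<^bsub>K'\<^esub>"
proof -
  have "h = (cls (X (- i)) \<otimes>\<^bsub>K'\<^esub> cls (X i)) \<otimes>\<^bsub>K'\<^esub> h"
    using assms by (simp add: cls_X_mult cls_X0)
  also have "\<dots> = cls (X (- i)) \<otimes>\<^bsub>K'\<^esub> (cls (X i) \<otimes>\<^bsub>K'\<^esub> h)"
    using assms by (intro K'.m_assoc) auto
  also have "\<dots> = \<zero>\<^bsub>K'\<^esub>" using assms by simp
  finally show ?thesis .
qed

end

section \<open>The twisted action\<close>

locale twisted_chen = exclusive_cycle_graph E c + laurent_quotient K f
  for E :: "('v, 'e) pre_digraph" and c :: "'e list" and K :: "('k, 'm) ring_scheme"
    and f :: "int \<Rightarrow> 'k"
begin

sublocale A: free_lpa E K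
  by (intro free_lpa.intro wf_digraph_axioms is_cring)

sublocale C: chen E K' q
  by (intro chen.intro free_lpa.intro wf_digraph_axioms K'_cring)

abbreviation "L \<equiv> lpa K E"
abbreviation L_mult (infixl "\<cdot>" 70) where "x \<cdot> y \<equiv> x \<otimes>\<^bsub>L\<^esub> y"
abbreviation "V \<equiv> free_module K' Q"
abbreviation "vx v \<equiv> lpa_gen K E (Vx v)"
abbreviation "ed e \<equiv> lpa_gen K E (Ed e)"
abbreviation "gh e \<equiv> lpa_gen K E (Gh e)"
abbreviation "t \<equiv> C.twist_scalar (hd c) xb"

text \<open>The operation of \<open>L\<^sub>K(E)\<close> on \<open>V\<^sup>f\<^bsub>[q]\<^esub>\<close>.\<close>

definition \<Phi> ::
    "(('v, 'e) gen list \<Rightarrow> 'k) set \<Rightarrow> ('e stream \<Rightarrow> (int \<Rightarrow> 'k) set) \<Rightarrow> ('e stream \<Rightarrow> (int \<Rightarrow> 'k) set)"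
  where "\<Phi> x m = chen_act K' E q (lpa_twist K' E (hd c) xb (lpa_base_change K f E x)) m"

lemma xb_unit: "xb \<in> Units K'" by (rule cls_X_unit)

lemma \<iota>_closed [simp]: "k \<in> carrier K \<Longrightarrow> \<iota> k \<in> carrier K'"
  by (rule ring_hom_closed[OF \<iota>_ring_hom])

text \<open>These four properties determine the action. They make the representatives in its definition
  invisible to the rest of the proof.\<close>

lemma
  shows \<Phi>_semilinear: "m \<in> carrier V \<Longrightarrow> semilinear K \<iota> L V (\<lambda>x. \<Phi> x m)"
    and \<Phi>_linear: "x \<in> carrier L \<Longrightarrow> semilinear K' id V V (\<Phi> x)"
    and \<Phi>_mult: "\<lbrakk>x \<in> carrier L; y \<in> carrier L; m \<in> carrier V\<rbrakk> \<Longrightarrow> \<Phi> (x \<cdot> y) m = \<Phi> x (\<Phi> y m)"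
    and \<Phi>_gen: "\<lbrakk>g \<in> lpa_gens E; m \<in> carrier V\<rbrakk> \<Longrightarrow> \<Phi> (lpa_gen K E g) m = t g \<odot>\<^bsub>V\<^esub> C.T g m"
proof -
  interpret b: lpa_lift E K K' "lpa K' E" "lpa_gen K' E" \<iota>
    by (intro lpa_lift.intro A.free_lpa_axioms C.Lgen.leavitt_family_axioms lpa_lift_axioms.intro
        \<iota>_ring_hom)
  interpret s: lpa_lift E K' K' "lpa K' E" "twist_gen K' E (hd c) xb" id
    by (intro lpa_lift.intro C.free_lpa_axioms C.twist_family xb_unit lpa_lift_axioms.intro id_ring_hom)
  note b = semilinearD[OF b.lpa_hom_semilinear] and s = semilinearD[OF s.lpa_hom_semilinear]
    and c = semilinearD[OF C.act_semilinear]
  have \<Phi>: "\<Phi> x m = C.act (lpa_hom K' (lpa K' E) id (twist_gen K' E (hd c) xb)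
      (lpa_hom K (lpa K' E) \<iota> (lpa_gen K' E) x)) m" for x m
    by (simp add: \<Phi>_def C.chen_act_eq lpa_twist_def lpa_base_change_def)
  show "m \<in> carrier V \<Longrightarrow> semilinear K \<iota> L V (\<lambda>x. \<Phi> x m)"
    unfolding semilinear_def \<Phi> by (auto simp: b s c)
  show "x \<in> carrier L \<Longrightarrow> semilinear K' id V V (\<Phi> x)"
    using C.act_linear unfolding \<Phi>[abs_def] by (simp add: b s)
  show "\<lbrakk>x \<in> carrier L; y \<in> carrier L; m \<in> carrier V\<rbrakk> \<Longrightarrow> \<Phi> (x \<cdot> y) m = \<Phi> x (\<Phi> y m)"
    unfolding \<Phi> by (simp add: b s b.lpa_hom_mult s.lpa_hom_mult C.act_mult)
  show "\<lbrakk>g \<in> lpa_gens E; m \<in> carrier V\<rbrakk> \<Longrightarrow> \<Phi> (lpa_gen K E g) m = t g \<odot>\<^bsub>V\<^esub> C.T g m"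
    unfolding \<Phi>
    by (simp add: b.lpa_hom_gen s.lpa_hom_gen C.twist_gen_eq c C.lpa_gen_closed
        C.twist_scalar_closed[OF xb_unit] C.act_gen del: twist_gen.simps)
qed

lemma \<Phi>_closed: "\<lbrakk>x \<in> carrier L; m \<in> carrier V\<rbrakk> \<Longrightarrow> \<Phi> x m \<in> carrier V"
  using semilinearD(1)[OF \<Phi>_linear] .

lemma \<Phi>_add_left: "\<lbrakk>x \<in> carrier L; y \<in> carrier L; m \<in> carrier V\<rbrakk> \<Longrightarrow>
    \<Phi> (x \<oplus>\<^bsub>L\<^esub> y) m = \<Phi> x m \<oplus>\<^bsub>V\<^esub> \<Phi> y m"
  using semilinearD(2)[OF \<Phi>_semilinear] .

lemma \<Phi>_smult_left: "\<lbrakk>k \<in> carrier K; x \<in> carrier L; m \<in> carrier V\<rbrakk> \<Longrightarrow>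
    \<Phi> (k \<odot>\<^bsub>L\<^esub> x) m = \<iota> k \<odot>\<^bsub>V\<^esub> \<Phi> x m"
  using semilinearD(3)[OF \<Phi>_semilinear] .

lemma \<Phi>_smult_right: "\<lbrakk>k \<in> carrier K'; x \<in> carrier L; m \<in> carrier V\<rbrakk> \<Longrightarrow>
    \<Phi> x (k \<odot>\<^bsub>V\<^esub> m) = k \<odot>\<^bsub>V\<^esub> \<Phi> x m"
  using semilinearD(3)[OF \<Phi>_linear] by simp

lemma \<Phi>_zero_left: "m \<in> carrier V \<Longrightarrow> \<Phi> \<zero>\<^bsub>L\<^esub> m = \<zero>\<^bsub>V\<^esub>"
  by (rule semilinear_0[OF A.L.module_axioms C.V.module_axioms \<Phi>_semilinear])

lemma \<Phi>_zero_right: "x \<in> carrier L \<Longrightarrow> \<Phi> x \<zero>\<^bsub>V\<^esub> = \<zero>\<^bsub>V\<^esub>"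
  by (rule semilinear_0[OF C.V.module_axioms C.V.module_axioms \<Phi>_linear])

lemma \<Phi>_minus_left: "\<lbrakk>x \<in> carrier L; y \<in> carrier L; m \<in> carrier V\<rbrakk> \<Longrightarrow>
    \<Phi> (x \<ominus>\<^bsub>L\<^esub> y) m = \<Phi> x m \<ominus>\<^bsub>V\<^esub> \<Phi> y m"
  by (rule semilinear_diff[OF A.L.module_axioms C.V.module_axioms \<Phi>_semilinear])

lemma \<Phi>_finsum_left: "\<lbrakk>g \<in> I \<rightarrow> carrier L; m \<in> carrier V\<rbrakk> \<Longrightarrow>
    \<Phi> (\<Oplus>\<^bsub>L\<^esub>i\<in>I. g i) m = (\<Oplus>\<^bsub>V\<^esub>i\<in>I. \<Phi> (g i) m)"
  by (rule semilinear_sum[OF A.L.module_axioms C.V.module_axioms \<Phi>_semilinear])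

abbreviation d :: "'e stream \<Rightarrow> ('e stream \<Rightarrow> (int \<Rightarrow> 'k) set)" where "d p \<equiv> delta K' p"

lemma vx_closed [simp]: "v \<in> verts E \<Longrightarrow> vx v \<in> carrier L"
  and ed_closed [simp]: "e \<in> arcs E \<Longrightarrow> ed e \<in> carrier L"
  and gh_closed [simp]: "e \<in> arcs E \<Longrightarrow> gh e \<in> carrier L"
  by (auto intro!: A.lpa_gen_closed lpa_gensI)

lemma d_closed [simp]: "p \<in> Q \<Longrightarrow> d p \<in> carrier V"
  by (rule C.delta_V)

lemma t_closed: "t g \<in> carrier K'"
  by (rule C.twist_scalar_closed[OF xb_unit])

lemma \<Phi>_vx:
  "\<lbrakk>v \<in> verts E; p \<in> Q\<rbrakk> \<Longrightarrow> \<Phi> (vx v) (d p) = (if v = tail E (shd p) then d p else \<zero>\<^bsub>V\<^esub>)"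
  by (auto simp: \<Phi>_gen lpa_gensI C.T_delta C.V_zero)

lemma \<Phi>_ed:
  "\<lbrakk>e \<in> arcs E; p \<in> Q; head E e = tail E (shd p)\<rbrakk> \<Longrightarrow> \<Phi> (ed e) (d p) = t (Ed e) \<odot>\<^bsub>V\<^esub> d (e ## p)"
  by (simp add: \<Phi>_gen lpa_gensI C.T_delta del: C.twist_scalar.simps)

lemma \<Phi>_gh:
  "\<lbrakk>e \<in> arcs E; p \<in> Q\<rbrakk> \<Longrightarrow> \<Phi> (gh e) (d p) = (if shd p = e then t (Gh e) \<odot>\<^bsub>V\<^esub> d (stl p) else \<zero>\<^bsub>V\<^esub>)"
  by (simp add: \<Phi>_gen lpa_gensI C.T_delta C.V_zero t_closed del: C.twist_scalar.simps)

lemma \<Phi>_ed_gh: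
  assumes "e \<in> arcs E" "p \<in> Q"
  shows "\<Phi> (ed e \<cdot> gh e) (d p) = (if shd p = e then d p else \<zero>\<^bsub>V\<^esub>)"
proof (cases "shd p = e")
  case True
  then have "\<Phi> (ed e \<cdot> gh e) (d p) = (t (Gh e) \<otimes>\<^bsub>K'\<^esub> t (Ed e)) \<odot>\<^bsub>V\<^esub> d p"
    using assms C.Q_shd[OF assms(2)] C.Q_stl[OF assms(2)] t_closed
    by (simp add: \<Phi>_mult \<Phi>_gh \<Phi>_smult_right \<Phi>_ed C.V.smult_assoc1 del: C.twist_scalar.simps)
      (metis stream.collapse)
  then show ?thesis
    using True assms by (simp add: C.twist_scalar_cancel[OF xb_unit] del: C.twist_scalar.simps)
next
  case False
  then show ?thesis using assms by (simp add: \<Phi>_mult \<Phi>_gh \<Phi>_zero_right)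
qed

section \<open>The annihilator is a two-sided ideal\<close>

definition Ann :: "(('v, 'e) gen list \<Rightarrow> 'k) set set" where
  "Ann = {x \<in> carrier L. \<forall>m \<in> carrier V. \<Phi> x m = \<zero>\<^bsub>V\<^esub>}"

lemma annihilator_eq: "annihilator L (twisted_chen_module K E c f) = Ann"
  by (simp add: annihilator_def twisted_chen_module_def Let_def chen_module_def Ann_def \<Phi>_def q_def)

lemma Ann_ideal: "alg_ideal K L Ann"
  by (rule A.L.alg_idealI)
    (auto simp: Ann_def \<Phi>_add_left \<Phi>_smult_left \<Phi>_mult \<Phi>_zero_left \<Phi>_zero_right \<Phi>_closed)

lemma AnnI:
  assumes x: "x \<in> carrier L" and p: "\<And>p. p \<in> Q \<Longrightarrow> \<Phi> x (d p) = \<zero>\<^bsub>V\<^esub>"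
  shows "x \<in> Ann"
proof -
  have "\<Phi> x m = \<zero>\<^bsub>V\<^esub>" if "m \<in> carrier V" for m
    by (rule C.eq_on_basis[OF \<Phi>_linear[OF x] zero_semilinear[OF C.V.module_axioms] that p])
  then show ?thesis using x by (simp add: Ann_def)
qed

lemma AnnD: "\<lbrakk>x \<in> Ann; p \<in> Q\<rbrakk> \<Longrightarrow> \<Phi> x (d p) = \<zero>\<^bsub>V\<^esub>"
  by (simp add: Ann_def)

lemma H_verts: "H \<subseteq> verts E"
  by (auto simp: H_path_def)

lemma vertex_in_Ann: "v \<in> H \<Longrightarrow> vx v \<in> Ann"
  using H_verts Q_start_not_H by (intro AnnI) (auto simp: \<Phi>_vx subset_iff)

lemma breaking_elt_closed: "breaking_elt K E H u \<in> carrier L" if "u \<in> verts E"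
  unfolding breaking_elt_def using that by (intro A.L.M.minus_closed A.L.M.finsum_closed) auto

lemma breaking_verts: "u \<in> breaking_vertices E H \<Longrightarrow> u \<in> verts E"
  by (simp add: breaking_vertices_def)

lemma breaking_set:
  "u \<in> verts E \<Longrightarrow> {e \<in> out_arcs E u. head E e \<notin> H} = {e \<in> out_arcs E u. head E e \<in> verts E - H}"
  using head_in_verts by auto

lemma breaking_in_Ann:
  assumes u: "u \<in> breaking_vertices E H"
  shows "breaking_elt K E H u \<in> Ann"
proof (rule AnnI)
  note uv = breaking_verts[OF u]
  show "breaking_elt K E H u \<in> carrier L" by (rule breaking_elt_closed[OF uv])
  fix p assume p: "p \<in> Q"
  define S where "S = {e \<in> out_arcs E u. head E e \<notin> H}"
  have S: "finite S" "S \<subseteq> out_arcs E u"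
    using u breaking_set[OF uv] by (auto simp: breaking_vertices_def S_def)
  have "\<Phi> (\<Oplus>\<^bsub>L\<^esub>e\<in>S. ed e \<cdot> gh e) (d p) = (\<Oplus>\<^bsub>V\<^esub>e\<in>S. \<Phi> (ed e \<cdot> gh e) (d p))"
    using S p by (intro \<Phi>_finsum_left) auto
  also have "\<dots> = (\<Oplus>\<^bsub>V\<^esub>e\<in>S. if shd p = e then d p else \<zero>\<^bsub>V\<^esub>)"
    using S p by (intro C.V.M.finsum_cong') (auto simp: \<Phi>_ed_gh)
  also have "\<dots> = (if u = tail E (shd p) then d p else \<zero>\<^bsub>V\<^esub>)"
  proof (cases "u = tail E (shd p)")
    case True
    then have "shd p \<in> S"
      using p Q_head_not_H[OF p] tail_class_shd[OF p] by (simp add: S_def)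
    then show ?thesis
      using C.V.M.finsum_singleton[of "shd p" S "\<lambda>_. d p"] S p True by simp
  next
    case False
    have "(\<Oplus>\<^bsub>V\<^esub>e\<in>S. if shd p = e then d p else \<zero>\<^bsub>V\<^esub>) = (\<Oplus>\<^bsub>V\<^esub>e\<in>S. \<zero>\<^bsub>V\<^esub>)"
      using False S by (intro C.V.M.finsum_cong') auto
    then show ?thesis using False by simp
  qed
  finally have "\<Phi> (\<Oplus>\<^bsub>L\<^esub>e\<in>S. ed e \<cdot> gh e) (d p) = \<Phi> (vx u) (d p)"
    using p uv by (simp add: \<Phi>_vx)
  moreover have "(\<Oplus>\<^bsub>L\<^esub>e\<in>S. ed e \<cdot> gh e) \<in> carrier L"
    using S by (intro A.L.M.finsum_closed) auto
  ultimately show "\<Phi> (breaking_elt K E H u) (d p) = \<zero>\<^bsub>V\<^esub>"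
    unfolding breaking_elt_def S_def[symmetric] using p uv \<Phi>_closed
    by (simp add: \<Phi>_minus_left) (simp add: a_minus_def C.V.M.r_neg)
qed

section \<open>Real paths\<close>

text \<open>The end \<open>w\<close> of the path is an argument because an empty edge list does not determine it.\<close>

fun mon :: "'e list \<Rightarrow> 'v \<Rightarrow> (('v, 'e) gen list \<Rightarrow> 'k) set" where
  "mon [] w = vx w"
| "mon (e # \<alpha>) w = ed e \<cdot> mon \<alpha> w"

fun ghost_mon :: "'e list \<Rightarrow> 'v \<Rightarrow> (('v, 'e) gen list \<Rightarrow> 'k) set" where
  "ghost_mon [] w = vx w"
| "ghost_mon (e # \<alpha>) w = ghost_mon \<alpha> w \<cdot> gh e"

lemma mon_closed: "awalk u \<alpha> w \<Longrightarrow> mon \<alpha> w \<in> carrier L"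
  by (induction \<alpha> arbitrary: u) (auto simp: awalk_simps)

lemma ghost_mon_closed: "awalk u \<alpha> w \<Longrightarrow> ghost_mon \<alpha> w \<in> carrier L"
  by (induction \<alpha> arbitrary: u) (auto simp: awalk_simps)

lemma awalk_verts_ends: "awalk u \<alpha> w \<Longrightarrow> u \<in> verts E \<and> w \<in> verts E"
  by (induction \<alpha> arbitrary: u) (auto simp: awalk_simps)

lemma mon_vx: "awalk u \<alpha> w \<Longrightarrow> mon \<alpha> w \<cdot> vx w = mon \<alpha> w"
  by (induction \<alpha> arbitrary: u)
    (auto simp: awalk_simps A.Lgen.vertex_idem A.L.mult_assoc mon_closed awalk_verts_ends)

lemma vx_mon: "awalk u \<alpha> w \<Longrightarrow> vx u \<cdot> mon \<alpha> w = mon \<alpha> w"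
  by (cases \<alpha>) (auto simp: awalk_simps A.Lgen.vertex_idem A.Lgen.edge_source
      A.L.mult_assoc[symmetric] mon_closed)

lemma ghost_mon_vx: "awalk u \<alpha> w \<Longrightarrow> ghost_mon \<alpha> w \<cdot> vx u = ghost_mon \<alpha> w"
  by (cases \<alpha>) (auto simp: awalk_simps A.Lgen.vertex_idem A.Lgen.ghost_source
      A.L.mult_assoc ghost_mon_closed)

lemma mon_append: "\<lbrakk>awalk u' \<gamma> u; awalk u \<delta> w\<rbrakk> \<Longrightarrow> mon (\<gamma> @ \<delta>) w = mon \<gamma> u \<cdot> mon \<delta> w"
  by (induction \<gamma> arbitrary: u')
    (auto simp: awalk_simps vx_mon A.L.mult_assoc mon_closed)

lemma mon_ed:
  assumes "awalk u \<alpha> (tail E g)" "g \<in> arcs E"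
  shows "mon \<alpha> (tail E g) \<cdot> ed g = mon (\<alpha> @ [g]) (head E g)"
  using mon_append[OF assms(1), of "[g]" "head E g"] assms
  by (simp add: awalk_simps A.Lgen.edge_range)

lemma ghost_mon_mon: "awalk u \<alpha> w \<Longrightarrow> ghost_mon \<alpha> w \<cdot> mon \<alpha> w = vx w"
proof (induction \<alpha> arbitrary: u)
  case Nil
  then show ?case by (auto simp: awalk_simps A.Lgen.vertex_idem)
next
  case (Cons e \<alpha>)
  then have w: "awalk (head E e) \<alpha> w" "e \<in> arcs E" by (auto simp: awalk_simps)
  note cl = mon_closed[OF w(1)] ghost_mon_closed[OF w(1)]
  have "ghost_mon (e # \<alpha>) w \<cdot> mon (e # \<alpha>) w =
      ghost_mon \<alpha> w \<cdot> ((gh e \<cdot> ed e) \<cdot> mon \<alpha> w)"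
    using w cl by (simp add: A.L.mult_assoc)
  also have "\<dots> = ghost_mon \<alpha> w \<cdot> mon \<alpha> w"
    using w by (simp add: A.Lgen.CK1_same vx_mon)
  finally show ?case using Cons.IH[OF w(1)] by simp
qed

text \<open>The twist contributes a factor \<open>x\<close> for each passage through the first edge of the cycle.\<close>

definition wt :: "'e list \<Rightarrow> (int \<Rightarrow> 'k) set" where
  "wt \<alpha> = cls (X (int (count_list \<alpha> (hd c))))"

lemma wt_closed [simp]: "wt \<alpha> \<in> carrier K'" by (simp add: wt_def)

lemma wt_Cons: "wt (e # \<alpha>) = t (Ed e) \<otimes>\<^bsub>K'\<^esub> wt \<alpha>"
  by (auto simp: wt_def cls_X_mult add.commute)

lemma \<Phi>_mon:
  assumes y: "y \<in> Q" "tail E (shd y) = w"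
  shows "awalk u \<alpha> w \<Longrightarrow> \<Phi> (mon \<alpha> w) (d y) = wt \<alpha> \<odot>\<^bsub>V\<^esub> d (\<alpha> @- y)"
proof (induction \<alpha> arbitrary: u)
  case Nil
  then show ?case using y by (auto simp: awalk_simps \<Phi>_vx wt_def cls_X0)
next
  case (Cons e \<alpha>)
  then have w: "awalk (head E e) \<alpha> w" "e \<in> arcs E" by (auto simp: awalk_simps)
  have s: "\<alpha> @- y \<in> Q" "tail E (shd (\<alpha> @- y)) = head E e"
    using tail_class_shift[OF y(1), of "head E e" \<alpha>] w y by auto
  have s': "e ## (\<alpha> @- y) \<in> Q" using s w by (simp add: tail_class_SCons)
  have "\<Phi> (mon (e # \<alpha>) w) (d y) = \<Phi> (ed e) (wt \<alpha> \<odot>\<^bsub>V\<^esub> d (\<alpha> @- y))"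
    using w y Cons.IH[OF w(1)] by (simp add: \<Phi>_mult mon_closed[OF w(1)])
  also have "\<dots> = (wt \<alpha> \<otimes>\<^bsub>K'\<^esub> t (Ed e)) \<odot>\<^bsub>V\<^esub> d (e ## (\<alpha> @- y))"
    using w s s' t_closed
    by (simp add: \<Phi>_smult_right \<Phi>_ed C.V.smult_assoc1 del: C.twist_scalar.simps)
  also have "wt \<alpha> \<otimes>\<^bsub>K'\<^esub> t (Ed e) = wt (e # \<alpha>)"
    unfolding wt_Cons using t_closed by (intro K'.m_comm) auto
  finally show ?case by simp
qed

section \<open>Evaluating Laurent polynomials at the cycle\<close>

abbreviation "cyc \<equiv> mon c v0"
abbreviation "cyc_star \<equiv> ghost_mon c v0"

text \<open>As \<open>c\<^sup>*c = v0\<close>, the powers of \<open>c\<^sup>*\<close> serve as negative powers of \<open>c\<close>. On the other side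
  \<open>cc\<^sup>*\<close> may differ from \<open>v0\<close>, so exponents add when the right factor is a power of \<open>c\<close>.\<close>

fun cpos :: "nat \<Rightarrow> (('v, 'e) gen list \<Rightarrow> 'k) set" where
  "cpos 0 = vx v0" | "cpos (Suc j) = cyc \<cdot> cpos j"

fun cneg :: "nat \<Rightarrow> (('v, 'e) gen list \<Rightarrow> 'k) set" where
  "cneg 0 = vx v0" | "cneg (Suc j) = cneg j \<cdot> cyc_star"

definition cpow :: "int \<Rightarrow> (('v, 'e) gen list \<Rightarrow> 'k) set" where
  "cpow j = (if j \<ge> 0 then cpos (nat j) else cneg (nat (- j)))"

lemma v0_verts [simp]: "v0 \<in> verts E"
  using v0_C0 C0_verts by auto

lemma cyc_closed [simp]: "cyc \<in> carrier L" "cyc_star \<in> carrier L"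
  using mon_closed ghost_mon_closed c_awalk by auto

lemma cpos_closed [simp]: "cpos j \<in> carrier L" by (induction j) auto

lemma cneg_closed [simp]: "cneg j \<in> carrier L" by (induction j) auto

lemma cpow_closed [simp]: "cpow j \<in> carrier L" by (simp add: cpow_def)

lemma vx_cpos: "vx v0 \<cdot> cpos j = cpos j"
  by (cases j) (auto simp: A.Lgen.vertex_idem A.L.mult_assoc[symmetric] vx_mon[OF c_awalk])

lemma cpos_vx: "cpos j \<cdot> vx v0 = cpos j"
  by (induction j) (auto simp: A.Lgen.vertex_idem A.L.mult_assoc)

lemma cneg_vx: "cneg j \<cdot> vx v0 = cneg j"
  by (cases j) (auto simp: A.Lgen.vertex_idem A.L.mult_assoc ghost_mon_vx[OF c_awalk])

lemma cpos_add: "cpos i \<cdot> cpos j = cpos (i + j)"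
  by (induction i) (auto simp: vx_cpos A.L.mult_assoc)

lemma cneg_Suc_cpos_Suc: "cneg (Suc i) \<cdot> cpos (Suc j) = cneg i \<cdot> cpos j"
proof -
  have "cneg (Suc i) \<cdot> cpos (Suc j) = cneg i \<cdot> ((cyc_star \<cdot> cyc) \<cdot> cpos j)"
    by (simp add: A.L.mult_assoc)
  then show ?thesis by (simp add: ghost_mon_mon[OF c_awalk] vx_cpos)
qed

lemma cneg_cpos: "cneg i \<cdot> cpos j = cpow (int j - int i)"
proof (induction i arbitrary: j)
  case 0
  then show ?case by (simp add: vx_cpos cpow_def)
next
  case (Suc i)
  show ?case
  proof (cases j)
    case 0
    have "cneg (Suc i) \<cdot> vx v0 = cneg (Suc i)" by (rule cneg_vx)
    moreover have "nat (- (int 0 - int (Suc i))) = Suc i" by simp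
    ultimately show ?thesis unfolding 0 cpow_def by (simp del: cneg.simps)
  next
    case (Suc j')
    then show ?thesis using Suc.IH[of j'] by (simp add: cneg_Suc_cpos_Suc del: cneg.simps cpos.simps)
  qed
qed

lemma cpow_add_nat: "cpow j \<cdot> cpow (int i) = cpow (j + int i)"
proof (cases "j \<ge> 0")
  case True
  then show ?thesis by (simp add: cpow_def cpos_add nat_add_distrib)
next
  case False
  then show ?thesis using cneg_cpos[of "nat (- j)" i] by (simp add: cpow_def[of j] cpow_def[of "int i"] add.commute)
qed

definition ev :: "(int \<Rightarrow> 'k) \<Rightarrow> (('v, 'e) gen list \<Rightarrow> 'k) set" where
  "ev = lin_ext K L id cpow"

lemma ev_semilinear: "semilinear K id LP L ev"
  unfolding ev_def
  by (rule lin_ext_semilinear[OF is_cring A.L.module_axioms id_ring_hom _ LP_free_on]) auto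

lemma ev_X: "ev (X j) = cpow j"
  unfolding ev_def
  by (rule lin_ext_delta[OF is_cring A.L.module_axioms id_ring_hom _ LP_free_on]) auto

lemmas evD = semilinearD[OF ev_semilinear]

lemma count_c: "count_list c (hd c) = 1"
proof -
  have "distinct c" using c_distinct_tails by (simp add: distinct_map)
  then show ?thesis using c_nonempty by (cases c) auto
qed

lemma wt_c: "wt c = xb" by (simp add: wt_def count_c)

lemma c_shift_q: "c @- q = q" using q_unfold by simp

lemma \<Phi>_cyc: "\<Phi> cyc (d q) = xb \<odot>\<^bsub>V\<^esub> d q"
  using \<Phi>_mon[OF q_in_Q shd_q c_awalk] by (simp add: wt_c c_shift_q)

lemma \<Phi>_cyc_star: "\<Phi> cyc_star (d q) = cls (X (- 1)) \<odot>\<^bsub>V\<^esub> d q"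
proof -
  have "d q = cls (X (- 1)) \<odot>\<^bsub>V\<^esub> \<Phi> cyc (d q)"
    using q_in_Q by (simp add: \<Phi>_cyc C.V.smult_assoc1[symmetric] cls_X_mult cls_X0)
  then have "\<Phi> cyc_star (d q) = \<Phi> cyc_star (cls (X (- 1)) \<odot>\<^bsub>V\<^esub> \<Phi> cyc (d q))" by simp
  also have "\<dots> = cls (X (- 1)) \<odot>\<^bsub>V\<^esub> \<Phi> (cyc_star \<cdot> cyc) (d q)"
    using q_in_Q by (simp add: \<Phi>_smult_right \<Phi>_closed \<Phi>_mult)
  also have "\<dots> = cls (X (- 1)) \<odot>\<^bsub>V\<^esub> d q"
    using q_in_Q shd_q by (simp add: ghost_mon_mon[OF c_awalk] \<Phi>_vx)
  finally show ?thesis .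
qed

lemma \<Phi>_cpow: "\<Phi> (cpow j) (d q) = cls (X j) \<odot>\<^bsub>V\<^esub> d q"
proof -
  have p: "\<Phi> (cpos i) (d q) = cls (X (int i)) \<odot>\<^bsub>V\<^esub> d q" for i
    by (induction i) (use q_in_Q shd_q in \<open>auto simp: \<Phi>_vx cls_X0 \<Phi>_mult \<Phi>_smult_right \<Phi>_cyc
      C.V.smult_assoc1[symmetric] cls_X_mult add.commute\<close>)
  have n: "\<Phi> (cneg i) (d q) = cls (X (- int i)) \<odot>\<^bsub>V\<^esub> d q" for i
    by (induction i) (use q_in_Q shd_q in \<open>auto simp: \<Phi>_vx cls_X0 \<Phi>_mult \<Phi>_smult_right \<Phi>_cyc_star
      C.V.smult_assoc1[symmetric] cls_X_mult\<close>)
  show ?thesis using p[of "nat j"] n[of "nat (- j)"] by (simp add: cpow_def)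
qed

text \<open>The cycle multiplies \<open>q\<close> by the class of \<open>x\<close>. So an element \<open>h(c)\<close> multiplies it by the class of \<open>h\<close>.\<close>

lemma \<Phi>_ev:
  assumes h: "h \<in> carrier LP"
  shows "\<Phi> (ev h) (d q) = cls h \<odot>\<^bsub>V\<^esub> d q"
proof (rule semilinear_unique[OF is_cring LP_free_on C.V.module_axioms \<iota>_ring_hom _ _ _ h])
  show "semilinear K \<iota> LP V (\<lambda>h. \<Phi> (ev h) (d q))"
    unfolding semilinear_def using q_in_Q
    by (auto simp: evD \<Phi>_closed \<Phi>_add_left \<Phi>_smult_left)
  have s: "cls (k \<odot>\<^bsub>LP\<^esub> x) = \<iota> k \<otimes>\<^bsub>K'\<^esub> cls x" if "k \<in> carrier K" "x \<in> carrier LP" for k x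
    using that by (simp add: \<iota>_eq ring_hom_mult[OF cls_ring_hom, symmetric] const_mult)
  show "semilinear K \<iota> LP V (\<lambda>h. cls h \<odot>\<^bsub>V\<^esub> d q)"
    unfolding semilinear_def using q_in_Q
    by (auto simp: ring_hom_add[OF cls_ring_hom] s C.V.smult_l_distr C.V.smult_assoc1)
  show "\<Phi> (ev (X j)) (d q) = cls (X j) \<odot>\<^bsub>V\<^esub> d q" for j
    by (simp add: ev_X \<Phi>_cpow)
qed

end

section \<open>Local units and the filtration by ghost degree\<close>

context free_lpa
begin

text \<open>The sum of a large enough finite set of vertices is a right unit for a given \<open>x\<close>. So membership
  in an ideal can be tested one vertex at a time.\<close>

lemma local_right_units:
  assumes x: "x \<in> carrier LA" and I: "alg_ideal F LA I"
    and xI: "\<And>w. w \<in> verts E \<Longrightarrow> x \<otimes>\<^bsub>LA\<^esub> gen (Vx w) \<in> I"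
  shows "x \<in> I"
proof -
  let ?u = "\<lambda>W. \<Oplus>\<^bsub>LA\<^esub>w\<in>W. gen (Vx w)"
  have u: "?u W \<in> carrier LA" if "W \<subseteq> verts E" for W
    using that by (intro L.M.finsum_closed) (auto intro!: lpa_gen_closed lpa_gensI)
  \<comment> \<open>The condition on all larger sets lets the property pass to sums of elements.\<close>
  define unit_on where "unit_on x W \<longleftrightarrow> finite W \<and> W \<subseteq> verts E \<and>
    (\<forall>W'. finite W' \<and> W \<subseteq> W' \<and> W' \<subseteq> verts E \<longrightarrow> x \<otimes>\<^bsub>LA\<^esub> ?u W' = x)" for x W
  have genu: "\<exists>W. unit_on (gen g) W" if g: "g \<in> lpa_gens E" for g
  proof -
    obtain r where r: "r \<in> verts E" "gen g \<otimes>\<^bsub>LA\<^esub> gen (Vx r) = gen g"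
      using g Lgen.vertex_idem Lgen.edge_range Lgen.ghost_source tail_in_verts head_in_verts
      unfolding lpa_gens_def by blast
    have z: "gen g \<otimes>\<^bsub>LA\<^esub> gen (Vx w) = \<zero>\<^bsub>LA\<^esub>" if w: "w \<in> verts E" "r \<noteq> w" for w
    proof -
      have "gen g \<otimes>\<^bsub>LA\<^esub> gen (Vx w) =
          gen g \<otimes>\<^bsub>LA\<^esub> (gen (Vx r) \<otimes>\<^bsub>LA\<^esub> gen (Vx w))"
        using r w g by (subst L.mult_assoc[symmetric]) (auto intro!: lpa_gen_closed lpa_gensI)
      then show ?thesis using Lgen.vertex_orth r w g by (simp add: lpa_gen_closed)
    qed
    have "gen g \<otimes>\<^bsub>LA\<^esub> ?u W = gen g"
      if W: "finite W" "{r} \<subseteq> W" "W \<subseteq> verts E" for W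
    proof -
      have "gen g \<otimes>\<^bsub>LA\<^esub> ?u W =
          (\<Oplus>\<^bsub>LA\<^esub>w\<in>W. gen g \<otimes>\<^bsub>LA\<^esub> gen (Vx w))"
        using g W by (intro L.mult_finsum_right) (auto intro!: lpa_gen_closed lpa_gensI)
      also have "\<dots> = (\<Oplus>\<^bsub>LA\<^esub>w\<in>W. if r = w then gen g else \<zero>\<^bsub>LA\<^esub>)"
        using g W r z by (intro L.M.finsum_cong') (auto intro!: lpa_gen_closed lpa_gensI)
      also have "\<dots> = gen g"
        using g W L.M.finsum_singleton[of r W "\<lambda>_. gen g"] by (simp add: lpa_gen_closed)
      finally show ?thesis .
    qed
    then show ?thesis using r unfolding unit_on_def by (intro exI[of _ "{r}"]) auto
  qed
  have "\<exists>W. unit_on x W"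
    using x
  proof (induction rule: lpa_induct)
    case zero
    show ?case by (intro exI[of _ "{}"]) (auto simp: unit_on_def u)
  next
    case (word k w)
    obtain v g where w: "w = v @ [g]" using word by (cases w rule: rev_cases) auto
    have g: "g \<in> lpa_gens E" using word w by simp
    obtain W where W: "unit_on (gen g) W" using genu[OF g] by auto
    let ?m = "\<lambda>w. list_mult LA (map gen w)"
    have cl: "?m w \<in> carrier LA" if "set w \<subseteq> lpa_gens E" "w \<noteq> []" for w
      using that by (intro L.list_mult_closed) (auto intro!: lpa_gen_closed)
    have "?m w \<otimes>\<^bsub>LA\<^esub> ?u W' = ?m w" if W': "finite W'" "W \<subseteq> W'" "W' \<subseteq> verts E" for W'
    proof (cases "v = []")
      case True
      then show ?thesis using W W' w by (simp add: unit_on_def)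
    next
      case False
      have "?m w = ?m v \<otimes>\<^bsub>LA\<^esub> ?m [g]"
        unfolding w map_append using word w False
        by (intro L.list_mult_append) (auto intro!: lpa_gen_closed)
      then show ?thesis
        using W W' u[OF W'(3)] word w False cl[of v] g
        by (simp add: L.mult_assoc lpa_gen_closed unit_on_def)
    qed
    then show ?case
      using W word cl[of w] u
      by (intro exI[of _ W]) (auto simp: unit_on_def L.mult_smult_left)
  next
    case (add x y)
    then obtain W W2 where "unit_on x W" "unit_on y W2" by auto
    then show ?case
      using add.hyps u by (intro exI[of _ "W \<union> W2"]) (auto simp: unit_on_def L.mult_add_left)
  qed
  then obtain W where W: "unit_on x W" by auto
  then have "x = x \<otimes>\<^bsub>LA\<^esub> ?u W" by (simp add: unit_on_def)
  also have "\<dots> = (\<Oplus>\<^bsub>LA\<^esub>w\<in>W. x \<otimes>\<^bsub>LA\<^esub> gen (Vx w))"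
    using x W by (intro L.mult_finsum_right) (auto intro!: lpa_gen_closed lpa_gensI simp: unit_on_def)
  also have "\<dots> \<in> I"
    using W xI by (intro L.alg_ideal_finsum[OF I]) (auto simp: unit_on_def)
  finally show ?thesis .
qed

end

context twisted_chen
begin

definition paths_to :: "'v \<Rightarrow> 'e list set" where
  "paths_to w = {\<alpha>. \<exists>u. awalk u \<alpha> w}"

definition real_comb :: "'v \<Rightarrow> ('e list \<Rightarrow> 'k) \<Rightarrow> (('v, 'e) gen list \<Rightarrow> 'k) set" where
  "real_comb w = lin_ext K L id (\<lambda>\<alpha>. mon \<alpha> w)"

text \<open>The span of the paths that end at \<open>w\<close>; such paths are called real, in contrast to the ghost paths \<open>\<beta>\<^sup>*\<close>.\<close>

definition real_span :: "'v \<Rightarrow> (('v, 'e) gen list \<Rightarrow> 'k) set set" where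
  "real_span w = real_comb w ` carrier (free_module K (paths_to w))"

lemma paths_to_free: "free_on K (paths_to w) (free_module K (paths_to w))"
  by (rule free_on_free_module)

lemma mon_paths_to: "\<alpha> \<in> paths_to w \<Longrightarrow> mon \<alpha> w \<in> carrier L"
  by (auto simp: paths_to_def mon_closed)

lemma real_span_semilinear:
  "semilinear K id (free_module K (paths_to w)) L (real_comb w)"
  unfolding real_comb_def by (rule lin_ext_semilinear[OF is_cring A.L.module_axioms id_ring_hom _ paths_to_free])
    (auto simp: mon_paths_to)

lemma real_span_delta: "\<alpha> \<in> paths_to w \<Longrightarrow> real_comb w (delta K \<alpha>) = mon \<alpha> w"
  unfolding real_comb_def by (rule lin_ext_delta[OF is_cring A.L.module_axioms id_ring_hom _ paths_to_free])
    (auto simp: mon_paths_to)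

lemma
  shows real_span_closed: "x \<in> real_span w \<Longrightarrow> x \<in> carrier L"
    and real_span_mon: "\<alpha> \<in> paths_to w \<Longrightarrow> mon \<alpha> w \<in> real_span w"
    and real_span_zero: "\<zero>\<^bsub>L\<^esub> \<in> real_span w"
    and real_span_add: "\<lbrakk>x \<in> real_span w; y \<in> real_span w\<rbrakk> \<Longrightarrow> x \<oplus>\<^bsub>L\<^esub> y \<in> real_span w"
    and real_span_smult: "\<lbrakk>k \<in> carrier K; x \<in> real_span w\<rbrakk> \<Longrightarrow> k \<odot>\<^bsub>L\<^esub> x \<in> real_span w"
proof -
  let ?M = "free_module K (paths_to w)"
  interpret M: module K ?M by (rule free_on_module[OF paths_to_free])
  note s = semilinearD[OF real_span_semilinear[of w]]
  show "x \<in> real_span w \<Longrightarrow> x \<in> carrier L" by (auto simp: real_span_def s)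
  show "\<alpha> \<in> paths_to w \<Longrightarrow> mon \<alpha> w \<in> real_span w"
    using real_span_delta delta_carrier[OF paths_to_free] unfolding real_span_def by (metis image_eqI)
  show "\<zero>\<^bsub>L\<^esub> \<in> real_span w"
    using semilinear_0[OF M.module_axioms A.L.module_axioms real_span_semilinear]
    unfolding real_span_def by (metis image_eqI M.zero_closed)
  show "\<lbrakk>x \<in> real_span w; y \<in> real_span w\<rbrakk> \<Longrightarrow> x \<oplus>\<^bsub>L\<^esub> y \<in> real_span w"
    unfolding real_span_def by (auto simp: s(2)[symmetric])
  show "\<lbrakk>k \<in> carrier K; x \<in> real_span w\<rbrakk> \<Longrightarrow> k \<odot>\<^bsub>L\<^esub> x \<in> real_span w"
    unfolding real_span_def using s(3)[of k, symmetric] by auto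
qed

lemma real_span_induct [consumes 1, case_names zero mon add]:
  assumes "x \<in> real_span w" "P \<zero>\<^bsub>L\<^esub>"
    and m: "\<And>k \<alpha>. \<lbrakk>k \<in> carrier K; \<alpha> \<in> paths_to w\<rbrakk> \<Longrightarrow> P (k \<odot>\<^bsub>L\<^esub> mon \<alpha> w)"
    and a: "\<And>x y. \<lbrakk>x \<in> real_span w; y \<in> real_span w; P x; P y\<rbrakk> \<Longrightarrow> P (x \<oplus>\<^bsub>L\<^esub> y)"
  shows "P x"
proof -
  let ?M = "free_module K (paths_to w)"
  note s = semilinearD[OF real_span_semilinear[of w]]
  obtain k where k: "k \<in> carrier ?M" "x = real_comb w k" using assms(1) by (auto simp: real_span_def)
  have "P (real_comb w k)"
    using paths_to_free k(1)
  proof (induction rule: free_on_induct)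
    case zero
    then show ?case
      using assms(2) semilinear_0[OF free_on_module[OF paths_to_free] A.L.module_axioms real_span_semilinear]
      by simp
  next
    case (delta k b)
    then show ?case using m s(3)[of k "delta K b"] real_span_delta delta_carrier[OF paths_to_free] by simp
  next
    case (add x y)
    then show ?case using a[of "real_comb w x" "real_comb w y"] s(2)[of x y] by (simp add: real_span_def)
  qed
  then show ?thesis using k by simp
qed

lemma real_span_vx: "x \<in> real_span w \<Longrightarrow> w \<in> verts E \<Longrightarrow> x \<cdot> vx w = x"
  by (induction x rule: real_span_induct)
    (auto simp: A.L.mult_smult_left A.L.mult_add_left mon_paths_to real_span_closed,
     auto simp: paths_to_def mon_vx)

lemma real_span_ed:
  assumes g: "g \<in> arcs E"
  shows "x \<in> real_span (tail E g) \<Longrightarrow> x \<cdot> ed g \<in> real_span (head E g)"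
proof (induction x rule: real_span_induct)
  case zero
  then show ?case using g by (simp add: real_span_zero)
next
  case (mon k \<alpha>)
  then obtain u where u: "awalk u \<alpha> (tail E g)" by (auto simp: paths_to_def)
  have "awalk u (\<alpha> @ [g]) (head E g)"
    using u g by (intro awalk_appendI[of u \<alpha> "tail E g"]) (auto simp: awalk_simps)
  then have "\<alpha> @ [g] \<in> paths_to (head E g)" by (auto simp: paths_to_def)
  then show ?case
    using mon g by (simp add: A.L.mult_smult_left mon_paths_to mon_ed[OF u g] real_span_smult real_span_mon)
next
  case (add x y)
  then show ?case using g by (simp add: A.L.mult_add_left real_span_closed real_span_add)
qed

text \<open>Here \<open>ghost_deg N w x\<close> means that \<open>x\<close> is a combination of products \<open>\<alpha>\<beta>\<^sup>*\<close> where \<open>\<beta>\<close> is a path from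
  \<open>w\<close> of length at most \<open>N\<close>. The closure rules add the edges of \<open>\<beta>\<close> at its start, on the right of \<open>\<beta>\<^sup>*\<close>.\<close>

inductive ghost_deg :: "nat \<Rightarrow> 'v \<Rightarrow> (('v, 'e) gen list \<Rightarrow> 'k) set \<Rightarrow> bool" where
  real: "x \<in> real_span w \<Longrightarrow> ghost_deg N w x"
| ghost: "\<lbrakk>ghost_deg N (head E e) x; e \<in> arcs E\<rbrakk> \<Longrightarrow> ghost_deg (Suc N) (tail E e) (x \<cdot> gh e)"
| add: "\<lbrakk>ghost_deg N w x; ghost_deg N w y\<rbrakk> \<Longrightarrow> ghost_deg N w (x \<oplus>\<^bsub>L\<^esub> y)"

lemma ghost_deg_closed: "ghost_deg N w x \<Longrightarrow> x \<in> carrier L"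
  by (induction rule: ghost_deg.induct) (auto intro: real_span_closed)

lemma ghost_deg_zero: "ghost_deg N w \<zero>\<^bsub>L\<^esub>"
  by (rule ghost_deg.real[OF real_span_zero])

lemma ghost_deg_0: "\<lbrakk>ghost_deg N w x; N = 0\<rbrakk> \<Longrightarrow> x \<in> real_span w"
  by (induction rule: ghost_deg.induct) (auto intro: real_span_add)

lemma ghost_deg_smult: "\<lbrakk>ghost_deg N w x; k \<in> carrier K\<rbrakk> \<Longrightarrow> ghost_deg N w (k \<odot>\<^bsub>L\<^esub> x)"
proof (induction rule: ghost_deg.induct)
  case (ghost N e x)
  then show ?case
    using ghost_deg.ghost[of N e "k \<odot>\<^bsub>L\<^esub> x"] ghost_deg_closed[OF ghost(1)]
    by (simp add: A.L.mult_smult_left)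
next
  case (add N w x y)
  then show ?case
    using ghost_deg.add[of N w "k \<odot>\<^bsub>L\<^esub> x"] ghost_deg_closed by (simp add: A.L.smult_r_distr)
qed (auto intro: ghost_deg.real real_span_smult)

lemma ghost_deg_Suc: "ghost_deg N w x \<Longrightarrow> ghost_deg (Suc N) w x"
  by (induction rule: ghost_deg.induct) (auto intro: ghost_deg.intros)

lemma ghost_deg_mono: "\<lbrakk>ghost_deg N w x; N \<le> M\<rbrakk> \<Longrightarrow> ghost_deg M w x"
  by (induction M rule: nat_induct) (auto simp: le_Suc_eq intro: ghost_deg_Suc)

lemma ghost_deg_vx: "\<lbrakk>ghost_deg N w x; w \<in> verts E\<rbrakk> \<Longrightarrow> x \<cdot> vx w = x"
  by (induction rule: ghost_deg.induct)
    (simp_all add: real_span_vx ghost_deg_closed A.L.mult_assoc A.L.mult_add_left A.Lgen.ghost_source)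

text \<open>Multiplying by an edge lowers the ghost degree, because \<open>e\<^sup>* g\<close> is a vertex or zero.\<close>

lemma ghost_deg_ed: "\<lbrakk>ghost_deg N w x; g \<in> out_arcs E w\<rbrakk> \<Longrightarrow> ghost_deg (N - 1) (head E g) (x \<cdot> ed g)"
proof (induction rule: ghost_deg.induct)
  case (real x w N)
  then show ?case by (intro ghost_deg.real real_span_ed) auto
next
  case (ghost N e x)
  have g: "g \<in> arcs E" using ghost by simp
  note xc = ghost_deg_closed[OF ghost(1)]
  have "(x \<cdot> gh e) \<cdot> ed g = (if g = e then x \<cdot> vx (head E e) else \<zero>\<^bsub>L\<^esub>)"
    using xc ghost(2) g by (simp add: A.L.mult_assoc A.Lgen.CK1_same A.Lgen.CK1_diff)
  then show ?case using ghost ghost_deg_vx[OF ghost(1)] ghost_deg_zero by simp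
next
  case (add N w x y)
  then show ?case
    using ghost_deg.add[of "N - 1"] by (simp add: A.L.mult_add_left ghost_deg_closed)
qed

definition range_proj :: "'e set \<Rightarrow> (('v, 'e) gen list \<Rightarrow> 'k) set" where
  "range_proj S = (\<Oplus>\<^bsub>L\<^esub>e\<in>S. ed e \<cdot> gh e)"

lemma range_proj_closed: "S \<subseteq> arcs E \<Longrightarrow> range_proj S \<in> carrier L"
  unfolding range_proj_def by (intro A.L.M.finsum_closed) auto

lemma mult_range_proj:
  assumes "x \<in> carrier L" "S \<subseteq> arcs E"
  shows "x \<cdot> range_proj S = (\<Oplus>\<^bsub>L\<^esub>e\<in>S. (x \<cdot> ed e) \<cdot> gh e)"
proof -
  have "x \<cdot> range_proj S = (\<Oplus>\<^bsub>L\<^esub>e\<in>S. x \<cdot> (ed e \<cdot> gh e))"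
    unfolding range_proj_def using assms by (intro A.L.mult_finsum_right) auto
  also have "\<dots> = (\<Oplus>\<^bsub>L\<^esub>e\<in>S. (x \<cdot> ed e) \<cdot> gh e)"
    using assms by (intro A.L.M.finsum_cong') (auto simp: A.L.mult_assoc subset_iff)
  finally show ?thesis .
qed

lemma gh_range_proj:
  assumes "finite S" "S \<subseteq> arcs E" "e \<in> S"
  shows "gh e \<cdot> range_proj S = gh e"
proof -
  have eE: "e \<in> arcs E" using assms by auto
  have "gh e \<cdot> range_proj S = (\<Oplus>\<^bsub>L\<^esub>g\<in>S. (gh e \<cdot> ed g) \<cdot> gh g)"
    using assms by (intro mult_range_proj) auto
  also have "\<dots> = (\<Oplus>\<^bsub>L\<^esub>g\<in>S. if e = g then gh e else \<zero>\<^bsub>L\<^esub>)"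
  proof (rule A.L.M.finsum_cong')
    show "(gh e \<cdot> ed g) \<cdot> gh g = (if e = g then gh e else \<zero>\<^bsub>L\<^esub>)" if "g \<in> S" for g
      using that assms(2) eE
      by (cases "e = g") (simp_all add: A.Lgen.CK1_same A.Lgen.CK1_diff A.Lgen.ghost_range subset_iff)
  qed (use eE in auto)
  also have "\<dots> = gh e"
    using assms eE A.L.M.finsum_singleton[of e S "\<lambda>_. gh e"] by simp
  finally show ?thesis .
qed

text \<open>An element is a combination of real paths plus a remainder that is unchanged by
  \<open>range_proj S\<close> for every large enough finite set \<open>S\<close> of edges: take the edges \<open>e\<close> for which
  the remainder involves \<open>e\<^sup>*\<close> as its last factor.\<close>

lemma ghost_deg_split:
  assumes "ghost_deg N w x"
  shows "\<exists>x0 \<in> real_span w. \<exists>r \<in> carrier L. x = x0 \<oplus>\<^bsub>L\<^esub> r \<and> (\<exists>S. finite S \<and> S \<subseteq> out_arcs E w \<and>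
    (\<forall>S'. finite S' \<and> S \<subseteq> S' \<and> S' \<subseteq> out_arcs E w \<longrightarrow> r \<cdot> range_proj S' = r))"
  using assms
proof (induction rule: ghost_deg.induct)
  case (real x w N)
  have "\<zero>\<^bsub>L\<^esub> \<cdot> range_proj S' = \<zero>\<^bsub>L\<^esub>" if "S' \<subseteq> out_arcs E w" for S'
    using that by (intro A.L.mult_zero_left range_proj_closed) auto
  then show ?case
    using real real_span_closed
    by (intro bexI[of _ x] bexI[of _ "\<zero>\<^bsub>L\<^esub>"] conjI exI[of _ "{}"]) simp_all
next
  case (ghost N e x)
  note xc = ghost_deg_closed[OF ghost(1)]
  have "(x \<cdot> gh e) \<cdot> range_proj S' = x \<cdot> gh e"
    if "finite S'" "{e} \<subseteq> S'" "S' \<subseteq> out_arcs E (tail E e)" for S'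
  proof -
    have "S' \<subseteq> arcs E" using that by auto
    then show ?thesis
      using that xc ghost(2) gh_range_proj[of S' e] by (simp add: A.L.mult_assoc range_proj_closed)
  qed
  then show ?case
    using xc ghost(2)
    by (intro bexI[of _ "\<zero>\<^bsub>L\<^esub>"] bexI[of _ "x \<cdot> gh e"] conjI exI[of _ "{e}"]) (simp_all add: real_span_zero)
next
  case (add N w x y)
  obtain x0 r S where x: "x0 \<in> real_span w" "r \<in> carrier L" "x = x0 \<oplus>\<^bsub>L\<^esub> r" "finite S" "S \<subseteq> out_arcs E w"
    and S: "\<forall>S'. finite S' \<and> S \<subseteq> S' \<and> S' \<subseteq> out_arcs E w \<longrightarrow> r \<cdot> range_proj S' = r"
    using add.IH(1) by (elim bexE exE conjE) (rule that)
  obtain y0 r' S2 where y: "y0 \<in> real_span w" "r' \<in> carrier L" "y = y0 \<oplus>\<^bsub>L\<^esub> r'" "finite S2" "S2 \<subseteq> out_arcs E w"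
    and S2: "\<forall>S'. finite S' \<and> S2 \<subseteq> S' \<and> S' \<subseteq> out_arcs E w \<longrightarrow> r' \<cdot> range_proj S' = r'"
    using add.IH(2) by (elim bexE exE conjE) (rule that)
  have "(r \<oplus>\<^bsub>L\<^esub> r') \<cdot> range_proj S' = r \<oplus>\<^bsub>L\<^esub> r'"
    if S': "finite S'" "S \<union> S2 \<subseteq> S'" "S' \<subseteq> out_arcs E w" for S'
  proof -
    have "S' \<subseteq> arcs E" using S' by auto
    then have "(r \<oplus>\<^bsub>L\<^esub> r') \<cdot> range_proj S' = r \<cdot> range_proj S' \<oplus>\<^bsub>L\<^esub> r' \<cdot> range_proj S'"
      using x(2) y(2) by (intro A.L.mult_add_left range_proj_closed)
    then show ?thesis using S S2 S' by simp
  qed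
  moreover have "x \<oplus>\<^bsub>L\<^esub> y = (x0 \<oplus>\<^bsub>L\<^esub> y0) \<oplus>\<^bsub>L\<^esub> (r \<oplus>\<^bsub>L\<^esub> r')"
    unfolding x(3) y(3) using x(1,2) y(1,2) real_span_closed by (simp add: A.L.M.a_ac)
  ultimately show ?case
    using x y real_span_add
    by (intro bexI[of _ "x0 \<oplus>\<^bsub>L\<^esub> y0"] bexI[of _ "r \<oplus>\<^bsub>L\<^esub> r'"] conjI exI[of _ "S \<union> S2"]) simp_all
qed

text \<open>Multiplying on the right by a generator at most raises the ghost degree by one, so the words in the
  generators are treated letter by letter.\<close>

lemma ghost_deg_exists:
  assumes "x \<in> carrier L"
  shows "\<forall>w \<in> verts E. \<exists>N. ghost_deg N w (x \<cdot> vx w)"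
proof -
  let ?S = "\<lambda>x. \<forall>w \<in> verts E. \<exists>N. ghost_deg N w (x \<cdot> vx w)"
  have vxS: "?S (vx v)" if v: "v \<in> verts E" for v
  proof
    fix w assume w: "w \<in> verts E"
    have "[] \<in> paths_to w" using w by (auto simp: paths_to_def awalk_simps)
    then have "ghost_deg 0 w (vx w)" using real_span_mon[of "[]" w] by (intro ghost_deg.real) simp
    then show "\<exists>N. ghost_deg N w (vx v \<cdot> vx w)"
      using v w A.Lgen.vertex_idem A.Lgen.vertex_orth ghost_deg_zero by (cases "v = w") auto
  qed
  have vx0: "(x \<cdot> vx v) \<cdot> vx w = (if v = w then x \<cdot> vx v else \<zero>\<^bsub>L\<^esub>)"
    if "x \<in> carrier L" "v \<in> verts E" "w \<in> verts E" for x v w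
    using that by (simp add: A.L.mult_assoc A.Lgen.vertex_idem A.Lgen.vertex_orth)
  have step: "?S (x \<cdot> lpa_gen K E g)" if x: "x \<in> carrier L" "?S x" and g: "g \<in> lpa_gens E" for x g
  proof (cases g)
    case (Vx v)
    then have v: "v \<in> verts E" using g by (auto simp: lpa_gens_def)
    show ?thesis unfolding Vx using x v ghost_deg_zero by (auto simp: vx0)
  next
    case (Ed e)
    then have e: "e \<in> arcs E" using g by (auto simp: lpa_gens_def)
    have "x \<cdot> ed e = (x \<cdot> vx (tail E e)) \<cdot> ed e"
      using x e by (simp add: A.L.mult_assoc A.Lgen.edge_source)
    moreover obtain N where "ghost_deg N (tail E e) (x \<cdot> vx (tail E e))" using x e tail_in_verts by blast
    ultimately have N: "ghost_deg (N - 1) (head E e) (x \<cdot> ed e)" using ghost_deg_ed e by auto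
    have eq: "(x \<cdot> ed e) \<cdot> vx (head E e) = x \<cdot> ed e"
      using x e by (simp add: A.L.mult_assoc A.Lgen.edge_range)
    have "(x \<cdot> ed e) \<cdot> vx w = (if head E e = w then x \<cdot> ed e else \<zero>\<^bsub>L\<^esub>)"
      if "w \<in> verts E" for w
      by (rule vx0[of "x \<cdot> ed e" "head E e" w, unfolded eq]) (use x(1) e that in simp_all)
    then have "\<exists>M. ghost_deg M w ((x \<cdot> ed e) \<cdot> vx w)" if "w \<in> verts E" for w
      using N ghost_deg_zero that by (cases "head E e = w") auto
    then show ?thesis unfolding Ed by blast
  next
    case (Gh e)
    then have e: "e \<in> arcs E" using g by (auto simp: lpa_gens_def)
    have "x \<cdot> gh e = (x \<cdot> vx (head E e)) \<cdot> gh e"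
      using x e by (simp add: A.L.mult_assoc A.Lgen.ghost_range)
    moreover obtain N where "ghost_deg N (head E e) (x \<cdot> vx (head E e))" using x e head_in_verts by blast
    ultimately have N: "ghost_deg (Suc N) (tail E e) (x \<cdot> gh e)" using ghost_deg.ghost e by auto
    have eq: "(x \<cdot> gh e) \<cdot> vx (tail E e) = x \<cdot> gh e"
      using x e by (simp add: A.L.mult_assoc A.Lgen.ghost_source)
    have "(x \<cdot> gh e) \<cdot> vx w = (if tail E e = w then x \<cdot> gh e else \<zero>\<^bsub>L\<^esub>)"
      if "w \<in> verts E" for w
      by (rule vx0[of "x \<cdot> gh e" "tail E e" w, unfolded eq]) (use x(1) e that in simp_all)
    then have "\<exists>M. ghost_deg M w ((x \<cdot> gh e) \<cdot> vx w)" if "w \<in> verts E" for w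
      using N ghost_deg_zero that by (cases "tail E e = w") auto
    then show ?thesis unfolding Gh by blast
  qed
  have word_S: "?S (list_mult L (map (lpa_gen K E) w))" if "set w \<subseteq> lpa_gens E" "w \<noteq> []" for w
    using that
  proof (induction w rule: rev_induct)
    case (snoc g w)
    then have g: "g \<in> lpa_gens E" by simp
    show ?case
    proof (cases "w = []")
      case True
      obtain v where v: "v \<in> verts E" "vx v \<cdot> lpa_gen K E g = lpa_gen K E g"
        using g A.Lgen.vertex_idem A.Lgen.edge_source A.Lgen.ghost_range tail_in_verts head_in_verts
        unfolding lpa_gens_def by blast
      show ?thesis using step[OF _ vxS[OF v(1)] g] v True by simp
    next
      case False
      have cl: "list_mult L (map (lpa_gen K E) w) \<in> carrier L"
        using snoc False by (intro A.L.list_mult_closed) (auto intro!: A.lpa_gen_closed)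
      have "list_mult L (map (lpa_gen K E) (w @ [g])) = list_mult L (map (lpa_gen K E) w) \<cdot> lpa_gen K E g"
        using A.L.list_mult_append[of "map (lpa_gen K E) w" "[lpa_gen K E g]"] snoc False
        by (auto intro!: A.lpa_gen_closed simp: image_subset_iff subset_iff)
      then show ?thesis using step[OF cl _ g] snoc False by simp
    qed
  qed simp
  show ?thesis
    using assms
  proof (induction rule: A.lpa_induct)
    case zero
    then show ?case using ghost_deg_zero by simp
  next
    case (word k w)
    have "list_mult L (map (lpa_gen K E) w) \<in> carrier L"
      using word by (intro A.L.list_mult_closed) (auto intro!: A.lpa_gen_closed)
    then show ?case
      using word_S[OF word(2,3)] word(1)
        ghost_deg_smult by (simp add: A.L.mult_smult_left) blast
  next
    case (add x y)
    show ?case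
    proof
      fix w assume w: "w \<in> verts E"
      obtain N M where "ghost_deg N w (x \<cdot> vx w)" "ghost_deg M w (y \<cdot> vx w)" using add w by blast
      then have "ghost_deg (max N M) w (x \<cdot> vx w \<oplus>\<^bsub>L\<^esub> y \<cdot> vx w)"
        by (intro ghost_deg.add) (auto elim: ghost_deg_mono)
      then show "\<exists>N. ghost_deg N w ((x \<oplus>\<^bsub>L\<^esub> y) \<cdot> vx w)"
        using add w by (auto simp: A.L.mult_add_left)
    qed
  qed
qed

end

section \<open>The ideal generated by \<open>I(H, B\<^sub>H)\<close> and \<open>f(c)\<close>\<close>

locale cycle_polynomial = twisted_chen E c K f
  for E :: "('v, 'e) pre_digraph" and c :: "'e list" and K :: "('k, 'm) ring_scheme"
    and f :: "int \<Rightarrow> 'k" +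
  fixes a :: "nat \<Rightarrow> 'k" and n :: nat
  assumes a_closed: "i \<in> {1..n} \<Longrightarrow> a i \<in> carrier K"
    and f_eq: "f = laurent_poly K a n"
begin

abbreviation "fc \<equiv> cycle_poly K E a n c"

lemma list_mult_path: "\<lbrakk>awalk u \<alpha> w; \<alpha> \<noteq> []\<rbrakk> \<Longrightarrow> list_mult L (map ed \<alpha>) = mon \<alpha> w"
proof (induction \<alpha> arbitrary: u)
  case (Cons e \<alpha>)
  then have e: "e \<in> arcs E" "awalk (head E e) \<alpha> w" by (auto simp: awalk_simps)
  show ?case
  proof (cases "\<alpha> = []")
    case True
    then have "head E e = w" using e by (simp add: awalk_simps)
    then show ?thesis using True A.Lgen.edge_range[OF e(1)] by simp
  next
    case False
    then show ?thesis using Cons.IH[OF e(2)] by (simp add: A.L.list_mult_Cons)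
  qed
qed simp

lemma path_elt_c: "path_elt K E c = cyc"
  unfolding path_elt_def by (rule list_mult_path[OF c_awalk c_nonempty])

lemma list_mult_replicate_cyc: "i > 0 \<Longrightarrow> list_mult L (replicate i cyc) = cpos i"
proof (induction i)
  case (Suc i)
  then show ?case
    by (cases "i = 0") (simp_all add: mon_vx[OF c_awalk] A.L.list_mult_Cons)
qed simp

lemma f_expand: "f = X 0 \<oplus>\<^bsub>LP\<^esub> (\<Oplus>\<^bsub>LP\<^esub>i\<in>{1..n}. a i \<odot>\<^bsub>LP\<^esub> X (int i))"
  unfolding f_eq laurent_poly_def by (simp add: LP_one X_pow)

lemma ev_finsum: "g \<in> J \<rightarrow> carrier LP \<Longrightarrow> ev (\<Oplus>\<^bsub>LP\<^esub>i\<in>J. g i) = (\<Oplus>\<^bsub>L\<^esub>i\<in>J. ev (g i))"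
  by (rule semilinear_sum[OF LP.module_axioms A.L.module_axioms ev_semilinear])

lemma fc_expand: "fc = cpow 0 \<oplus>\<^bsub>L\<^esub> (\<Oplus>\<^bsub>L\<^esub>i\<in>{1..n}. a i \<odot>\<^bsub>L\<^esub> cpow (int i))"
proof -
  have "(\<Oplus>\<^bsub>L\<^esub>i\<in>{1..n}. a i \<odot>\<^bsub>L\<^esub> list_mult L (replicate i (path_elt K E c))) =
      (\<Oplus>\<^bsub>L\<^esub>i\<in>{1..n}. a i \<odot>\<^bsub>L\<^esub> cpow (int i))"
    using a_closed by (intro A.L.M.finsum_cong')
      (auto simp: path_elt_c list_mult_replicate_cyc cpow_def)
  then show ?thesis unfolding cycle_poly_def v0_def[symmetric] by (simp add: cpow_def)
qed

lemma fc_eq_ev: "fc = ev f"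
proof -
  have "ev f = ev (X 0) \<oplus>\<^bsub>L\<^esub> ev (\<Oplus>\<^bsub>LP\<^esub>i\<in>{1..n}. a i \<odot>\<^bsub>LP\<^esub> X (int i))"
    unfolding f_expand using a_closed by (intro evD) auto
  also have "ev (\<Oplus>\<^bsub>LP\<^esub>i\<in>{1..n}. a i \<odot>\<^bsub>LP\<^esub> X (int i)) =
      (\<Oplus>\<^bsub>L\<^esub>i\<in>{1..n}. ev (a i \<odot>\<^bsub>LP\<^esub> X (int i)))"
    using a_closed by (intro ev_finsum) auto
  also have "\<dots> = (\<Oplus>\<^bsub>L\<^esub>i\<in>{1..n}. a i \<odot>\<^bsub>L\<^esub> cpow (int i))"
    using a_closed by (intro A.L.M.finsum_cong') (auto simp: evD ev_X)
  finally show ?thesis by (simp add: fc_expand ev_X)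
qed

lemma fc_closed: "fc \<in> carrier L"
  unfolding fc_eq_ev using f_closed by (rule evD)

text \<open>Negative powers of \<open>c\<close> multiply correctly with \<open>f(c)\<close> because \<open>f\<close> has only nonnegative exponents.\<close>

lemma cpow_fc: "ev (X j \<otimes>\<^bsub>LP\<^esub> f) = cpow j \<cdot> fc"
proof -
  let ?s = "\<Oplus>\<^bsub>LP\<^esub>i\<in>{1..n}. a i \<odot>\<^bsub>LP\<^esub> X (int i)"
  have s: "?s \<in> carrier LP" using a_closed by (intro LP.M.finsum_closed) auto
  have Xs: "X j \<otimes>\<^bsub>LP\<^esub> ?s = (\<Oplus>\<^bsub>LP\<^esub>i\<in>{1..n}. X j \<otimes>\<^bsub>LP\<^esub> (a i \<odot>\<^bsub>LP\<^esub> X (int i)))"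
    using a_closed by (intro LP.mult_finsum_right) auto
  have "ev (X j \<otimes>\<^bsub>LP\<^esub> ?s) = (\<Oplus>\<^bsub>L\<^esub>i\<in>{1..n}. ev (X j \<otimes>\<^bsub>LP\<^esub> (a i \<odot>\<^bsub>LP\<^esub> X (int i))))"
    unfolding Xs using a_closed by (intro ev_finsum) auto
  also have "\<dots> = (\<Oplus>\<^bsub>L\<^esub>i\<in>{1..n}. cpow j \<cdot> (a i \<odot>\<^bsub>L\<^esub> cpow (int i)))"
    using a_closed by (intro A.L.M.finsum_cong')
      (auto simp: LP.mult_smult_right A.L.mult_smult_right X_mult evD ev_X cpow_add_nat)
  also have "\<dots> = cpow j \<cdot> (\<Oplus>\<^bsub>L\<^esub>i\<in>{1..n}. a i \<odot>\<^bsub>L\<^esub> cpow (int i))"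
    using a_closed by (intro A.L.mult_finsum_right[symmetric]) auto
  finally have 1: "ev (X j \<otimes>\<^bsub>LP\<^esub> ?s) = cpow j \<cdot> (\<Oplus>\<^bsub>L\<^esub>i\<in>{1..n}. a i \<odot>\<^bsub>L\<^esub> cpow (int i))" .
  have 2: "X j \<otimes>\<^bsub>LP\<^esub> f = X j \<oplus>\<^bsub>LP\<^esub> X j \<otimes>\<^bsub>LP\<^esub> ?s"
    using s by (subst f_expand) (simp add: LP.mult_add_right X_mult)
  have c: "(\<Oplus>\<^bsub>L\<^esub>i\<in>{1..n}. a i \<odot>\<^bsub>L\<^esub> cpow (int i)) \<in> carrier L"
    using a_closed by (intro A.L.M.finsum_closed) auto
  have "ev (X j \<otimes>\<^bsub>LP\<^esub> f) = ev (X j) \<oplus>\<^bsub>L\<^esub> ev (X j \<otimes>\<^bsub>LP\<^esub> ?s)"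
    unfolding 2 using s by (intro evD) auto
  also have "\<dots> = cpow j \<oplus>\<^bsub>L\<^esub> cpow j \<cdot> (\<Oplus>\<^bsub>L\<^esub>i\<in>{1..n}. a i \<odot>\<^bsub>L\<^esub> cpow (int i))"
    unfolding 1 ev_X ..
  also have "\<dots> = cpow j \<cdot> fc"
    unfolding fc_expand using c cpow_add_nat[of j 0] by (simp add: A.L.mult_add_right)
  finally show ?thesis .
qed

lemma ev_mult_f:
  assumes "h \<in> carrier LP"
  shows "ev (h \<otimes>\<^bsub>LP\<^esub> f) = ev h \<cdot> fc"
proof (rule semilinear_unique[OF is_cring LP_free_on A.L.module_axioms id_ring_hom _ _ _ assms])
  show "semilinear K id LP L (\<lambda>h. ev (h \<otimes>\<^bsub>LP\<^esub> f))"
    unfolding semilinear_def using f_closed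
    by (auto simp: LP.mult_add_left LP.mult_smult_left evD)
  show "semilinear K id LP L (\<lambda>h. ev h \<cdot> fc)"
    unfolding semilinear_def using fc_closed
    by (auto simp: A.L.mult_add_left A.L.mult_smult_left evD)
  show "ev (X j \<otimes>\<^bsub>LP\<^esub> f) = ev (X j) \<cdot> fc" for j
    by (simp add: cpow_fc ev_X)
qed

lemma cpow_vx: "cpow j \<cdot> vx v0 = cpow j"
  by (simp add: cpow_def cpos_vx cneg_vx)

lemma fc_vx: "fc \<cdot> vx v0 = fc"
  unfolding fc_eq_ev
proof (rule semilinear_unique[OF is_cring LP_free_on A.L.module_axioms id_ring_hom
      comp_semilinear[OF ev_semilinear A.L.mult_left_linear] ev_semilinear _ f_closed])
  show "ev (X j) \<cdot> vx v0 = ev (X j)" for j by (simp add: ev_X cpow_vx)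
qed simp

text \<open>A path that starts at \<open>v0\<close> is \<open>q\<close>, on which \<open>f(c)\<close> acts as the class of \<open>f\<close>. On all other paths
  \<open>f(c) = f(c) v0\<close> acts as zero.\<close>

lemma fc_in_Ann: "fc \<in> Ann"
proof (rule AnnI[OF fc_closed])
  fix p assume p: "p \<in> Q"
  show "\<Phi> fc (d p) = \<zero>\<^bsub>V\<^esub>"
  proof (cases "tail E (shd p) = v0")
    case True
    then have "p = q" using Q_from_v0 p by simp
    moreover have "cls f = \<zero>\<^bsub>K'\<^esub>"
      using cls_zero_iff[OF f_closed] LP.cgenideal_self[OF f_closed] by simp
    ultimately show ?thesis using p by (simp add: fc_eq_ev \<Phi>_ev[OF f_closed])
  next
    case False
    have "\<Phi> (fc \<cdot> vx v0) (d p) = \<zero>\<^bsub>V\<^esub>"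
      using p False fc_closed by (simp add: \<Phi>_mult \<Phi>_vx \<Phi>_zero_right)
    then show ?thesis by (simp add: fc_vx)
  qed
qed

abbreviation "BH \<equiv> breaking_vertices E H"

definition I :: "(('v, 'e) gen list \<Rightarrow> 'k) set set" where
  "I = alg_ideal_gen K L (lpa_ideal K E H BH \<union> {fc})"

lemma lpa_ideal_gens: "vx ` H \<union> breaking_elt K E H ` BH \<subseteq> carrier L"
  using H_verts breaking_verts breaking_elt_closed by auto

lemma lpa_ideal_closed: "lpa_ideal K E H BH \<subseteq> carrier L"
  unfolding lpa_ideal_def by (rule A.L.alg_idealD(1)[OF A.L.alg_ideal_gen(1)[OF lpa_ideal_gens]])

lemma I_gens: "lpa_ideal K E H BH \<union> {fc} \<subseteq> carrier L"
  using lpa_ideal_closed fc_closed by simp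

lemma I_ideal: "alg_ideal K L I"
  unfolding I_def by (rule A.L.alg_ideal_gen(1)[OF I_gens])

lemma vx_in_I: "v \<in> H \<Longrightarrow> vx v \<in> I"
  and breaking_in_I: "u \<in> BH \<Longrightarrow> breaking_elt K E H u \<in> I"
  and fc_in_I: "fc \<in> I"
  using A.L.alg_ideal_gen(2)[OF I_gens] A.L.alg_ideal_gen(2)[OF lpa_ideal_gens]
  unfolding I_def lpa_ideal_def by auto

lemma I_subset_Ann: "I \<subseteq> Ann"
  unfolding I_def
proof (rule A.L.alg_ideal_gen_least[OF Ann_ideal])
  have "lpa_ideal K E H BH \<subseteq> Ann"
    unfolding lpa_ideal_def
    by (rule A.L.alg_ideal_gen_least[OF Ann_ideal]) (auto simp: vertex_in_Ann breaking_in_Ann)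
  then show "lpa_ideal K E H BH \<union> {fc} \<subseteq> Ann" using fc_in_Ann by simp
qed

section \<open>The annihilator is contained in the ideal\<close>

text \<open>Modulo \<open>I\<close> the vertex \<open>w\<close> is the sum of the \<open>ee\<^sup>*\<close> over its edges with range outside \<open>H\<close>. If \<open>w\<close> is regular
  this is the second Cuntz--Krieger relation, whose other terms factor through vertices of \<open>H\<close>. If \<open>w\<close>
  is an infinite emitter it is a breaking vertex, and the difference is the generator \<open>w\<^sup>H\<close>.\<close>

lemma finite_emission:
  assumes w: "w \<in> verts E" "w \<notin> H" and x: "x \<in> carrier L" "x \<cdot> vx w = x"
    and fin: "finite {e \<in> out_arcs E w. head E e \<notin> H}"
    and xe: "\<And>e. \<lbrakk>e \<in> out_arcs E w; head E e \<notin> H\<rbrakk> \<Longrightarrow> x \<cdot> ed e \<in> I"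
  shows "x \<in> I"
proof -
  note I = A.L.alg_idealD[OF I_ideal]
  define S where "S = {e \<in> out_arcs E w. head E e \<notin> H}"
  let ?s = "range_proj S"
  have S: "finite S" "S \<subseteq> arcs E" using fin by (auto simp: S_def)
  have sc: "?s \<in> carrier L" by (rule range_proj_closed[OF S(2)])
  obtain z where z: "z \<in> Q" "tail E (shd z) = w" using Q_exists[OF w] by blast
  have ne: "shd z \<in> S" using z Q_head_not_H[OF z(1)] tail_class_shd[OF z(1)] by (simp add: S_def)
  have 1: "x \<cdot> ?s \<in> I"
    unfolding mult_range_proj[OF x(1) S(2)]
    by (rule A.L.alg_ideal_finsum[OF I_ideal]) (auto intro!: I(9)[OF gh_closed xe] simp: S_def)
  have 2: "vx w \<ominus>\<^bsub>L\<^esub> ?s \<in> I"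
  proof (cases "finite (out_arcs E w)")
    case True
    then have reg: "regular_vertex E w"
      using w z tail_class_shd[OF z(1)] by (auto simp: regular_vertex_def)
    let ?r = "range_proj (out_arcs E w - S)"
    have "ed e \<cdot> gh e \<in> I" if "e \<in> out_arcs E w - S" for e
    proof -
      have eH: "e \<in> arcs E" "head E e \<in> H" using that by (auto simp: S_def)
      then have "(ed e \<cdot> vx (head E e)) \<cdot> gh e \<in> I"
        by (intro I(9) I(8) vx_in_I) auto
      then show ?thesis using eH by (simp add: A.Lgen.edge_range)
    qed
    then have r: "?r \<in> I"
      unfolding range_proj_def by (intro A.L.alg_ideal_finsum[OF I_ideal]) auto
    have "out_arcs E w = S \<union> (out_arcs E w - S)" by (auto simp: S_def)
    then have "range_proj (out_arcs E w) = range_proj (S \<union> (out_arcs E w - S))" by simp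
    also have "\<dots> = ?s \<oplus>\<^bsub>L\<^esub> ?r"
      unfolding range_proj_def using True S by (intro A.L.M.finsum_Un_disjoint) auto
    finally have "vx w = ?r \<oplus>\<^bsub>L\<^esub> ?s"
      using A.Lgen.CK2[OF reg] sc I(2)[OF r] by (simp add: A.L.M.a_comm range_proj_def)
    then have "vx w \<ominus>\<^bsub>L\<^esub> ?s = ?r"
      using sc I(2)[OF r] by (simp add: a_minus_def A.L.M.a_assoc A.L.M.r_neg)
    then show ?thesis using r by simp
  next
    case False
    have "w \<in> BH"
      using w False S(1) ne breaking_set[OF w(1)]
      by (auto simp: breaking_vertices_def infinite_emitter_def S_def)
    then show ?thesis using breaking_in_I by (simp add: breaking_elt_def S_def range_proj_def)
  qed
  have "x \<cdot> (vx w \<ominus>\<^bsub>L\<^esub> ?s) \<oplus>\<^bsub>L\<^esub> x \<cdot> ?s \<in> I"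
    using I(4)[OF I(8)[OF x(1) 2] 1] .
  also have "x \<cdot> (vx w \<ominus>\<^bsub>L\<^esub> ?s) \<oplus>\<^bsub>L\<^esub> x \<cdot> ?s = x"
    using x sc w by (simp add: A.L.mult_minus_right) (simp add: a_minus_def A.L.M.a_assoc A.L.M.l_neg)
  finally show ?thesis .
qed

lemma real_span_expand:
  assumes "x \<in> real_span w"
  obtains k where "finite (supp K k)" "supp K k \<subseteq> paths_to w" "\<And>\<alpha>. k \<alpha> \<in> carrier K"
    "x = (\<Oplus>\<^bsub>L\<^esub>\<alpha>\<in>supp K k. k \<alpha> \<odot>\<^bsub>L\<^esub> mon \<alpha> w)"
proof -
  obtain k where k: "k \<in> finsupp K (paths_to w)" "x = real_comb w k"
    using assms by (auto simp: real_span_def free_module_def)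
  show ?thesis
    by (rule that[OF finsupp_finite[OF k(1)] finsupp_supp[OF k(1)] finsupp_closed[OF k(1)]])
      (simp add: k(2) real_comb_def lin_ext_def)
qed

text \<open>The paths \<open>\<alpha>\<close> that end at \<open>w\<close> yield distinct basis elements \<open>\<alpha>y\<close>, and each coefficient is only changed by
  a power of \<open>x\<close>.\<close>

lemma real_span_off_cycle:
  assumes x: "x \<in> real_span w" and w: "w \<notin> C0" and y: "y \<in> Q" "tail E (shd y) = w"
    and 0: "\<Phi> x (d y) = \<zero>\<^bsub>V\<^esub>"
  shows "x = \<zero>\<^bsub>L\<^esub>"
proof -
  obtain k where sup: "finite (supp K k)" "supp K k \<subseteq> paths_to w"
    and kc: "\<And>\<alpha>. k \<alpha> \<in> carrier K" and x_eq: "x = (\<Oplus>\<^bsub>L\<^esub>\<alpha>\<in>supp K k. k \<alpha> \<odot>\<^bsub>L\<^esub> mon \<alpha> w)"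
    using x by (rule real_span_expand) blast
  have path: "\<alpha> @- y \<in> Q" if "\<alpha> \<in> paths_to w" for \<alpha>
    using that tail_class_shift[OF y(1)] y(2) by (auto simp: paths_to_def)
  have "k \<beta> = \<zero>\<^bsub>K\<^esub>" if \<beta>: "\<beta> \<in> supp K k" for \<beta>
  proof -
    have "\<zero>\<^bsub>V\<^esub> = (\<Oplus>\<^bsub>V\<^esub>\<alpha>\<in>supp K k. \<Phi> (k \<alpha> \<odot>\<^bsub>L\<^esub> mon \<alpha> w) (d y))"
      unfolding 0[symmetric] x_eq using sup kc y mon_paths_to by (intro \<Phi>_finsum_left) auto
    also have "\<dots> = (\<Oplus>\<^bsub>V\<^esub>\<alpha>\<in>supp K k. (\<iota> (k \<alpha>) \<otimes>\<^bsub>K'\<^esub> wt \<alpha>) \<odot>\<^bsub>V\<^esub> d (\<alpha> @- y))"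
    proof (rule C.V.M.finsum_cong')
      fix \<alpha> assume \<alpha>: "\<alpha> \<in> supp K k"
      then obtain u where "awalk u \<alpha> w" using sup by (auto simp: paths_to_def)
      then show "\<Phi> (k \<alpha> \<odot>\<^bsub>L\<^esub> mon \<alpha> w) (d y) = (\<iota> (k \<alpha>) \<otimes>\<^bsub>K'\<^esub> wt \<alpha>) \<odot>\<^bsub>V\<^esub> d (\<alpha> @- y)"
        using kc y path \<alpha> sup by (simp add: \<Phi>_smult_left mon_closed \<Phi>_mon C.V.smult_assoc1 subset_iff)
    qed (use kc path sup in auto)
    finally have "\<zero>\<^bsub>V\<^esub> (\<beta> @- y) = (\<Oplus>\<^bsub>V\<^esub>\<alpha>\<in>supp K k. (\<iota> (k \<alpha>) \<otimes>\<^bsub>K'\<^esub> wt \<alpha>) \<odot>\<^bsub>V\<^esub> d (\<alpha> @- y)) (\<beta> @- y)"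
      by simp
    also have "\<dots> = (\<Oplus>\<^bsub>K'\<^esub>\<alpha>\<in>supp K k. ((\<iota> (k \<alpha>) \<otimes>\<^bsub>K'\<^esub> wt \<alpha>) \<odot>\<^bsub>V\<^esub> d (\<alpha> @- y)) (\<beta> @- y))"
      using kc path sup by (intro K'.free_on_finsum_apply[OF C.V_free_on]) auto
    also have "\<dots> = (\<Oplus>\<^bsub>K'\<^esub>\<alpha>\<in>supp K k. if \<beta> = \<alpha> then \<iota> (k \<alpha>) \<otimes>\<^bsub>K'\<^esub> wt \<alpha> else \<zero>\<^bsub>K'\<^esub>)"
      using kc prefix_injective[OF w y]
      by (intro K'.finsum_cong') (auto simp: free_module_def delta_def)
    also have "\<dots> = \<iota> (k \<beta>) \<otimes>\<^bsub>K'\<^esub> wt \<beta>"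
      using kc sup \<beta> by (intro K'.add.finprod_singleton) auto
    finally have "wt \<beta> \<otimes>\<^bsub>K'\<^esub> \<iota> (k \<beta>) = \<zero>\<^bsub>K'\<^esub>"
      using kc by (simp add: free_module_def K'.m_comm)
    then have "\<iota> (k \<beta>) = \<zero>\<^bsub>K'\<^esub>" unfolding wt_def by (rule cls_X_cancel[rotated]) (use kc in simp)
    then show ?thesis using kc \<iota>_injective by blast
  qed
  then have "supp K k = {}" by (auto simp: supp_def)
  then show ?thesis by (simp add: x_eq)
qed

text \<open>The paths \<open>\<alpha>\<close> to \<open>v0\<close> with a given \<open>\<alpha>q\<close> are the products of the shortest one with powers of \<open>c\<close>.\<close>

definition shortest :: "'e stream \<Rightarrow> 'e list" where
  "shortest z = (ARG_MIN length \<gamma>. \<gamma> \<in> paths_to v0 \<and> \<gamma> @- q = z)"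

lemma shortest:
  assumes "\<alpha> \<in> paths_to v0"
  shows "shortest (\<alpha> @- q) \<in> paths_to v0" "shortest (\<alpha> @- q) @- q = \<alpha> @- q"
    "length (shortest (\<alpha> @- q)) \<le> length \<alpha>"
proof -
  let ?P = "\<lambda>\<gamma>. \<gamma> \<in> paths_to v0 \<and> \<gamma> @- q = \<alpha> @- q"
  have "?P (shortest (\<alpha> @- q))"
    unfolding shortest_def by (rule arg_min_natI[of ?P \<alpha>]) (use assms in simp)
  then show "shortest (\<alpha> @- q) \<in> paths_to v0" "shortest (\<alpha> @- q) @- q = \<alpha> @- q" by auto
  show "length (shortest (\<alpha> @- q)) \<le> length \<alpha>"
    unfolding shortest_def by (rule arg_min_nat_le[of ?P \<alpha> length]) (use assms in simp)
qed

lemma mon_cycles: "awalk v0 (concat (replicate j c)) v0 \<and> mon (concat (replicate j c)) v0 = cpos j"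
proof (induction j)
  case 0
  then show ?case by (simp add: awalk_simps)
next
  case (Suc j)
  then show ?case
    using mon_append[OF c_awalk, of "concat (replicate j c)" v0]
      awalk_appendI[OF c_awalk, of "concat (replicate j c)" v0] by simp
qed

abbreviation "Z0 \<equiv> (\<lambda>\<alpha>. \<alpha> @- q) ` paths_to v0"

lemma Z0_shortest: "z \<in> Z0 \<Longrightarrow> shortest z \<in> paths_to v0 \<and> shortest z @- q = z"
  using shortest by auto

lemma Z0_closed: "z \<in> Z0 \<Longrightarrow> mon (shortest z) v0 \<in> carrier L"
  using Z0_shortest mon_paths_to by blast

lemma mon_shortest:
  assumes "\<alpha> \<in> paths_to v0"
  shows "\<exists>j. mon \<alpha> v0 = mon (shortest (\<alpha> @- q)) v0 \<cdot> cpow (int j)"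
proof -
  define \<gamma> where "\<gamma> = shortest (\<alpha> @- q)"
  have s: "\<gamma> \<in> paths_to v0" "\<gamma> @- q = \<alpha> @- q" "length \<gamma> \<le> length \<alpha>"
    using shortest[OF assms] by (simp_all add: \<gamma>_def)
  obtain u u' where u: "awalk u \<alpha> v0" "awalk u' \<gamma> v0"
    using assms s(1) by (auto simp: paths_to_def)
  obtain j where j: "\<alpha> = \<gamma> @ concat (replicate j c)"
    using prefix_of_q[OF u s(3,2)] by blast
  have "mon \<alpha> v0 = mon \<gamma> v0 \<cdot> cpow (int j)"
    unfolding j using mon_append[OF u(2), of "concat (replicate j c)" v0] mon_cycles[of j]
    by (simp add: cpow_def)
  then show ?thesis unfolding \<gamma>_def by blast
qed

lemma real_span_v0_expand:
  assumes "x \<in> real_span v0"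
  shows "\<exists>Z g. finite Z \<and> Z \<subseteq> Z0 \<and> (\<forall>z \<in> Z. g z \<in> carrier LP) \<and>
    x = (\<Oplus>\<^bsub>L\<^esub>z\<in>Z. mon (shortest z) v0 \<cdot> ev (g z))"
proof -
  obtain k where sup: "finite (supp K k)" "supp K k \<subseteq> paths_to v0"
    and kc: "\<And>\<alpha>. k \<alpha> \<in> carrier K" and x_eq: "x = (\<Oplus>\<^bsub>L\<^esub>\<alpha>\<in>supp K k. k \<alpha> \<odot>\<^bsub>L\<^esub> mon \<alpha> v0)"
    using assms by (rule real_span_expand) blast
  have "\<forall>\<alpha> \<in> paths_to v0. \<exists>j. mon \<alpha> v0 = mon (shortest (\<alpha> @- q)) v0 \<cdot> cpow (int j)"
    using mon_shortest by (rule ballI)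
  from bchoice[OF this] obtain j
    where "\<forall>\<alpha> \<in> paths_to v0. mon \<alpha> v0 = mon (shortest (\<alpha> @- q)) v0 \<cdot> cpow (int (j \<alpha>))"
    by (elim exE) (rule that)
  note j = bspec[OF this]
  define Z where "Z = (\<lambda>\<alpha>. \<alpha> @- q) ` supp K k"
  define S where "S z = {\<alpha> \<in> supp K k. \<alpha> @- q = z}" for z
  define g where "g z = (\<Oplus>\<^bsub>LP\<^esub>\<alpha>\<in>S z. k \<alpha> \<odot>\<^bsub>LP\<^esub> X (int (j \<alpha>)))" for z
  have Z: "finite Z" "Z \<subseteq> Z0" using sup by (auto simp: Z_def)
  have gc: "g z \<in> carrier LP" for z
    unfolding g_def using kc by (intro LP.M.finsum_closed) auto
  have part: "(\<Oplus>\<^bsub>L\<^esub>\<alpha>\<in>S z. k \<alpha> \<odot>\<^bsub>L\<^esub> mon \<alpha> v0) = mon (shortest z) v0 \<cdot> ev (g z)"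
    if z: "z \<in> Z" for z
  proof -
    have m: "mon (shortest z) v0 \<in> carrier L" using z Z Z0_closed by blast
    have "ev (g z) = (\<Oplus>\<^bsub>L\<^esub>\<alpha>\<in>S z. ev (k \<alpha> \<odot>\<^bsub>LP\<^esub> X (int (j \<alpha>))))"
      unfolding g_def using kc by (intro ev_finsum) auto
    then have "mon (shortest z) v0 \<cdot> ev (g z) =
        (\<Oplus>\<^bsub>L\<^esub>\<alpha>\<in>S z. mon (shortest z) v0 \<cdot> ev (k \<alpha> \<odot>\<^bsub>LP\<^esub> X (int (j \<alpha>))))"
      using m kc by (simp add: A.L.mult_finsum_right evD Pi_def)
    also have "\<dots> = (\<Oplus>\<^bsub>L\<^esub>\<alpha>\<in>S z. k \<alpha> \<odot>\<^bsub>L\<^esub> mon \<alpha> v0)"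
    proof (rule A.L.M.finsum_cong')
      fix \<alpha> assume "\<alpha> \<in> S z"
      then have "mon \<alpha> v0 = mon (shortest z) v0 \<cdot> cpow (int (j \<alpha>))"
        using j[of \<alpha>] sup(2) by (auto simp: S_def)
      then show "mon (shortest z) v0 \<cdot> ev (k \<alpha> \<odot>\<^bsub>LP\<^esub> X (int (j \<alpha>))) = k \<alpha> \<odot>\<^bsub>L\<^esub> mon \<alpha> v0"
        using m kc by (simp add: evD ev_X A.L.mult_smult_right)
    qed (use kc sup(2) mon_paths_to in \<open>auto simp: S_def\<close>)
    finally show ?thesis ..
  qed
  have "supp K k = (\<Union>z\<in>Z. S z)" by (auto simp: Z_def S_def)
  then have "x = (\<Oplus>\<^bsub>L\<^esub>\<alpha>\<in>(\<Union>z\<in>Z. S z). k \<alpha> \<odot>\<^bsub>L\<^esub> mon \<alpha> v0)" using x_eq by simp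
  also have "\<dots> = (\<Oplus>\<^bsub>L\<^esub>z\<in>Z. \<Oplus>\<^bsub>L\<^esub>\<alpha>\<in>S z. k \<alpha> \<odot>\<^bsub>L\<^esub> mon \<alpha> v0)"
    using Z sup kc mon_paths_to
    by (intro A.L.M.add.finprod_UN_disjoint) (auto simp: S_def pairwise_def disjnt_def)
  also have "\<dots> = (\<Oplus>\<^bsub>L\<^esub>z\<in>Z. mon (shortest z) v0 \<cdot> ev (g z))"
    using Z gc Z0_closed by (intro A.L.M.finsum_cong') (auto simp: part evD subset_iff)
  finally have "x = (\<Oplus>\<^bsub>L\<^esub>z\<in>Z. mon (shortest z) v0 \<cdot> ev (g z))" .
  with Z gc show ?thesis by (intro exI[of _ Z] exI[of _ g]) simp
qed

text \<open>The basis element \<open>z\<close> occurs in \<open>xq\<close> with the class of \<open>g z\<close> times a power of \<open>x\<close> as its coefficient. So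
  \<open>f\<close> divides \<open>g z\<close>.\<close>

lemma real_span_v0:
  assumes x: "x \<in> real_span v0" "x \<in> Ann"
  shows "x \<in> I"
proof -
  obtain Z g where Z: "finite Z" "Z \<subseteq> Z0" and g': "\<forall>z \<in> Z. g z \<in> carrier LP"
    and x_eq: "x = (\<Oplus>\<^bsub>L\<^esub>z\<in>Z. mon (shortest z) v0 \<cdot> ev (g z))"
    using real_span_v0_expand[OF x(1)] by (elim exE conjE) (rule that)
  note g = bspec[OF g']
  let ?m = "\<lambda>z. mon (shortest z) v0"
  have m: "?m z \<in> carrier L" if "z \<in> Z" for z using that Z Z0_closed by blast
  have zQ: "z \<in> Q" if "z \<in> Z" for z
    using that Z tail_class_shift[OF q_in_Q] shd_q by (auto simp: paths_to_def)
  have act: "\<Phi> (?m z \<cdot> ev (g z)) (d q) = (cls (g z) \<otimes>\<^bsub>K'\<^esub> wt (shortest z)) \<odot>\<^bsub>V\<^esub> d z"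
    if z: "z \<in> Z" for z
  proof -
    have s: "shortest z \<in> paths_to v0" "shortest z @- q = z" using z Z Z0_shortest by auto
    then obtain u where "awalk u (shortest z) v0" by (auto simp: paths_to_def)
    then have "\<Phi> (?m z) (d q) = wt (shortest z) \<odot>\<^bsub>V\<^esub> d z"
      using \<Phi>_mon[OF q_in_Q shd_q] s(2) by simp
    then show ?thesis
      using m[OF z] g[OF z] q_in_Q zQ[OF z]
      by (simp add: \<Phi>_mult evD \<Phi>_ev \<Phi>_smult_right C.V.smult_assoc1)
  qed
  have cls0: "cls (g z0) = \<zero>\<^bsub>K'\<^esub>" if z0: "z0 \<in> Z" for z0
  proof -
    have "\<zero>\<^bsub>V\<^esub> = \<Phi> x (d q)" using AnnD[OF x(2) q_in_Q] by simp
    also have "\<dots> = (\<Oplus>\<^bsub>V\<^esub>z\<in>Z. \<Phi> (?m z \<cdot> ev (g z)) (d q))"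
      unfolding x_eq using m g q_in_Q by (intro \<Phi>_finsum_left) (auto simp: evD)
    also have "\<dots> = (\<Oplus>\<^bsub>V\<^esub>z\<in>Z. (cls (g z) \<otimes>\<^bsub>K'\<^esub> wt (shortest z)) \<odot>\<^bsub>V\<^esub> d z)"
      using g zQ by (intro C.V.M.finsum_cong') (auto simp: act)
    finally have "\<zero>\<^bsub>V\<^esub> z0 = (\<Oplus>\<^bsub>V\<^esub>z\<in>Z. (cls (g z) \<otimes>\<^bsub>K'\<^esub> wt (shortest z)) \<odot>\<^bsub>V\<^esub> d z) z0" by simp
    also have "\<dots> = (\<Oplus>\<^bsub>K'\<^esub>z\<in>Z. ((cls (g z) \<otimes>\<^bsub>K'\<^esub> wt (shortest z)) \<odot>\<^bsub>V\<^esub> d z) z0)"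
      using g zQ by (intro K'.free_on_finsum_apply[OF C.V_free_on]) auto
    also have "\<dots> = (\<Oplus>\<^bsub>K'\<^esub>z\<in>Z. if z0 = z then cls (g z) \<otimes>\<^bsub>K'\<^esub> wt (shortest z) else \<zero>\<^bsub>K'\<^esub>)"
      using g by (intro K'.finsum_cong') (auto simp: free_module_def delta_def)
    also have "\<dots> = cls (g z0) \<otimes>\<^bsub>K'\<^esub> wt (shortest z0)"
      using g Z z0 by (intro K'.add.finprod_singleton) auto
    finally have "wt (shortest z0) \<otimes>\<^bsub>K'\<^esub> cls (g z0) = \<zero>\<^bsub>K'\<^esub>"
      using g[OF z0] by (simp add: free_module_def K'.m_comm)
    then show ?thesis unfolding wt_def by (rule cls_X_cancel[rotated]) (use g[OF z0] in simp)
  qed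
  show ?thesis
    unfolding x_eq
  proof (rule A.L.alg_ideal_finsum[OF I_ideal], rule funcsetI)
    fix z assume z: "z \<in> Z"
    obtain h where h: "h \<in> carrier LP" "g z = h \<otimes>\<^bsub>LP\<^esub> f"
      using cls_zeroE[OF g[OF z] cls0[OF z]] by blast
    have "ev (g z) \<in> I"
      unfolding h(2) ev_mult_f[OF h(1)]
      using A.L.alg_idealD(8)[OF I_ideal evD(1)[OF h(1)] fc_in_I] .
    then show "?m z \<cdot> ev (g z) \<in> I"
      by (rule A.L.alg_idealD(8)[OF I_ideal m[OF z]])
  qed
qed

lemma C0_emission: "w \<in> C0 \<Longrightarrow> {e \<in> out_arcs E w. head E e \<notin> H} \<subseteq> set c"
  using no_exit by auto

lemma Ann_ed: "\<lbrakk>x \<in> Ann; e \<in> arcs E\<rbrakk> \<Longrightarrow> x \<cdot> ed e \<in> Ann"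
  using A.L.alg_idealD(9)[OF Ann_ideal] by simp

text \<open>A vertex of the cycle emits only one edge with range outside \<open>H\<close>, namely the next edge of \<open>c\<close>. So
  \<open>finite_emission\<close> moves the claim backwards along the cycle, starting from \<open>v0\<close>.\<close>

lemma real_span_on_cycle:
  assumes w: "w \<in> C0" and x: "x \<in> real_span w" "x \<in> Ann"
  shows "x \<in> I"
proof -
  obtain i where i: "w = tail E (q !! i)" using w C0_iff by auto
  let ?P = "\<lambda>i. \<forall>x. x \<in> real_span (tail E (q !! i)) \<longrightarrow> x \<in> Ann \<longrightarrow> x \<in> I"
  \<comment> \<open>The position \<open>length c * i\<close> is occupied by \<open>v0\<close> and is not before \<open>i\<close>.\<close>
  have "i \<le> length c * i" using c_nonempty by (cases c) auto
  then have "?P i"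
  proof (induction rule: inc_induct)
    case base
    have "q !! (length c * i) = q !! 0" unfolding q_nth by simp
    then have "tail E (q !! (length c * i)) = v0" using shd_q by simp
    then show ?case using real_span_v0 by simp
  next
    case (step j)
    define u where "u = tail E (q !! j)"
    have u: "u \<in> C0" "u \<in> verts E" "u \<notin> H"
      using C0_iff C0_verts C0_not_H by (auto simp: u_def)
    have only: "e = q !! j" if "e \<in> out_arcs E u" "head E e \<notin> H" for e
      using that C0_emission[OF u(1)] sset_q snth_sset[of q j]
      by (intro c_edge_unique) (auto simp: u_def)
    show ?case
    proof (intro allI impI)
      fix x assume x: "x \<in> real_span (tail E (q !! j))" "x \<in> Ann"
      show "x \<in> I"
      proof (rule finite_emission[OF u(2,3)])
        show "x \<in> carrier L" using x(1) by (rule real_span_closed)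
        show "x \<cdot> vx u = x" using x(1) u(2) by (simp add: real_span_vx u_def)
        show "finite {e \<in> out_arcs E u. head E e \<notin> H}"
          using C0_emission[OF u(1)] by (rule finite_subset) simp
        fix e assume e: "e \<in> out_arcs E u" "head E e \<notin> H"
        have eq: "e = q !! j" by (rule only[OF e])
        have h: "head E e = tail E (q !! Suc j)"
          unfolding eq by (rule tail_class_nth(2)[OF q_in_Q])
        have "x \<cdot> ed e \<in> real_span (head E e)"
          using e x(1) by (intro real_span_ed) (auto simp: u_def)
        moreover have "x \<cdot> ed e \<in> Ann" using e x(2) by (intro Ann_ed) auto
        ultimately show "x \<cdot> ed e \<in> I" using step.IH unfolding h by blast
      qed
    qed
  qed
  then show ?thesis using x i by blast
qed

text \<open>Only a vertex \<open>w\<close> with infinitely many edges to the complement of \<open>H\<close> escapes \<open>finite_emission\<close>. There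
  some edge \<open>g\<close> is not used by the ghost part \<open>r\<close> of \<open>x\<close>, so \<open>r\<close> kills every path that starts with \<open>g\<close>
  and the real part \<open>x0\<close> has to kill it too.\<close>

lemma ghost_deg_Ann_in_I:
  "\<lbrakk>w \<in> verts E; ghost_deg N w x; x \<in> Ann\<rbrakk> \<Longrightarrow> x \<in> I"
proof (induction N arbitrary: w x)
  case 0
  then have x: "x \<in> real_span w" using ghost_deg_0 by blast
  consider "w \<in> H" | "w \<in> C0" | "w \<notin> H" "w \<notin> C0" by blast
  then show ?case
  proof cases
    case 1
    then have "x \<cdot> vx w \<in> I"
      using A.L.alg_idealD(8)[OF I_ideal] vx_in_I real_span_closed[OF x] by blast
    then show ?thesis using real_span_vx[OF x 0(1)] by simp
  next
    case 2
    then show ?thesis using x 0(3) by (rule real_span_on_cycle)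
  next
    case 3
    obtain y where y: "y \<in> Q" "tail E (shd y) = w" using Q_exists[OF 0(1) 3(1)] by blast
    have "x = \<zero>\<^bsub>L\<^esub>" by (rule real_span_off_cycle[OF x 3(2) y AnnD[OF 0(3) y(1)]])
    then show ?thesis using A.L.alg_idealD(3)[OF I_ideal] by simp
  qed
next
  case (Suc N)
  note w = Suc.prems(1) and x = Suc.prems(2,3)
  note xc = ghost_deg_closed[OF x(1)]
  have xe: "x \<cdot> ed e \<in> I" if "e \<in> out_arcs E w" for e
    using that Suc.IH[of "head E e" "x \<cdot> ed e"] ghost_deg_ed[OF x(1) that] Ann_ed[OF x(2)] by simp
  consider "w \<in> H" | "w \<notin> H" "finite {e \<in> out_arcs E w. head E e \<notin> H}"
    | "w \<notin> H" "infinite {e \<in> out_arcs E w. head E e \<notin> H}" by blast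
  then show ?case
  proof cases
    case 1
    then have "x \<cdot> vx w \<in> I"
      using A.L.alg_idealD(8)[OF I_ideal] vx_in_I xc by blast
    then show ?thesis using ghost_deg_vx[OF x(1) w] by simp
  next
    case 2
    show ?thesis
      by (rule finite_emission[OF w 2(1) xc ghost_deg_vx[OF x(1) w] 2(2)]) (rule xe)
  next
    case 3
    have wC0: "w \<notin> C0" using 3(2) finite_subset[OF C0_emission] by auto
    obtain x0 r S where r: "x0 \<in> real_span w" "r \<in> carrier L" "x = x0 \<oplus>\<^bsub>L\<^esub> r" "finite S" "S \<subseteq> out_arcs E w"
      and S: "\<forall>S'. finite S' \<and> S \<subseteq> S' \<and> S' \<subseteq> out_arcs E w \<longrightarrow> r \<cdot> range_proj S' = r"
      using ghost_deg_split[OF x(1)] by (elim bexE exE conjE) (rule that)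
    have rS: "r \<cdot> range_proj S = r" using S r by simp
    have SE: "S \<subseteq> arcs E" using r(5) by auto
    have "infinite ({e \<in> out_arcs E w. head E e \<notin> H} - S)"
      using 3(2) r(4) by simp
    then obtain g where g: "g \<in> out_arcs E w" "head E g \<notin> H" "g \<notin> S"
      by (metis (no_types, lifting) DiffE ex_in_conv finite.emptyI mem_Collect_eq)
    obtain z where z: "g ## z \<in> Q" using Q_exists_edge[of g] g by auto
    have "\<Phi> (range_proj S) (d (g ## z)) = (\<Oplus>\<^bsub>V\<^esub>e\<in>S. \<Phi> (ed e \<cdot> gh e) (d (g ## z)))"
      unfolding range_proj_def using SE z by (intro \<Phi>_finsum_left) auto
    also have "\<dots> = (\<Oplus>\<^bsub>V\<^esub>e\<in>S. \<zero>\<^bsub>V\<^esub>)"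
      using SE g(3) z by (intro C.V.M.finsum_cong') (auto simp: \<Phi>_ed_gh)
    finally have "\<Phi> (r \<cdot> range_proj S) (d (g ## z)) = \<zero>\<^bsub>V\<^esub>"
      using r(2) z by (simp add: \<Phi>_mult range_proj_closed[OF SE] \<Phi>_zero_right)
    then have "\<Phi> x0 (d (g ## z)) = \<Phi> x (d (g ## z))"
      unfolding r(3) rS using real_span_closed[OF r(1)] r(2) z \<Phi>_closed by (simp add: \<Phi>_add_left)
    also have "\<dots> = \<zero>\<^bsub>V\<^esub>" by (rule AnnD[OF x(2) z])
    finally have "x0 = \<zero>\<^bsub>L\<^esub>"
      using g by (intro real_span_off_cycle[OF r(1) wC0 z]) auto
    then have "x = x \<cdot> range_proj S" using r(2,3) rS by simp
    also have "\<dots> = (\<Oplus>\<^bsub>L\<^esub>e\<in>S. (x \<cdot> ed e) \<cdot> gh e)" by (rule mult_range_proj[OF xc SE])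
    also have "\<dots> \<in> I"
      using SE r(5) by (intro A.L.alg_ideal_finsum[OF I_ideal])
        (auto intro!: A.L.alg_idealD(9)[OF I_ideal gh_closed xe])
    finally show ?thesis .
  qed
qed

theorem Ann_eq_I: "Ann = I"
proof
  show "I \<subseteq> Ann" by (rule I_subset_Ann)
  show "Ann \<subseteq> I"
  proof
    fix x assume x: "x \<in> Ann"
    then have xc: "x \<in> carrier L" by (simp add: Ann_def)
    show "x \<in> I"
    proof (rule A.local_right_units[OF xc I_ideal])
      fix w assume w: "w \<in> verts E"
      obtain N where "ghost_deg N w (x \<cdot> vx w)" using ghost_deg_exists[OF xc] w by blast
      moreover have "x \<cdot> vx w \<in> Ann"
        using A.L.alg_idealD(9)[OF Ann_ideal] x w by simp
      ultimately show "x \<cdot> vx w \<in> I" using ghost_deg_Ann_in_I[OF w] by blast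
    qed
  qed
qed

end

lemma (in laurent_field) laurent_poly_closed:
  assumes "\<And>i. i \<in> {1..n} \<Longrightarrow> a i \<in> carrier K"
  shows "laurent_poly K a n \<in> carrier (laurent K)"
  unfolding laurent_poly_def using assms
  by (intro LP.M.a_closed LP.M.finsum_closed) auto

theorem lemma3p4:
  fixes E :: "('v, 'e) pre_digraph"
    and K :: "('k, 'm) ring_scheme"
    and a :: "nat \<Rightarrow> 'k"
    and n :: nat
    and c :: "'e list"
    and q :: "'e stream"
    and f :: "int \<Rightarrow> 'k"
  assumes "wf_digraph E"
    and "field K"
    and "n \<ge> 1"
    and "\<And>i. i \<in> {1..n} \<Longrightarrow> a i \<in> carrier K"
    and "f = laurent_poly K a n"
    and "ring_irreducible\<^bsub>laurent K\<^esub> f"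
    and "exclusive_cycle E c"
    and "q = Stream.cycle c"
  shows "annihilator (lpa K E) (twisted_chen_module K E c f) =
    alg_ideal_gen K (lpa K E)
      (lpa_ideal K E (H_path E q) (breaking_vertices E (H_path E q)) \<union> {cycle_poly K E a n c})"
proof -
  interpret laurent_field K using assms(2) by (rule laurent_field.intro)
  have "f \<in> carrier (laurent K)"
    unfolding assms(5) using assms(4) by (rule laurent_poly_closed)
  then interpret P: cycle_polynomial E c K f a n
    using assms
    by (intro cycle_polynomial.intro twisted_chen.intro exclusive_cycle_graph.intro
        exclusive_cycle_graph_axioms.intro laurent_quotient.intro laurent_field.intro
        laurent_quotient_axioms.intro cycle_polynomial_axioms.intro)
  show ?thesis
    using P.annihilator_eq P.Ann_eq_I unfolding P.I_def P.q_def assms(8)[symmetric] by simp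
qed

end
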